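(* Suppose $\mathcal{M}$ and $\mathcal{N}$ are models of $\mathsf{ZF}$ and $\mathcal{N}$ is a proper end extension of $\mathcal{M}$ that is also a faithful extension of $\mathcal{M}$. Then: (a) There is $\gamma\in\mathrm{Ord}^{\mathcal{N}}\setminus\mathrm{Ord}^{\mathcal{M}}$ such that $\mathcal{M}\preceq\mathcal{N}_\gamma$. Thus either $\mathcal{M}=\mathcal{N}_\gamma$, in which case $\mathcal{N}$ is a topped rank extension of $\mathcal{M}$, or $\mathcal{M}\prec\mathcal{N}_\gamma$. (b) In particular, there is a full satisfaction class $S$ for $\mathcal{M}$ such that $S=D\cap M$ for some $\mathcal{N}$-definable set $D$.
   Context: Structures are in $\{=,\in\}$; "definable" means with parameters. $\mathrm{Ext}_{\mathcal{K}}(c)=\{m\in K: m\in^{\mathcal{K}}c\}$; $\mathrm{Ord}^{\mathcal{K}}$ is the set of ordinals of $\mathcal{K}$. $\mathcal{N}$ is an end extension of $\mathcal{M}$ if $\mathcal{M}\subseteq\mathcal{N}$ and $\mathrm{Ext}_{\mathcal{N}}(a)=\mathrm{Ext}_{\mathcal{M}}(a)$ for all $a\in M$. $\mathcal{N}$ is a faithful extension of $\mathcal{M}$ if for every $\mathcal{N}$-definable $D$, $(\mathcal{M},D\cap M)\models\mathsf{ZF}(\mathrm{X})$ (separation and collection for formulas with an extra predicate $\mathrm{X}$ interpreted as $D\cap M$). For $\gamma\in\mathrm{Ord}^{\mathcal{N}}$, $\mathcal{N}_\gamma$ is the substructure with universe $\{m\in N:\mathcal{N}\models m\in\mathrm{V}_\gamma\}$.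 A rank extension is an end extension with $\mathcal{N}\models\mathrm{rank}(a)\in\mathrm{rank}(b)$ for all $a\in M$, $b\in N\setminus M$; it is topped if $\mathrm{Ord}^{\mathcal{N}}\setminus\mathrm{Ord}^{\mathcal{M}}$ has a least element. A full satisfaction class for $\mathcal{M}$ is $S\subseteq M$ such that for each metatheoretic $k\in\omega$, $(\mathcal{M},S)$ satisfies Tarski's clauses for all $\Sigma_k$-sentences in $\mathcal{M}$'s sense (built from $\neg,\vee,\exists$ with constants $\dot a$ for all sets $a$): $\mathrm{S}(\dot x=\dot y)\leftrightarrow x=y$, $\mathrm{S}(\dot x\in\dot y)\leftrightarrow x\in y$, $\mathrm{S}(\neg\psi)\leftrightarrow\neg\mathrm{S}(\psi)$, $\mathrm{S}(\psi_1\vee\psi_2)\leftrightarrow\mathrm{S}(\psi_1)\vee\mathrm{S}(\psi_2)$, $\mathrm{S}(\exists v\,\psi(v))\leftrightarrow\exists x\,\mathrm{S}(\psi(\dot x))$. *)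

theory Defs
  imports Main
begin

section \<open>Structures for the language of set theory\<close>

record 'a sstruct =
  univ :: "'a set"
  mem :: "('a \<times> 'a) set"

definition set_structure :: "'a sstruct \<Rightarrow> bool" where
  "set_structure K \<longleftrightarrow> univ K \<noteq> {} \<and> mem K \<subseteq> univ K \<times> univ K"

definition Ext :: "'a sstruct \<Rightarrow> 'a \<Rightarrow> 'a set" where
  "Ext K c = {m \<in> univ K. (m, c) \<in> mem K}"

definition restrict_struct :: "'a sstruct \<Rightarrow> 'a set \<Rightarrow> 'a sstruct" where
  "restrict_struct K A = \<lparr>univ = univ K \<inter> A, mem = mem K \<inter> (A \<times> A)\<rparr>"

definition substructure :: "'a sstruct \<Rightarrow> 'a sstruct \<Rightarrow> bool" where
  "substructure M N \<longleftrightarrow> univ M \<subseteq> univ N \<and> mem M = mem N \<inter> (univ M \<times> univ M)"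

definition end_extension :: "'a sstruct \<Rightarrow> 'a sstruct \<Rightarrow> bool" where
  "end_extension M N \<longleftrightarrow> substructure M N \<and> (\<forall>a\<in>univ M. Ext N a = Ext M a)"


section \<open>First-order formulas, with an extra unary predicate X\<close>

datatype fm =
    EqF nat nat
  | MemF nat nat
  | XF nat
  | NegF fm
  | OrF fm fm
  | ExF nat fm

primrec X_free :: "fm \<Rightarrow> bool" where
  "X_free (EqF i j) \<longleftrightarrow> True"
| "X_free (MemF i j) \<longleftrightarrow> True"
| "X_free (XF i) \<longleftrightarrow> False"
| "X_free (NegF p) \<longleftrightarrow> X_free p"
| "X_free (OrF p q) \<longleftrightarrow> X_free p \<and> X_free q"
| "X_free (ExF i p) \<longleftrightarrow> X_free p"

primrec sat :: "'a sstruct \<Rightarrow> 'a set \<Rightarrow> (nat \<Rightarrow> 'a) \<Rightarrow> fm \<Rightarrow> bool" where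
  "sat K X e (EqF i j) \<longleftrightarrow> e i = e j"
| "sat K X e (MemF i j) \<longleftrightarrow> e i \<in> Ext K (e j)"
| "sat K X e (XF i) \<longleftrightarrow> e i \<in> X"
| "sat K X e (NegF p) \<longleftrightarrow> \<not> sat K X e p"
| "sat K X e (OrF p q) \<longleftrightarrow> sat K X e p \<or> sat K X e q"
| "sat K X e (ExF i p) \<longleftrightarrow> (\<exists>a\<in>univ K. sat K X (e(i := a)) p)"

text \<open>For X-free formulas the interpretation of X is irrelevant; it is then taken to be empty.
  Parameters are supplied by the assignment.\<close>

definition definable :: "'a sstruct \<Rightarrow> 'a set \<Rightarrow> bool" where
  "definable K D \<longleftrightarrow> (\<exists>p e. X_free p \<and> range e \<subseteq> univ K \<and>
     D = {x \<in> univ K. sat K {} (e(0 := x)) p})"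

definition elementary_sub :: "'a sstruct \<Rightarrow> 'a sstruct \<Rightarrow> bool" where
  "elementary_sub M N \<longleftrightarrow> substructure M N \<and>
     (\<forall>p e. X_free p \<longrightarrow> range e \<subseteq> univ M \<longrightarrow> (sat M {} e p \<longleftrightarrow> sat N {} e p))"

definition proper_elementary_sub :: "'a sstruct \<Rightarrow> 'a sstruct \<Rightarrow> bool" where
  "proper_elementary_sub M N \<longleftrightarrow> elementary_sub M N \<and> M \<noteq> N"


section \<open>ZF and ZF(X)\<close>

definition separation :: "'a sstruct \<Rightarrow> 'a set \<Rightarrow> fm \<Rightarrow> bool" where
  "separation K X p \<longleftrightarrow> (\<forall>e. range e \<subseteq> univ K \<longrightarrow>
     (\<forall>a\<in>univ K. \<exists>b\<in>univ K. Ext K b = {x \<in> Ext K a. sat K X (e(0 := x)) p}))"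

definition collection :: "'a sstruct \<Rightarrow> 'a set \<Rightarrow> fm \<Rightarrow> bool" where
  "collection K X p \<longleftrightarrow> (\<forall>e. range e \<subseteq> univ K \<longrightarrow>
     (\<forall>a\<in>univ K.
        (\<forall>x\<in>Ext K a. \<exists>y\<in>univ K. sat K X (e(0 := x, 1 := y)) p) \<longrightarrow>
        (\<exists>b\<in>univ K. \<forall>x\<in>Ext K a. \<exists>y\<in>Ext K b. sat K X (e(0 := x, 1 := y)) p)))"

definition ZF_finite_part :: "'a sstruct \<Rightarrow> bool" where
  "ZF_finite_part K \<longleftrightarrow>
     (\<forall>x\<in>univ K. \<forall>y\<in>univ K. Ext K x = Ext K y \<longrightarrow> x = y) \<and>
     (\<forall>x\<in>univ K. Ext K x \<noteq> {} \<longrightarrow> (\<exists>y\<in>Ext K x. Ext K y \<inter> Ext K x = {})) \<and>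
     (\<forall>x\<in>univ K. \<forall>y\<in>univ K. \<exists>z\<in>univ K. Ext K z = {x, y}) \<and>
     (\<forall>x\<in>univ K. \<exists>u\<in>univ K. Ext K u = (\<Union>y\<in>Ext K x. Ext K y)) \<and>
     (\<forall>x\<in>univ K. \<exists>p\<in>univ K. Ext K p = {z \<in> univ K. Ext K z \<subseteq> Ext K x}) \<and>
     (\<exists>w\<in>univ K. (\<exists>z\<in>Ext K w. Ext K z = {}) \<and>
        (\<forall>x\<in>Ext K w. \<exists>y\<in>Ext K w. Ext K y = insert x (Ext K x)))"

definition models_ZF :: "'a sstruct \<Rightarrow> bool" where
  "models_ZF K \<longleftrightarrow> ZF_finite_part K \<and>
     (\<forall>p. X_free p \<longrightarrow> separation K {} p \<and> collection K {} p)"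

definition models_ZFX :: "'a sstruct \<Rightarrow> 'a set \<Rightarrow> bool" where
  "models_ZFX K X \<longleftrightarrow> ZF_finite_part K \<and> (\<forall>p. separation K X p \<and> collection K X p)"

definition faithful_extension :: "'a sstruct \<Rightarrow> 'a sstruct \<Rightarrow> bool" where
  "faithful_extension M N \<longleftrightarrow> substructure M N \<and>
     (\<forall>D. definable N D \<longrightarrow> models_ZFX M (D \<inter> univ M))"


section \<open>Set-theoretic notions evaluated inside a structure\<close>

text \<open>\<open>the_set K A\<close> is the element of K whose extension is A. It is only used where K, a model
  of ZF, has exactly one such element.\<close>

definition the_set :: "'a sstruct \<Rightarrow> 'a set \<Rightarrow> 'a" where
  "the_set K A = (THE c. c \<in> univ K \<and> Ext K c = A)"

definition pair :: "'a sstruct \<Rightarrow> 'a \<Rightarrow> 'a \<Rightarrow> 'a" where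
  "pair K a b = the_set K {the_set K {a}, the_set K {a, b}}"

primrec numeral_in :: "'a sstruct \<Rightarrow> nat \<Rightarrow> 'a" where
  "numeral_in K 0 = the_set K {}"
| "numeral_in K (Suc k) = the_set K (insert (numeral_in K k) (Ext K (numeral_in K k)))"

text \<open>Transitive and well-ordered by membership, in the sense of K.\<close>

definition Ord :: "'a sstruct \<Rightarrow> 'a set" where
  "Ord K = {x \<in> univ K.
     (\<forall>y\<in>Ext K x. Ext K y \<subseteq> Ext K x) \<and>
     (\<forall>y\<in>Ext K x. y \<notin> Ext K y) \<and>
     (\<forall>y\<in>Ext K x. \<forall>z\<in>Ext K x. \<forall>w\<in>Ext K x. y \<in> Ext K z \<and> z \<in> Ext K w \<longrightarrow> y \<in> Ext K w) \<and>
     (\<forall>y\<in>Ext K x. \<forall>z\<in>Ext K x. y \<in> Ext K z \<or> y = z \<or> z \<in> Ext K y) \<and>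
     (\<forall>s\<in>univ K. Ext K s \<subseteq> Ext K x \<and> Ext K s \<noteq> {} \<longrightarrow>
        (\<exists>m\<in>Ext K s. \<forall>y\<in>Ext K s. m = y \<or> m \<in> Ext K y))}"

text \<open>The natural numbers in the sense of K, possibly nonstandard.\<close>

definition omega_in :: "'a sstruct \<Rightarrow> 'a set" where
  "omega_in K = {n \<in> Ord K. \<forall>m\<in>insert n (Ext K n).
     Ext K m = {} \<or> (\<exists>l\<in>Ext K m. Ext K m = insert l (Ext K l))}"

text \<open>The element f of K is, in the sense of K, a function with domain d, and F gives its values.\<close>

definition codes_fun :: "'a sstruct \<Rightarrow> 'a \<Rightarrow> 'a \<Rightarrow> ('a \<Rightarrow> 'a) \<Rightarrow> bool" where
  "codes_fun K f d F \<longleftrightarrow> f \<in> univ K \<and> F ` Ext K d \<subseteq> univ K \<and>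
     Ext K f = (\<lambda>x. pair K x (F x)) ` Ext K d"

text \<open>K satisfies \<open>v = V\<^sub>\<gamma>\<close>, where \<open>V\<^sub>\<alpha> = \<Union>\<^sub>\<beta>\<^sub><\<^sub>\<alpha> P(V\<^sub>\<beta>)\<close>;
  the recursion is witnessed by a function f in K with domain \<open>\<gamma>\<close>.\<close>

definition is_V :: "'a sstruct \<Rightarrow> 'a \<Rightarrow> 'a \<Rightarrow> bool" where
  "is_V K \<gamma> v \<longleftrightarrow> \<gamma> \<in> Ord K \<and> v \<in> univ K \<and>
     (\<exists>f F. codes_fun K f \<gamma> F \<and>
        (\<forall>\<alpha>\<in>Ext K \<gamma>. Ext K (F \<alpha>) = {z \<in> univ K. \<exists>\<beta>\<in>Ext K \<alpha>. Ext K z \<subseteq> Ext K (F \<beta>)}) \<and>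
        Ext K v = {z \<in> univ K. \<exists>\<beta>\<in>Ext K \<gamma>. Ext K z \<subseteq> Ext K (F \<beta>)})"

definition V_substructure :: "'a sstruct \<Rightarrow> 'a \<Rightarrow> 'a sstruct" where
  "V_substructure K \<gamma> = restrict_struct K {m \<in> univ K. \<exists>v. is_V K \<gamma> v \<and> m \<in> Ext K v}"

text \<open>The rank of x is the least \<open>\<alpha>\<close> with \<open>x \<in> V\<^bsub>\<alpha>+1\<^esub>\<close>, i.e. \<open>x \<subseteq> V\<^sub>\<alpha>\<close>.\<close>

definition is_rank :: "'a sstruct \<Rightarrow> 'a \<Rightarrow> 'a \<Rightarrow> bool" where
  "is_rank K x \<alpha> \<longleftrightarrow> (\<exists>v. is_V K \<alpha> v \<and> Ext K x \<subseteq> Ext K v) \<and>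
     (\<forall>\<beta>\<in>Ext K \<alpha>. \<not> (\<exists>w. is_V K \<beta> w \<and> Ext K x \<subseteq> Ext K w))"

definition rank_extension :: "'a sstruct \<Rightarrow> 'a sstruct \<Rightarrow> bool" where
  "rank_extension M N \<longleftrightarrow> end_extension M N \<and>
     (\<forall>a\<in>univ M. \<forall>b\<in>univ N - univ M.
        \<exists>\<alpha> \<beta>. is_rank N a \<alpha> \<and> is_rank N b \<beta> \<and> \<alpha> \<in> Ext N \<beta>)"

definition topped_rank_extension :: "'a sstruct \<Rightarrow> 'a sstruct \<Rightarrow> bool" where
  "topped_rank_extension M N \<longleftrightarrow> rank_extension M N \<and>
     (\<exists>\<gamma>\<in>Ord N - Ord M. \<forall>\<delta>\<in>Ord N - Ord M. \<gamma> = \<delta> \<or> \<gamma> \<in> Ext N \<delta>)"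


section \<open>Formulas in the sense of a structure\<close>

text \<open>Codes are tagged pairs formed inside K. Variables \<open>v\<^sub>i\<close> are indexed by the natural numbers i
  of K, and every element a of K has a constant.\<close>

definition tagged :: "'a sstruct \<Rightarrow> nat \<Rightarrow> 'a \<Rightarrow> 'a" where
  "tagged K k a = pair K (numeral_in K k) a"

definition cVar :: "'a sstruct \<Rightarrow> 'a \<Rightarrow> 'a" where
  "cVar K i = tagged K 0 i"

definition cConst :: "'a sstruct \<Rightarrow> 'a \<Rightarrow> 'a" where
  "cConst K a = tagged K 1 a"

definition cEq :: "'a sstruct \<Rightarrow> 'a \<Rightarrow> 'a \<Rightarrow> 'a" where
  "cEq K t u = tagged K 2 (pair K t u)"

definition cMem :: "'a sstruct \<Rightarrow> 'a \<Rightarrow> 'a \<Rightarrow> 'a" where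
  "cMem K t u = tagged K 3 (pair K t u)"

definition cNeg :: "'a sstruct \<Rightarrow> 'a \<Rightarrow> 'a" where
  "cNeg K \<phi> = tagged K 4 \<phi>"

definition cOr :: "'a sstruct \<Rightarrow> 'a \<Rightarrow> 'a \<Rightarrow> 'a" where
  "cOr K \<phi> \<psi> = tagged K 5 (pair K \<phi> \<psi>)"

definition cEx :: "'a sstruct \<Rightarrow> 'a \<Rightarrow> 'a \<Rightarrow> 'a" where
  "cEx K i \<phi> = tagged K 6 (pair K i \<phi>)"

definition cTerm :: "'a sstruct \<Rightarrow> 'a set" where
  "cTerm K = cVar K ` omega_in K \<union> cConst K ` univ K"

text \<open>Inductive definitions inside K: x is generated by the rules R if K contains a sequence F,
  whose length n is a natural number of K, that lists x and in which every entry follows by R from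
  the set of entries before it.\<close>

definition generated :: "'a sstruct \<Rightarrow> ('a set \<Rightarrow> 'a \<Rightarrow> bool) \<Rightarrow> 'a \<Rightarrow> bool" where
  "generated K R x \<longleftrightarrow> (\<exists>n f F. n \<in> omega_in K \<and> codes_fun K f n F \<and> x \<in> F ` Ext K n \<and>
     (\<forall>i\<in>Ext K n. R (F ` Ext K i) (F i)))"

text \<open>Pairs of a formula and the set of indices of its free variables.\<close>

inductive fv_step :: "'a sstruct \<Rightarrow> 'a set \<Rightarrow> 'a \<Rightarrow> bool" for K Y where
  "\<lbrakk>t \<in> cTerm K; u \<in> cTerm K; s \<in> univ K;
    Ext K s = {i \<in> omega_in K. cVar K i = t \<or> cVar K i = u}\<rbrakk>
   \<Longrightarrow> fv_step K Y (pair K (cEq K t u) s)"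
| "\<lbrakk>t \<in> cTerm K; u \<in> cTerm K; s \<in> univ K;
    Ext K s = {i \<in> omega_in K. cVar K i = t \<or> cVar K i = u}\<rbrakk>
   \<Longrightarrow> fv_step K Y (pair K (cMem K t u) s)"
| "\<lbrakk>\<phi> \<in> univ K; s \<in> univ K; pair K \<phi> s \<in> Y\<rbrakk> \<Longrightarrow> fv_step K Y (pair K (cNeg K \<phi>) s)"
| "\<lbrakk>\<phi> \<in> univ K; s \<in> univ K; pair K \<phi> s \<in> Y; \<psi> \<in> univ K; r \<in> univ K; pair K \<psi> r \<in> Y;
    q \<in> univ K; Ext K q = Ext K s \<union> Ext K r\<rbrakk>
   \<Longrightarrow> fv_step K Y (pair K (cOr K \<phi> \<psi>) q)"
| "\<lbrakk>i \<in> omega_in K; \<phi> \<in> univ K; s \<in> univ K; pair K \<phi> s \<in> Y;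
    q \<in> univ K; Ext K q = Ext K s - {i}\<rbrakk>
   \<Longrightarrow> fv_step K Y (pair K (cEx K i \<phi>) q)"

definition sentence_in :: "'a sstruct \<Rightarrow> 'a \<Rightarrow> bool" where
  "sentence_in K \<phi> \<longleftrightarrow> \<phi> \<in> univ K \<and> generated K (fv_step K) (pair K \<phi> (the_set K {}))"

text \<open>Pairs of a formula and the result of replacing the free occurrences of \<open>v\<^sub>j\<close> in it by the
  constant for c.\<close>

definition term_subst :: "'a sstruct \<Rightarrow> 'a \<Rightarrow> 'a \<Rightarrow> 'a \<Rightarrow> 'a" where
  "term_subst K j c t = (if t = cVar K j then cConst K c else t)"

inductive subst_step :: "'a sstruct \<Rightarrow> 'a \<Rightarrow> 'a \<Rightarrow> 'a set \<Rightarrow> 'a \<Rightarrow> bool" for K j c Y where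
  "\<lbrakk>t \<in> cTerm K; u \<in> cTerm K\<rbrakk>
   \<Longrightarrow> subst_step K j c Y (pair K (cEq K t u) (cEq K (term_subst K j c t) (term_subst K j c u)))"
| "\<lbrakk>t \<in> cTerm K; u \<in> cTerm K\<rbrakk>
   \<Longrightarrow> subst_step K j c Y (pair K (cMem K t u) (cMem K (term_subst K j c t) (term_subst K j c u)))"
| "\<lbrakk>\<phi> \<in> univ K; \<phi>' \<in> univ K; pair K \<phi> \<phi>' \<in> Y\<rbrakk>
   \<Longrightarrow> subst_step K j c Y (pair K (cNeg K \<phi>) (cNeg K \<phi>'))"
| "\<lbrakk>\<phi> \<in> univ K; \<phi>' \<in> univ K; pair K \<phi> \<phi>' \<in> Y; \<psi> \<in> univ K; \<psi>' \<in> univ K; pair K \<psi> \<psi>' \<in> Y\<rbrakk>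
   \<Longrightarrow> subst_step K j c Y (pair K (cOr K \<phi> \<psi>) (cOr K \<phi>' \<psi>'))"
| "\<lbrakk>i \<in> omega_in K; \<phi> \<in> univ K; \<phi>' \<in> univ K; pair K \<phi> \<phi>' \<in> Y\<rbrakk>
   \<Longrightarrow> subst_step K j c Y (pair K (cEx K i \<phi>) (cEx K i (if i = j then \<phi> else \<phi>')))"

definition is_subst :: "'a sstruct \<Rightarrow> 'a \<Rightarrow> 'a \<Rightarrow> 'a \<Rightarrow> 'a \<Rightarrow> bool" where
  "is_subst K j c \<phi> \<phi>' \<longleftrightarrow> \<phi> \<in> univ K \<and> \<phi>' \<in> univ K \<and>
     generated K (subst_step K j c) (pair K \<phi> \<phi>')"


section \<open>The Levy hierarchy in the sense of a structure\<close>

text \<open>Only negation, disjunction and existential quantification are primitive. In the last rule the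
  formula reads \<open>\<exists>v\<^sub>i \<in> t. \<not>\<phi>\<close>: with \<open>\<phi>\<close> a negation it is the bounded existential quantifier (where
  \<open>\<alpha> \<and> \<beta>\<close> abbreviates \<open>\<not>(\<not>\<alpha> \<or> \<not>\<beta>)\<close>), and its negation is the bounded universal one.\<close>

inductive Delta0_step :: "'a sstruct \<Rightarrow> 'a set \<Rightarrow> 'a \<Rightarrow> bool" for K Y where
  "\<lbrakk>t \<in> cTerm K; u \<in> cTerm K\<rbrakk> \<Longrightarrow> Delta0_step K Y (cEq K t u)"
| "\<lbrakk>t \<in> cTerm K; u \<in> cTerm K\<rbrakk> \<Longrightarrow> Delta0_step K Y (cMem K t u)"
| "\<phi> \<in> Y \<Longrightarrow> Delta0_step K Y (cNeg K \<phi>)"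
| "\<lbrakk>\<phi> \<in> Y; \<psi> \<in> Y\<rbrakk> \<Longrightarrow> Delta0_step K Y (cOr K \<phi> \<psi>)"
| "\<lbrakk>i \<in> omega_in K; t \<in> cTerm K; t \<noteq> cVar K i; \<phi> \<in> Y\<rbrakk>
   \<Longrightarrow> Delta0_step K Y (cEx K i (cNeg K (cOr K (cNeg K (cMem K (cVar K i) t)) \<phi>)))"

text \<open>Passage from the class B of \<open>\<Sigma>\<^sub>k\<close> formulas to \<open>\<Sigma>\<^bsub>k+1\<^esub>\<close>: the \<open>\<Sigma>\<^sub>k\<close> formulas and their
  negations (the \<open>\<Pi>\<^sub>k\<close> formulas), closed under disjunction, conjunction, existential quantification
  and double negation. Double negations occur because a block of universal quantifiers
  \<open>\<forall>x\<forall>y \<phi>\<close> is literally \<open>\<not>\<exists>x\<not>\<not>\<exists>y\<not>\<phi>\<close>.\<close>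

inductive Sigma_step :: "'a sstruct \<Rightarrow> 'a set \<Rightarrow> 'a set \<Rightarrow> 'a \<Rightarrow> bool" for K B Y where
  "\<phi> \<in> B \<Longrightarrow> Sigma_step K B Y \<phi>"
| "\<phi> \<in> B \<Longrightarrow> Sigma_step K B Y (cNeg K \<phi>)"
| "\<lbrakk>\<phi> \<in> Y; \<psi> \<in> Y\<rbrakk> \<Longrightarrow> Sigma_step K B Y (cOr K \<phi> \<psi>)"
| "\<lbrakk>\<phi> \<in> Y; \<psi> \<in> Y\<rbrakk> \<Longrightarrow> Sigma_step K B Y (cNeg K (cOr K (cNeg K \<phi>) (cNeg K \<psi>)))"
| "\<lbrakk>i \<in> omega_in K; \<phi> \<in> Y\<rbrakk> \<Longrightarrow> Sigma_step K B Y (cEx K i \<phi>)"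
| "\<phi> \<in> Y \<Longrightarrow> Sigma_step K B Y (cNeg K (cNeg K \<phi>))"

primrec Sigma_formulas :: "'a sstruct \<Rightarrow> nat \<Rightarrow> 'a set" where
  "Sigma_formulas K 0 = {\<phi> \<in> univ K. generated K (Delta0_step K) \<phi>}"
| "Sigma_formulas K (Suc k) =
     {\<phi> \<in> univ K. generated K (Sigma_step K (Sigma_formulas K k)) \<phi>}"

definition Sigma_sentences :: "'a sstruct \<Rightarrow> nat \<Rightarrow> 'a set" where
  "Sigma_sentences K k = {\<phi> \<in> Sigma_formulas K k. sentence_in K \<phi>}"


section \<open>Full satisfaction classes\<close>

definition Tarski_clauses :: "'a sstruct \<Rightarrow> nat \<Rightarrow> 'a set \<Rightarrow> bool" where
  "Tarski_clauses K k S \<longleftrightarrow>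
     (\<forall>x\<in>univ K. \<forall>y\<in>univ K. cEq K (cConst K x) (cConst K y) \<in> S \<longleftrightarrow> x = y) \<and>
     (\<forall>x\<in>univ K. \<forall>y\<in>univ K. cMem K (cConst K x) (cConst K y) \<in> S \<longleftrightarrow> x \<in> Ext K y) \<and>
     (\<forall>\<psi>\<in>univ K. cNeg K \<psi> \<in> Sigma_sentences K k \<longrightarrow> (cNeg K \<psi> \<in> S \<longleftrightarrow> \<psi> \<notin> S)) \<and>
     (\<forall>\<psi>\<^sub>1\<in>univ K. \<forall>\<psi>\<^sub>2\<in>univ K. cOr K \<psi>\<^sub>1 \<psi>\<^sub>2 \<in> Sigma_sentences K k \<longrightarrow>
        (cOr K \<psi>\<^sub>1 \<psi>\<^sub>2 \<in> S \<longleftrightarrow> \<psi>\<^sub>1 \<in> S \<or> \<psi>\<^sub>2 \<in> S)) \<and>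
     (\<forall>i\<in>omega_in K. \<forall>\<psi>\<in>univ K. cEx K i \<psi> \<in> Sigma_sentences K k \<longrightarrow>
        (cEx K i \<psi> \<in> S \<longleftrightarrow> (\<exists>x\<in>univ K. \<exists>\<psi>'. is_subst K i x \<psi> \<psi>' \<and> \<psi>' \<in> S)))"

definition full_satisfaction_class :: "'a sstruct \<Rightarrow> 'a set \<Rightarrow> bool" where
  "full_satisfaction_class K S \<longleftrightarrow> S \<subseteq> univ K \<and> (\<forall>k. Tarski_clauses K k S)"

end

theory Submission
  imports Defs
begin

text \<open>
  Faithfulness implies that a subset in \<open>N\<close> of an element of \<open>M\<close> belongs to \<open>M\<close>; hence \<open>V\<^sub>\<alpha>\<close> is the
  same in \<open>M\<close> and \<open>N\<close> for all ordinals \<open>\<alpha>\<close> of \<open>M\<close>, and \<open>N\<close> is a rank extension with new ordinals.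
  Fix a new ordinal \<open>c\<close> and close it under the operations that send \<open>\<gamma>\<close> to the least rank of a
  witness in \<open>V\<^sub>\<gamma>\<close> for an existential formula with parameters in \<open>M\<close>. The ordinals obtained are
  named by elements of \<open>M\<close>, and \<open>N\<close> defines the evaluation of names. Among the values outside \<open>M\<close>
  there is a least one, \<open>\<gamma>\<close>: otherwise replacement in \<open>M\<close>, with a predicate for the order of the
  values, produces a set of names whose values have no minimum. Minimality of \<open>\<gamma>\<close> means that least
  ranks of witnesses in \<open>V\<^sub>\<gamma>\<close> lie in \<open>M\<close>, so \<open>M\<close> is elementary in \<open>V\<^sub>\<gamma>\<close>, even for the formulas in
  the sense of \<open>M\<close>, and the satisfaction relation of \<open>V\<^sub>\<gamma>\<close> restricts to a full satisfaction class.
\<close>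

section \<open>Definability with parameters\<close>

text \<open>The obstacle is that M is in general not definable in N, so the well-foundedness of N
  from inside yields no least ordinal outside M. Faithfulness gives M separation and collection for
  the traces of classes of N; the descent is therefore carried out in M, with the evaluation of
  names as its only access to the new ordinals. This dictates two uses of ranks. A witness is
  replaced by the least rank of a witness, since N need not have a definable choice of witnesses; a
  witness whose rank lies in M lies in M itself, because the levels of M do not grow in N. And the
  descent passes through levels of names instead of single names, since M need not satisfy dependent
  choice. The models may be ill-founded from outside, and formulas in the sense of M may have
  nonstandard length. Hence inductions and recursions on sets, or on such formulas, take place
  inside the models, which is why every predicate and operation below comes with a proof that it is
  definable.\<close>

primrec fm_vars :: "fm \<Rightarrow> nat set" where
  "fm_vars (EqF i j) = {i, j}"
| "fm_vars (MemF i j) = {i, j}"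
| "fm_vars (XF i) = {i}"
| "fm_vars (NegF p) = fm_vars p"
| "fm_vars (OrF p q) = fm_vars p \<union> fm_vars q"
| "fm_vars (ExF i p) = insert i (fm_vars p)"

lemma finite_fm_vars: "finite (fm_vars p)"
  by (induction p) auto

lemma sat_cong: "(\<And>n. n \<in> fm_vars p \<Longrightarrow> e n = e' n) \<Longrightarrow> sat K X e p \<longleftrightarrow> sat K X e' p"
proof (induction p arbitrary: e e')
  case (ExF i p)
  have "sat K X (e(i := a)) p \<longleftrightarrow> sat K X (e'(i := a)) p" for a
    using ExF.prems by (intro ExF.IH) auto
  then show ?case by simp
next
  case (OrF p q)
  show ?case using OrF.prems OrF.IH(1)[of e e'] OrF.IH(2)[of e e'] by simp
next
  case (NegF p)
  show ?case using NegF.prems NegF.IH[of e e'] by simp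
qed simp_all

text \<open>The map \<open>f\<close> need not be injective, so a renamed bound variable could
  capture others; it is replaced by one outside the image of all variables of the body.\<close>

lemma sat_rename: "\<exists>q. \<forall>e. sat K X e q \<longleftrightarrow> sat K X (\<lambda>n. e (f n)) p"
proof (induction p arbitrary: f)
  case (EqF i j)
  then show ?case by (intro exI[of _ "EqF (f i) (f j)"]) simp
next
  case (MemF i j)
  then show ?case by (intro exI[of _ "MemF (f i) (f j)"]) simp
next
  case (XF i)
  then show ?case by (intro exI[of _ "XF (f i)"]) simp
next
  case (NegF p)
  then obtain q where "\<forall>e. sat K X e q \<longleftrightarrow> sat K X (\<lambda>n. e (f n)) p" by blast
  then show ?case by (intro exI[of _ "NegF q"]) simp
next
  case (OrF p1 p2)
  then obtain q1 q2 where "\<forall>e. sat K X e q1 \<longleftrightarrow> sat K X (\<lambda>n. e (f n)) p1"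
    "\<forall>e. sat K X e q2 \<longleftrightarrow> sat K X (\<lambda>n. e (f n)) p2" by metis
  then show ?case by (intro exI[of _ "OrF q1 q2"]) simp
next
  case (ExF i p)
  obtain m where m: "m \<notin> f ` fm_vars p"
    using ex_new_if_finite[OF infinite_UNIV_nat finite_imageI[OF finite_fm_vars]] by blast
  obtain q where q: "\<forall>e. sat K X e q \<longleftrightarrow> sat K X (\<lambda>n. e ((f(i := m)) n)) p"
    using ExF.IH by blast
  have "sat K X (e(m := a)) q \<longleftrightarrow> sat K X ((\<lambda>n. e (f n))(i := a)) p" for e a
    using m q by (auto intro!: sat_cong)
  then show ?case by (intro exI[of _ "ExF m q"]) simp
qed

section \<open>Predicates and functions definable with parameters\<close>

definition Env :: "'a sstruct \<Rightarrow> (nat \<Rightarrow> 'a) set" where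
  "Env K = {e. range e \<subseteq> univ K}"

definition interleave :: "(nat \<Rightarrow> 'a) \<Rightarrow> (nat \<Rightarrow> 'a) \<Rightarrow> nat \<Rightarrow> 'a" where
  "interleave e c n = (if even n then e (n div 2) else c (n div 2))"

text \<open>A predicate on assignments is definable if it is expressed by a formula whose even variables
  are read off the assignment and whose odd variables hold parameters.\<close>

definition Def :: "'a sstruct \<Rightarrow> 'a set \<Rightarrow> ((nat \<Rightarrow> 'a) \<Rightarrow> bool) \<Rightarrow> bool" where
  "Def K X P \<longleftrightarrow> (\<exists>p c. c \<in> Env K \<and> (\<forall>e\<in>Env K. P e \<longleftrightarrow> sat K X (interleave e c) p))"

text \<open>A function of the assignment counts as a term if its graph is definable. As with de
  Bruijn indices, variable 0 is the new one (here the value) and the old assignment is shifted by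
  one; the rules for quantifiers and separation follow the same convention.\<close>

definition tm :: "'a sstruct \<Rightarrow> 'a set \<Rightarrow> ((nat \<Rightarrow> 'a) \<Rightarrow> 'a) \<Rightarrow> bool" where
  "tm K X t \<longleftrightarrow> (\<forall>e\<in>Env K. t e \<in> univ K) \<and> Def K X (\<lambda>e. e 0 = t (\<lambda>n. e (Suc n)))"

lemma Env_nth [simp]: "e \<in> Env K \<Longrightarrow> e n \<in> univ K"
  by (auto simp: Env_def)

lemma Env_Suc [simp]: "e \<in> Env K \<Longrightarrow> (\<lambda>n. e (f n)) \<in> Env K"
  by (auto simp: Env_def)

lemma Env_case_nat [simp]: "e \<in> Env K \<Longrightarrow> a \<in> univ K \<Longrightarrow> case_nat a e \<in> Env K"
  by (auto simp: Env_def split: nat.splits)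

lemma Env_interleave: "e \<in> Env K \<Longrightarrow> c \<in> Env K \<Longrightarrow> interleave e c \<in> Env K"
  by (auto simp: Env_def interleave_def)

lemma Env_upd [simp]: "e \<in> Env K \<Longrightarrow> a \<in> univ K \<Longrightarrow> e(i := a) \<in> Env K"
  by (auto simp: Env_def)

lemma Def_cong: "(\<And>e. e \<in> Env K \<Longrightarrow> P e \<longleftrightarrow> Q e) \<Longrightarrow> Def K X P \<longleftrightarrow> Def K X Q"
  by (simp add: Def_def)

lemma Def_neg: "Def K X P \<Longrightarrow> Def K X (\<lambda>e. \<not> P e)"
  unfolding Def_def by (metis sat.simps(4))

lemma Def_or:
  assumes "Def K X P" "Def K X Q"
  shows "Def K X (\<lambda>e. P e \<or> Q e)"
proof -
  obtain p c where p: "c \<in> Env K" "\<forall>e\<in>Env K. P e \<longleftrightarrow> sat K X (interleave e c) p"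
    using assms(1) unfolding Def_def by blast
  obtain q d where q: "d \<in> Env K" "\<forall>e\<in>Env K. Q e \<longleftrightarrow> sat K X (interleave e d) q"
    using assms(2) unfolding Def_def by blast
  \<comment> \<open>The two parameter lists are merged: entry b of \<open>c\<close> moves to
    variable 4b + 1, entry b of \<open>d\<close> to 4b + 3.\<close>
  define f where "f n = (if even n then n else 4 * (n div 2) + 1)" for n :: nat
  define g where "g n = (if even n then n else 4 * (n div 2) + 3)" for n :: nat
  have f: "(\<lambda>n. interleave e (interleave c d) (f n)) = interleave e c" for e
    by (auto simp: f_def interleave_def fun_eq_iff elim!: oddE)
  have [simp]: "(4 * b + 3) div 2 = Suc (2 * b)" for b :: nat by simp
  have g: "(\<lambda>n. interleave e (interleave c d) (g n)) = interleave e d" for e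
    by (auto simp: g_def interleave_def fun_eq_iff elim!: oddE)
  obtain p' where p': "\<forall>e. sat K X e p' \<longleftrightarrow> sat K X (\<lambda>n. e (f n)) p"
    using sat_rename[of K X] by blast
  obtain q' where q': "\<forall>e. sat K X e q' \<longleftrightarrow> sat K X (\<lambda>n. e (g n)) q"
    using sat_rename[of K X] by blast
  show ?thesis
    unfolding Def_def using p q
    by (intro exI[of _ "OrF p' q'"] exI[of _ "interleave c d"])
      (simp add: p' q' f g Env_interleave)
qed

lemma Def_and: "Def K X P \<Longrightarrow> Def K X Q \<Longrightarrow> Def K X (\<lambda>e. P e \<and> Q e)"
  using Def_neg[OF Def_or[OF Def_neg Def_neg], of K X P Q] by simp

lemma Def_imp: "Def K X P \<Longrightarrow> Def K X Q \<Longrightarrow> Def K X (\<lambda>e. P e \<longrightarrow> Q e)"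
  unfolding imp_conv_disj by (intro Def_or Def_neg)

lemma Def_iff: "Def K X P \<Longrightarrow> Def K X Q \<Longrightarrow> Def K X (\<lambda>e. P e \<longleftrightarrow> Q e)"
  unfolding iff_conv_conj_imp by (intro Def_and Def_imp)

lemma Def_ex:
  assumes "Def K X (\<lambda>e. Q (e 0) (\<lambda>n. e (Suc n)))"
  shows "Def K X (\<lambda>e. \<exists>a\<in>univ K. Q a e)"
proof -
  obtain p c where p: "c \<in> Env K"
    "\<forall>e\<in>Env K. Q (e 0) (\<lambda>n. e (Suc n)) \<longleftrightarrow> sat K X (interleave e c) p"
    using assms unfolding Def_def by blast
  \<comment> \<open>Even variables hold the assignment. The one at 0 becomes the bound variable
    \<open>m\<close>; the later ones move down by 2, which undoes the shift.\<close>
  define h where "h n = (if even n then n - 2 else n)" for n :: nat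
  obtain m where m: "m \<notin> h ` fm_vars p"
    using ex_new_if_finite[OF infinite_UNIV_nat finite_imageI[OF finite_fm_vars]] by blast
  obtain q where q: "\<forall>e. sat K X e q \<longleftrightarrow> sat K X (\<lambda>n. e ((h(0 := m)) n)) p"
    using sat_rename[of K X] by blast
  have "sat K X ((interleave e c)(m := a)) q \<longleftrightarrow> Q a e" if "e \<in> Env K" "a \<in> univ K" for e a
  proof -
    have "sat K X ((interleave e c)(m := a)) q \<longleftrightarrow> sat K X (interleave (case_nat a e) c) p"
      unfolding q[rule_format]
    proof (rule sat_cong)
      fix n assume n: "n \<in> fm_vars p"
      have "h n \<noteq> m" using m n by blast
      moreover have "e ((n - 2) div 2) = case_nat a e (n div 2)" if "n \<noteq> 0" "even n"
        using that by (auto elim!: evenE split: nat.splits simp: diff_mult_distrib2[symmetric])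
      ultimately show "((interleave e c)(m := a)) ((h(0 := m)) n) = interleave (case_nat a e) c n"
        by (auto simp: h_def interleave_def)
    qed
    also have "\<dots> \<longleftrightarrow> Q a e"
      using p(2)[rule_format, of "case_nat a e"] that by simp
    finally show ?thesis .
  qed
  then show ?thesis
    unfolding Def_def using p(1) by (intro exI[of _ "ExF m q"] exI[of _ c]) simp
qed

lemma Def_all:
  assumes "Def K X (\<lambda>e. Q (e 0) (\<lambda>n. e (Suc n)))"
  shows "Def K X (\<lambda>e. \<forall>a\<in>univ K. Q a e)"
  using Def_neg[OF Def_ex[of K X "\<lambda>a e. \<not> Q a e", OF Def_neg[OF assms]]] by simp

lemma Def_rename: "Def K X P \<Longrightarrow> Def K X (\<lambda>e. P (\<lambda>n. e (f n)))"
proof -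
  assume "Def K X P"
  then obtain p c where p: "c \<in> Env K" "\<forall>e\<in>Env K. P e \<longleftrightarrow> sat K X (interleave e c) p"
    unfolding Def_def by blast
  define g where "g n = (if even n then 2 * f (n div 2) else n)" for n
  obtain q where q: "\<forall>e. sat K X e q \<longleftrightarrow> sat K X (\<lambda>n. e (g n)) p"
    using sat_rename[of K X] by blast
  have "(\<lambda>n. interleave e c (g n)) = interleave (\<lambda>n. e (f n)) c" for e
    by (auto simp: g_def interleave_def fun_eq_iff)
  then show ?thesis
    unfolding Def_def using p by (intro exI[of _ q] exI[of _ c]) (simp add: q)
qed

lemma Def_var_eq:
  assumes "univ K \<noteq> {}"
  shows "Def K X (\<lambda>e. e i = e j)"
proof -
  obtain z where "z \<in> univ K" using assms by blast
  then show ?thesis unfolding Def_def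
    by (intro exI[of _ "EqF (2*i) (2*j)"] exI[of _ "\<lambda>_. z"]) (auto simp: interleave_def Env_def)
qed

lemma Def_var_mem:
  assumes "univ K \<noteq> {}"
  shows "Def K X (\<lambda>e. e i \<in> Ext K (e j))"
proof -
  obtain z where "z \<in> univ K" using assms by blast
  then show ?thesis unfolding Def_def
    by (intro exI[of _ "MemF (2*i) (2*j)"] exI[of _ "\<lambda>_. z"]) (auto simp: interleave_def Env_def)
qed

lemma Def_var_X:
  assumes "univ K \<noteq> {}"
  shows "Def K X (\<lambda>e. e i \<in> X)"
proof -
  obtain z where "z \<in> univ K" using assms by blast
  then show ?thesis unfolding Def_def
    by (intro exI[of _ "XF (2*i)"] exI[of _ "\<lambda>_. z"]) (auto simp: interleave_def Env_def)
qed

lemma tm_const: "c \<in> univ K \<Longrightarrow> tm K X (\<lambda>e. c)"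
  unfolding tm_def Def_def
  by (auto intro!: exI[of _ "EqF 0 1"] exI[of _ "\<lambda>_. c"] simp: interleave_def Env_def)

lemma tm_var: "univ K \<noteq> {} \<Longrightarrow> tm K X (\<lambda>e. e i)"
  unfolding tm_def by (auto intro: Def_var_eq)

lemma tm_in: "tm K X t \<Longrightarrow> e \<in> Env K \<Longrightarrow> t e \<in> univ K"
  by (simp add: tm_def)

lemma tm_rename: "tm K X t \<Longrightarrow> tm K X (\<lambda>e. t (\<lambda>n. e (f n)))"
  using Def_rename[of K X "\<lambda>e. e 0 = t (\<lambda>n. e (Suc n))" "case_nat 0 (\<lambda>n. Suc (f n))"]
  by (simp add: tm_def)

text \<open>Substituting a term costs one quantifier over its value, since a term is given only by
  its graph.\<close>

lemma Def_inst:
  assumes "tm K X t" "Def K X (\<lambda>e. P (e 0) (\<lambda>n. e (Suc n)))"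
  shows "Def K X (\<lambda>e. P (t e) e)"
proof -
  have "Def K X (\<lambda>e. \<exists>a\<in>univ K. a = t e \<and> P a e)"
    using assms by (intro Def_ex Def_and) (simp add: tm_def)
  then show ?thesis
    by (rule Def_cong[THEN iffD1, rotated]) (use assms(1) in \<open>auto simp: tm_def\<close>)
qed

lemma Def_inst2:
  assumes "tm K X t" "tm K X s" "Def K X (\<lambda>e. P (e 0) (e (Suc 0)))"
  shows "Def K X (\<lambda>e. P (t e) (s e))"
proof -
  have "Def K X (\<lambda>e. P (e (Suc 0)) (e 0))"
    using Def_rename[OF assms(3), of "\<lambda>n. if n = 0 then Suc 0 else 0"] by simp
  then have "Def K X (\<lambda>e. P (e 0) (s (\<lambda>n. e (Suc n))))"
    by (intro Def_inst[OF tm_rename[OF assms(2)], of "\<lambda>a e. P (e 0) a"])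
  then show ?thesis by (rule Def_inst[OF assms(1), of "\<lambda>a e. P a (s e)"])
qed

lemma tm_inst:
  assumes "tm K X t" "tm K X (\<lambda>e. F (e 0) (\<lambda>n. e (Suc n)))"
  shows "tm K X (\<lambda>e. F (t e) e)"
proof -
  have "Def K X (\<lambda>e. e 0 = F (e (Suc 0)) (\<lambda>n. e (Suc (Suc n))))"
    using assms(2) by (simp add: tm_def)
  from Def_rename[OF this, of "\<lambda>n. if n = 0 then Suc 0 else if n = Suc 0 then 0 else n"]
  have "Def K X (\<lambda>e. e (Suc 0) = F (e 0) (\<lambda>n. e (Suc (Suc n))))"
    by simp
  then have "Def K X (\<lambda>e. e 0 = F (t (\<lambda>n. e (Suc n))) (\<lambda>n. e (Suc n)))"
    by (rule Def_inst[OF tm_rename[OF assms(1)], of "\<lambda>a e. e 0 = F a (\<lambda>n. e (Suc n))"])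
  moreover have "F (t e) e \<in> univ K" if "e \<in> Env K" for e
    using tm_in[OF assms(2), of "case_nat (t e) e"] tm_in[OF assms(1)] that by simp
  ultimately show ?thesis by (simp add: tm_def)
qed

lemma tm_comp3:
  assumes "tm K X t" "tm K X s" "tm K X r" "tm K X (\<lambda>e. F (e 0) (e (Suc 0)) (e (Suc (Suc 0))))"
  shows "tm K X (\<lambda>e. F (t e) (s e) (r e))"
proof -
  have "tm K X (\<lambda>e. F (e (Suc (Suc 0))) (e (Suc 0)) (e 0))"
    using tm_rename[OF assms(4), of "\<lambda>n. if n = 0 then Suc (Suc 0) else if n = Suc 0 then Suc 0 else 0"]
    by simp
  then have "tm K X (\<lambda>e. F (e (Suc 0)) (e 0) (r (\<lambda>n. e (Suc (Suc n)))))"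
    by (rule tm_inst[OF tm_rename[OF assms(3)], of "\<lambda>a e. F (e (Suc 0)) (e 0) a"])
  then have "tm K X (\<lambda>e. F (e 0) (s (\<lambda>n. e (Suc n))) (r (\<lambda>n. e (Suc n))))"
    by (rule tm_inst[OF tm_rename[OF assms(2)], of "\<lambda>a e. F (e 0) a (r (\<lambda>n. e (Suc n)))"])
  then show ?thesis by (rule tm_inst[OF assms(1), of "\<lambda>a e. F a (s e) (r e)"])
qed

text \<open>Freezes all variables but the first as parameters, which is what separation under a
  given assignment requires.\<close>

lemma Def_fix:
  assumes "Def K X (\<lambda>e. P (e 0) (\<lambda>n. e (Suc n)))" "d \<in> Env K"
  shows "Def K X (\<lambda>e. P (e 0) d)"
proof -
  obtain p c where p: "c \<in> Env K"
    "\<forall>e\<in>Env K. P (e 0) (\<lambda>n. e (Suc n)) \<longleftrightarrow> sat K X (interleave e c) p"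
    using assms(1) unfolding Def_def by blast
  \<comment> \<open>Variable 2k + 2, which held \<open>d k\<close>, moves to the odd position 4k +
    1; the old parameter at 2k + 1 moves to 4k + 3.\<close>
  define f where "f n = (if n = 0 then 0 else if even n then 2 * (n - 2) + 1 else 2 * n + 1)" for n :: nat
  obtain q where q: "\<forall>e. sat K X e q \<longleftrightarrow> sat K X (\<lambda>n. e (f n)) p" using sat_rename[of K X] by blast
  have "P (e 0) d \<longleftrightarrow> sat K X (interleave e (interleave d c)) q" if "e \<in> Env K" for e
  proof -
    have "interleave e (interleave d c) (f n) = interleave (case_nat (e 0) d) c n" for n
      by (auto simp: interleave_def f_def elim!: evenE oddE split: nat.splits)
    then have "(\<lambda>n. interleave e (interleave d c) (f n)) = interleave (case_nat (e 0) d) c"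
      by blast
    then show ?thesis
      using p(2)[rule_format, of "case_nat (e 0) d"] q that assms(2) by simp
  qed
  then show ?thesis
    unfolding Def_def using Env_interleave[OF assms(2) p(1)] by blast
qed

lemma tm_if:
  assumes "Def K X P" "tm K X t" "tm K X s"
  shows "tm K X (\<lambda>e. if P e then t e else s e)"
proof -
  let ?sh = "\<lambda>e n. e (Suc n)"
  have D: "Def K X (\<lambda>e. (P (?sh e) \<and> e 0 = t (?sh e)) \<or> (\<not> P (?sh e) \<and> e 0 = s (?sh e)))"
    using assms(2,3) unfolding tm_def
    by (intro Def_or Def_and Def_neg Def_rename[OF assms(1)]) blast+
  have "Def K X (\<lambda>e. e 0 = (if P (?sh e) then t (?sh e) else s (?sh e)))"
    by (rule Def_cong[THEN iffD1, OF _ D]) auto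
  then show ?thesis using assms(2,3) by (simp add: tm_def)
qed

lemma X_free_equiv: "\<exists>q. X_free q \<and> (\<forall>e. sat K {} e q \<longleftrightarrow> sat K {} e p)"
proof (induction p)
  case (EqF i j)
  show ?case by (intro exI[of _ "EqF i j"]) simp
next
  case (MemF i j)
  show ?case by (intro exI[of _ "MemF i j"]) simp
next
  case (XF i)
  show ?case by (intro exI[of _ "NegF (EqF i i)"]) simp
next
  case (NegF p)
  then show ?case by (metis X_free.simps(4) sat.simps(4))
next
  case (OrF p q)
  then show ?case by (metis X_free.simps(5) sat.simps(5))
next
  case (ExF i p)
  then show ?case by (metis X_free.simps(6) sat.simps(6))
qed

text \<open>If X is empty, an atom for X can be replaced by a contradiction. So plain ZF is an
  instance of ZF(X), and one locale serves for M, for N, and for M expanded by the trace of a class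
  of N.\<close>

lemma models_ZFX_empty:
  assumes "models_ZF K"
  shows "models_ZFX K {}"
proof -
  have "separation K {} p \<and> collection K {} p" for p
  proof -
    obtain q where q: "X_free q" "\<forall>e. sat K {} e q \<longleftrightarrow> sat K {} e p"
      using X_free_equiv[of K p] by blast
    then have "separation K {} q \<and> collection K {} q"
      using assms unfolding models_ZF_def by blast
    with q(2) show ?thesis unfolding separation_def collection_def by simp
  qed
  with assms show ?thesis unfolding models_ZF_def models_ZFX_def by blast
qed

lemma Def_definable:
  assumes "Def K {} (\<lambda>e. P (e 0))"
  shows "definable K {x \<in> univ K. P x}"
proof -
  obtain p c where p: "c \<in> Env K" "\<forall>e\<in>Env K. P (e 0) \<longleftrightarrow> sat K {} (interleave e c) p"
    using assms unfolding Def_def by blast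
  obtain q where q: "X_free q" "\<forall>e. sat K {} e q \<longleftrightarrow> sat K {} e p" using X_free_equiv[of K p] by blast
  have "P x \<longleftrightarrow> sat K {} ((interleave c c)(0 := x)) q" if "x \<in> univ K" for x
  proof -
    have "(interleave c c)(0 := x) = interleave (c(0 := x)) c"
      by (auto simp: interleave_def fun_eq_iff)
    then show ?thesis using p(2)[rule_format, of "c(0 := x)"] p(1) q(2) that by simp
  qed
  then show ?thesis unfolding definable_def
    using q(1) Env_interleave[OF p(1) p(1)] by (auto simp: Env_def intro!: exI[of _ q])
qed

section \<open>Set theory inside a structure\<close>

locale zfx =
  fixes K :: "'a sstruct" and X :: "'a set"
  assumes set_structure: "set_structure K" and models_ZFX: "models_ZFX K X"
begin

lemma univ_ne: "univ K \<noteq> {}"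
  using set_structure by (simp add: set_structure_def)

lemma Ext_univ: "x \<in> Ext K a \<Longrightarrow> x \<in> univ K"
  by (simp add: Ext_def)

lemma finite_part: "ZF_finite_part K"
  using models_ZFX by (simp add: models_ZFX_def)

lemmas finite_part' = finite_part[unfolded ZF_finite_part_def]
lemmas extensionality = finite_part'[THEN conjunct1, rule_format]
lemmas foundation = finite_part'[THEN conjunct2, THEN conjunct1, rule_format]
lemmas pairing = finite_part'[THEN conjunct2, THEN conjunct2, THEN conjunct1, rule_format]
lemmas union_ax = finite_part'[THEN conjunct2, THEN conjunct2, THEN conjunct2, THEN conjunct1, rule_format]
lemmas powerset = finite_part'[THEN conjunct2, THEN conjunct2, THEN conjunct2, THEN conjunct2,
    THEN conjunct1, rule_format]
lemmas infinity = finite_part'[THEN conjunct2, THEN conjunct2, THEN conjunct2, THEN conjunct2,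
    THEN conjunct2]

lemma tm_v: "tm K X (\<lambda>e. e i)"
  by (rule tm_var[OF univ_ne])

lemma Def_eq: "tm K X t \<Longrightarrow> tm K X s \<Longrightarrow> Def K X (\<lambda>e. t e = s e)"
  by (rule Def_inst2[where P = "(=)"]) (assumption | rule Def_var_eq[OF univ_ne])+

lemma Def_mem: "tm K X t \<Longrightarrow> tm K X s \<Longrightarrow> Def K X (\<lambda>e. t e \<in> Ext K (s e))"
  by (rule Def_inst2[where P = "\<lambda>a b. a \<in> Ext K b"])
    (assumption | rule Def_var_mem[OF univ_ne])+

lemma Def_X: "tm K X t \<Longrightarrow> Def K X (\<lambda>e. t e \<in> X)"
  by (rule Def_inst[where P = "\<lambda>a _. a \<in> X"]) (assumption | rule Def_var_X[OF univ_ne])+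

lemma Def_bex:
  assumes "tm K X t" "Def K X (\<lambda>e. Q (e 0) (\<lambda>n. e (Suc n)))"
  shows "Def K X (\<lambda>e. \<exists>a\<in>Ext K (t e). Q a e)"
proof -
  have "Def K X (\<lambda>e. \<exists>a\<in>univ K. a \<in> Ext K (t e) \<and> Q a e)"
    by (intro Def_ex Def_and Def_mem tm_v tm_rename[OF assms(1)] assms(2))
  then show ?thesis
    by (rule Def_cong[THEN iffD1, rotated]) (auto dest: Ext_univ)
qed

lemma Def_ball:
  assumes "tm K X t" "Def K X (\<lambda>e. Q (e 0) (\<lambda>n. e (Suc n)))"
  shows "Def K X (\<lambda>e. \<forall>a\<in>Ext K (t e). Q a e)"
  using Def_neg[OF Def_bex[of _ "\<lambda>a e. \<not> Q a e", OF assms(1) Def_neg[OF assms(2)]]] by simp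

lemma Def_subset:
  assumes "tm K X t" "tm K X s"
  shows "Def K X (\<lambda>e. Ext K (t e) \<subseteq> Ext K (s e))"
  unfolding subset_eq by (intro Def_ball Def_mem tm_v tm_rename[OF assms(2)] assms(1))

lemmas Def_intros = Def_neg Def_and Def_or Def_imp Def_iff Def_ex Def_all Def_bex Def_ball
  Def_subset Def_eq Def_mem tm_v

lemma Separation:
  assumes "a \<in> univ K" "Def K X (\<lambda>e. P (e 0))"
  shows "\<exists>b\<in>univ K. Ext K b = {x \<in> Ext K a. P x}"
proof -
  obtain p c where p: "c \<in> Env K" "\<forall>e\<in>Env K. P (e 0) \<longleftrightarrow> sat K X (interleave e c) p"
    using assms(2) unfolding Def_def by blast
  have "interleave c c \<in> Env K" using p by (simp add: Env_interleave)
  then obtain b where b: "b \<in> univ K"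
    "Ext K b = {x \<in> Ext K a. sat K X ((interleave c c)(0 := x)) p}"
    using models_ZFX assms(1) unfolding models_ZFX_def separation_def Env_def by blast
  have "P x \<longleftrightarrow> sat K X ((interleave c c)(0 := x)) p" if "x \<in> univ K" for x
  proof -
    have "(interleave c c)(0 := x) = interleave (c(0 := x)) c"
      by (auto simp: interleave_def fun_eq_iff)
    then show ?thesis using p(2)[rule_format, of "c(0 := x)"] p(1) that by simp
  qed
  then show ?thesis using b Ext_univ by blast
qed

lemma Collection:
  assumes "a \<in> univ K" "Def K X (\<lambda>e. P (e 0) (e (Suc 0)))"
    "\<And>x. x \<in> Ext K a \<Longrightarrow> \<exists>y\<in>univ K. P x y"
  shows "\<exists>b\<in>univ K. \<forall>x\<in>Ext K a. \<exists>y\<in>Ext K b. P x y"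
proof -
  obtain p c where p: "c \<in> Env K"
    "\<forall>e\<in>Env K. P (e 0) (e (Suc 0)) \<longleftrightarrow> sat K X (interleave e c) p"
    using assms(2) unfolding Def_def by blast
  \<comment> \<open>The scheme puts x and y at variables 0 and 1, interleaving puts them at 0 and 2.
    So 2 is renamed to 1, and the other nonzero variables move up by 2 to make room;
    \<open>d\<close> shifts the parameters accordingly.\<close>
  define f where "f n = (if n = 0 then 0 else if n = 2 then 1 else n + 2)" for n :: nat
  define d where "d n = interleave c c (n - 2)" for n
  have d: "d \<in> Env K" using Env_interleave[OF p(1) p(1)] by (auto simp: d_def Env_def)
  obtain q where q: "\<forall>e. sat K X e q \<longleftrightarrow> sat K X (\<lambda>n. e (f n)) p" using sat_rename[of K X] by blast
  have P: "sat K X (d(0 := x, 1 := y)) q \<longleftrightarrow> P x y" if "x \<in> univ K" "y \<in> univ K" for x y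
  proof -
    have "(\<lambda>n. (d(0 := x, 1 := y)) (f n)) = interleave (c(0 := x, Suc 0 := y)) c"
      by (auto simp: interleave_def fun_eq_iff d_def f_def elim!: evenE)
    then show ?thesis using p(2)[rule_format, of "c(0 := x, Suc 0 := y)"] q p(1) that by simp
  qed
  have *: "\<forall>x\<in>Ext K a. \<exists>y\<in>univ K. sat K X (d(0 := x, 1 := y)) q"
  proof
    fix x assume x: "x \<in> Ext K a"
    then obtain y where "y \<in> univ K" "P x y" using assms(3) by blast
    then show "\<exists>y\<in>univ K. sat K X (d(0 := x, 1 := y)) q"
      using P[OF Ext_univ[OF x]] by blast
  qed
  have "collection K X q" using models_ZFX unfolding models_ZFX_def by blast
  from this[unfolded collection_def, rule_format, of d, OF _ assms(1)] d *
  obtain b where b: "b \<in> univ K" "\<forall>x\<in>Ext K a. \<exists>y\<in>Ext K b. sat K X (d(0 := x, 1 := y)) q"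
    unfolding Env_def by auto
  have "\<exists>y\<in>Ext K b. P x y" if x: "x \<in> Ext K a" for x
  proof -
    obtain y where "y \<in> Ext K b" "sat K X (d(0 := x, 1 := y)) q" using b(2) x by blast
    then show ?thesis using P[OF Ext_univ[OF x] Ext_univ] by blast
  qed
  then show ?thesis using b(1) by blast
qed

section \<open>Sets of the metatheory realized in K, and basic operations\<close>

definition isset :: "'a set \<Rightarrow> bool" where
  "isset A \<longleftrightarrow> (\<exists>c\<in>univ K. Ext K c = A)"

lemma the_set_eq: "c \<in> univ K \<Longrightarrow> Ext K c = A \<Longrightarrow> the_set K A = c"
  unfolding the_set_def by (rule the_equality) (auto intro: extensionality)

lemma isset_univ: "isset A \<Longrightarrow> the_set K A \<in> univ K"
  unfolding isset_def using the_set_eq by auto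

lemma isset_Ext: "isset A \<Longrightarrow> Ext K (the_set K A) = A"
  unfolding isset_def using the_set_eq by auto

lemma issetI: "c \<in> univ K \<Longrightarrow> Ext K c = A \<Longrightarrow> isset A"
  unfolding isset_def by blast

lemma isset_Ext_self: "c \<in> univ K \<Longrightarrow> isset (Ext K c)"
  by (rule issetI) auto

lemma isset_Collect: "a \<in> univ K \<Longrightarrow> Def K X (\<lambda>e. P (e 0)) \<Longrightarrow> isset {x \<in> Ext K a. P x}"
  unfolding isset_def by (rule Separation)

lemma isset_bounded:
  assumes "a \<in> univ K" "Def K X (\<lambda>e. P (e 0))" "\<And>x. x \<in> univ K \<Longrightarrow> P x \<Longrightarrow> x \<in> Ext K a"
  shows "isset {x \<in> univ K. P x}"
proof -
  have "{x \<in> univ K. P x} = {x \<in> Ext K a. P x}" using assms(3) Ext_univ by auto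
  then show ?thesis using isset_Collect[OF assms(1,2)] by simp
qed

lemma isset_empty: "isset {}"
proof -
  obtain a where "a \<in> univ K" using univ_ne by blast
  moreover have "Def K X (\<lambda>e. e 0 \<noteq> e 0)" by (intro Def_intros)
  ultimately have "isset {x \<in> Ext K a. x \<noteq> x}" by (rule isset_Collect)
  then show ?thesis by simp
qed

lemma isset_two: "a \<in> univ K \<Longrightarrow> b \<in> univ K \<Longrightarrow> isset {a, b}"
  unfolding isset_def by (rule pairing)

lemma isset_one: "a \<in> univ K \<Longrightarrow> isset {a}"
  using isset_two[of a a] by simp

lemma isset_UN: "a \<in> univ K \<Longrightarrow> isset (\<Union>y\<in>Ext K a. Ext K y)"
  unfolding isset_def by (rule union_ax)

lemma isset_Un: "isset A \<Longrightarrow> isset B \<Longrightarrow> isset (A \<union> B)"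
  unfolding isset_def[of A] isset_def[of B]
proof (elim bexE)
  fix a b assume ab: "a \<in> univ K" "Ext K a = A" "b \<in> univ K" "Ext K b = B"
  let ?p = "the_set K {a, b}"
  have "?p \<in> univ K" "Ext K ?p = {a, b}" using ab by (auto simp: isset_univ isset_Ext isset_two)
  then show ?thesis using isset_UN[of ?p] ab by simp
qed

lemma isset_insert: "a \<in> univ K \<Longrightarrow> isset B \<Longrightarrow> isset (insert a B)"
  using isset_Un[OF isset_one, of a B] by simp

lemma isset_image:
  assumes "a \<in> univ K" "tm K X (\<lambda>e. F (e 0))"
  shows "isset (F ` Ext K a)"
proof -
  have F: "F x \<in> univ K" if "x \<in> univ K" for x
    using tm_in[OF assms(2), of "\<lambda>_. x"] that by (simp add: Env_def)
  have d: "Def K X (\<lambda>e. e (Suc 0) = F (e 0))"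
    by (intro Def_intros assms)
  have "\<exists>b\<in>univ K. \<forall>x\<in>Ext K a. \<exists>y\<in>Ext K b. y = F x"
    by (rule Collection[OF assms(1), of "\<lambda>x y. y = F x"])
      (use d F Ext_univ in auto)
  then obtain b where b: "b \<in> univ K" "\<forall>x\<in>Ext K a. F x \<in> Ext K b" by auto
  have "Def K X (\<lambda>e. \<exists>x\<in>Ext K a. e 0 = F x)"
    by (intro Def_intros tm_const assms(1) tm_rename[OF assms(2)])
  then have "isset {y \<in> Ext K b. \<exists>x\<in>Ext K a. y = F x}" by (rule isset_Collect[OF b(1)])
  moreover have "{y \<in> Ext K b. \<exists>x\<in>Ext K a. y = F x} = F ` Ext K a" using b(2) by auto
  ultimately show ?thesis by simp
qed

lemma isset_subset:
  assumes "a \<in> univ K" "A \<subseteq> Ext K a" "Def K X (\<lambda>e. e 0 \<in> A)"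
  shows "isset A"
proof -
  have "{x \<in> Ext K a. x \<in> A} = A" using assms(2) by blast
  with isset_Collect[OF assms(1,3)] show ?thesis by simp
qed

text \<open>The graph says that the value has the same members as \<open>A e\<close>; so once these
  sets exist in K, a definable membership condition is enough.\<close>

lemma tm_the_set:
  assumes "\<And>e. e \<in> Env K \<Longrightarrow> isset (A e)" "Def K X (\<lambda>e. e 0 \<in> A (\<lambda>n. e (Suc n)))"
  shows "tm K X (\<lambda>e. the_set K (A e))"
proof -
  have "Def K X (\<lambda>e. e 0 \<in> A (\<lambda>n. e (Suc (Suc n))))"
    using Def_rename[OF assms(2), of "\<lambda>n. if n = 0 then 0 else Suc n"] by simp
  then have D: "Def K X (\<lambda>e. \<forall>z\<in>univ K. z \<in> Ext K (e 0) \<longleftrightarrow> z \<in> A (\<lambda>n. e (Suc n)))"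
    by (intro Def_intros)
  have eq: "(\<forall>z\<in>univ K. z \<in> Ext K (e 0) \<longleftrightarrow> z \<in> A (\<lambda>n. e (Suc n))) \<longleftrightarrow>
      e 0 = the_set K (A (\<lambda>n. e (Suc n)))" if e: "e \<in> Env K" for e
  proof
    have s: "isset (A (\<lambda>n. e (Suc n)))" using assms(1) e by simp
    then have sub: "A (\<lambda>n. e (Suc n)) \<subseteq> univ K" using Ext_univ isset_Ext by blast
    assume "\<forall>z\<in>univ K. z \<in> Ext K (e 0) \<longleftrightarrow> z \<in> A (\<lambda>n. e (Suc n))"
    then have "Ext K (e 0) = A (\<lambda>n. e (Suc n))" using sub Ext_univ by blast
    then show "e 0 = the_set K (A (\<lambda>n. e (Suc n)))"
      using the_set_eq[of "e 0"] e by simp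
  next
    assume "e 0 = the_set K (A (\<lambda>n. e (Suc n)))"
    then show "\<forall>z\<in>univ K. z \<in> Ext K (e 0) \<longleftrightarrow> z \<in> A (\<lambda>n. e (Suc n))"
      using isset_Ext assms(1) e by simp
  qed
  have "Def K X (\<lambda>e. e 0 = the_set K (A (\<lambda>n. e (Suc n))))"
    by (rule Def_cong[THEN iffD1, OF eq D])
  then show ?thesis using assms(1) isset_univ by (simp add: tm_def)
qed

lemma isset_sep:
  assumes "tm K X t" "Def K X (\<lambda>e. P (e 0) (\<lambda>n. e (Suc n)))" "e \<in> Env K"
  shows "isset {q \<in> Ext K (t e). P q e}"
  by (rule isset_Collect[OF tm_in[OF assms(1,3)] Def_fix[OF assms(2,3)]])

lemma tm_sep:
  assumes "tm K X t" "Def K X (\<lambda>e. P (e 0) (\<lambda>n. e (Suc n)))"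
  shows "tm K X (\<lambda>e. the_set K {q \<in> Ext K (t e). P q e})"
  using assms
  by (intro tm_the_set isset_sep) (auto intro!: Def_intros tm_rename[OF assms(1)])

definition zero :: 'a where "zero = the_set K {}"
definition suc :: "'a \<Rightarrow> 'a" where "suc x = the_set K (insert x (Ext K x))"
definition bigun :: "'a \<Rightarrow> 'a" where "bigun x = the_set K (\<Union>y\<in>Ext K x. Ext K y)"

lemma zero [simp]: "zero \<in> univ K" "Ext K zero = {}"
  by (auto simp: zero_def isset_univ isset_Ext isset_empty)

lemma suc [simp]: assumes "x \<in> univ K"
  shows "suc x \<in> univ K" "Ext K (suc x) = insert x (Ext K x)"
  using isset_insert[OF assms isset_Ext_self[OF assms]]
  by (auto simp: suc_def isset_univ isset_Ext)

lemma bigun [simp]: assumes "x \<in> univ K"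
  shows "bigun x \<in> univ K" "Ext K (bigun x) = (\<Union>y\<in>Ext K x. Ext K y)"
  using isset_UN[OF assms] by (auto simp: bigun_def isset_univ isset_Ext)

lemma tm_zero: "tm K X (\<lambda>e. zero)"
  by (rule tm_const) simp

lemma tm_suc: assumes "tm K X t" shows "tm K X (\<lambda>e. suc (t e))"
  unfolding suc_def
  by (rule tm_the_set)
    (auto simp: insert_iff intro!: Def_intros tm_rename[OF assms] isset_insert isset_Ext_self tm_in[OF assms])

lemma tm_bigun: assumes "tm K X t" shows "tm K X (\<lambda>e. bigun (t e))"
  unfolding bigun_def
  by (rule tm_the_set)
    (auto simp: UN_iff intro!: Def_intros tm_rename[OF assms] isset_UN tm_in[OF assms])

lemma tm_two: assumes "tm K X t" "tm K X s" shows "tm K X (\<lambda>e. the_set K {t e, s e})"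
  by (rule tm_the_set)
    (auto intro!: Def_intros tm_rename[OF assms(1)] tm_rename[OF assms(2)] isset_two
       tm_in[OF assms(1)] tm_in[OF assms(2)])

lemma tm_pair: assumes "tm K X t" "tm K X s" shows "tm K X (\<lambda>e. pair K (t e) (s e))"
  unfolding pair_def using tm_two[OF tm_two[OF assms(1,1)] tm_two[OF assms]] by simp

lemma pair_univ [simp]: "a \<in> univ K \<Longrightarrow> b \<in> univ K \<Longrightarrow> pair K a b \<in> univ K"
  by (simp add: pair_def isset_univ isset_two isset_one)

lemma Ext_pair: "a \<in> univ K \<Longrightarrow> b \<in> univ K \<Longrightarrow>
    Ext K (pair K a b) = {the_set K {a}, the_set K {a, b}}"
  by (simp add: pair_def isset_Ext isset_univ isset_two isset_one)

lemma the_set_inject: "isset A \<Longrightarrow> isset B \<Longrightarrow> the_set K A = the_set K B \<longleftrightarrow> A = B"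
  using isset_Ext by metis

lemma pair_inject [simp]:
  assumes "a \<in> univ K" "b \<in> univ K" "c \<in> univ K" "d \<in> univ K"
  shows "pair K a b = pair K c d \<longleftrightarrow> a = c \<and> b = d"
proof
  assume *: "pair K a b = pair K c d"
  have "{the_set K {a}, the_set K {a, b}} = {the_set K {c}, the_set K {c, d}}"
    using Ext_pair[OF assms(1,2)] Ext_pair[OF assms(3,4)] * by simp
  then have "{{a}, {a, b}} = {{c}, {c, d}}"
    using assms by (auto simp: doubleton_eq_iff the_set_inject isset_one isset_two)
  then show "a = c \<and> b = d" by (auto simp: doubleton_eq_iff)
qed simp

lemma not_mem_self: "x \<notin> Ext K x"
proof
  assume x: "x \<in> Ext K x"
  then have "x \<in> univ K" by (rule Ext_univ)
  then have s: "isset {x}" by (rule isset_one)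
  from foundation[OF isset_univ[OF s]] x show False by (simp add: isset_Ext[OF s])
qed

lemma not_mem_cycle: assumes "x \<in> Ext K y" shows "y \<notin> Ext K x"
proof
  assume y: "y \<in> Ext K x"
  have s: "isset {x, y}" using isset_two Ext_univ assms y by blast
  from foundation[OF isset_univ[OF s]] y assms show False by (auto simp: isset_Ext[OF s])
qed

lemma suc_inject: "x \<in> univ K \<Longrightarrow> y \<in> univ K \<Longrightarrow> suc x = suc y \<Longrightarrow> x = y"
  using suc(2)[of x] suc(2)[of y] not_mem_cycle by (metis insert_iff)

lemma suc_ne_zero: "x \<in> univ K \<Longrightarrow> suc x \<noteq> zero"
  by (metis suc(2) zero(2) insert_not_empty)

lemma numeral_in: "numeral_in K k \<in> univ K"
  "Ext K (numeral_in K (Suc k)) = insert (numeral_in K k) (Ext K (numeral_in K k))"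
proof -
  have *: "numeral_in K (Suc k) = suc (numeral_in K k)" for k by (simp add: suc_def)
  show 1: "numeral_in K k \<in> univ K" for k
    by (induction k) (auto simp: * simp flip: zero_def simp del: numeral_in.simps(2))
  show "Ext K (numeral_in K (Suc k)) = insert (numeral_in K k) (Ext K (numeral_in K k))"
    unfolding * using 1 by (rule suc)
qed

lemma numeral_in_less: "k < l \<Longrightarrow> numeral_in K k \<in> Ext K (numeral_in K l)"
  by (induction l) (auto simp: numeral_in less_Suc_eq simp del: numeral_in.simps)

lemma numeral_in_inject [simp]: "numeral_in K k = numeral_in K l \<longleftrightarrow> k = l"
  using numeral_in_less not_mem_self by (metis linorder_neqE_nat)

lemmas Def_tms = Def_intros tm_zero tm_suc tm_bigun tm_two tm_pair

section \<open>Natural numbers, transitive closures and induction\<close>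

lemma omega_exists:
  obtains w where "w \<in> univ K" "zero \<in> Ext K w" "\<And>x. x \<in> Ext K w \<Longrightarrow> suc x \<in> Ext K w"
    "\<And>P x. Def K X (\<lambda>e. P (e 0)) \<Longrightarrow> P zero \<Longrightarrow> (\<And>n. n \<in> Ext K w \<Longrightarrow> P n \<Longrightarrow> P (suc n)) \<Longrightarrow>
       x \<in> Ext K w \<Longrightarrow> P x"
proof -
  define ind where "ind v \<longleftrightarrow> zero \<in> Ext K v \<and> (\<forall>x\<in>Ext K v. suc x \<in> Ext K v)" for v
  obtain w0 z where w0: "w0 \<in> univ K" "z \<in> Ext K w0" "Ext K z = {}"
    "\<forall>x\<in>Ext K w0. \<exists>y\<in>Ext K w0. Ext K y = insert x (Ext K x)"
    using infinity by blast
  have z: "z = zero" using w0 Ext_univ extensionality[of z zero] by simp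
  have "suc x \<in> Ext K w0" if x: "x \<in> Ext K w0" for x
  proof -
    obtain y where "y \<in> Ext K w0" "Ext K y = insert x (Ext K x)" using w0(4) x by blast
    then show ?thesis
      using extensionality[of y "suc x"] Ext_univ[OF x] Ext_univ[of y] by auto
  qed
  then have ind0: "ind w0" using w0 z by (simp add: ind_def)
  have "Def K X (\<lambda>e. \<forall>v\<in>univ K. ind v \<longrightarrow> e 0 \<in> Ext K v)"
    unfolding ind_def by (intro Def_tms)
  then have s: "isset {n \<in> Ext K w0. \<forall>v\<in>univ K. ind v \<longrightarrow> n \<in> Ext K v}"
    by (rule isset_Collect[OF w0(1)])
  define w where "w = the_set K {n \<in> Ext K w0. \<forall>v\<in>univ K. ind v \<longrightarrow> n \<in> Ext K v}"
  have w: "w \<in> univ K" "Ext K w = {n \<in> Ext K w0. \<forall>v\<in>univ K. ind v \<longrightarrow> n \<in> Ext K v}"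
    using s isset_univ isset_Ext by (auto simp: w_def)
  show thesis
  proof
    show "w \<in> univ K" by (rule w)
    show zw: "zero \<in> Ext K w" using ind0 by (auto simp: w ind_def)
    show sw: "suc x \<in> Ext K w" if "x \<in> Ext K w" for x using that ind0 by (auto simp: w ind_def)
    fix P x
    assume P: "Def K X (\<lambda>e. P (e 0))" "P zero" "\<And>n. n \<in> Ext K w \<Longrightarrow> P n \<Longrightarrow> P (suc n)"
      and x: "x \<in> Ext K w"
    \<comment> \<open>The numbers of K may be nonstandard. Induction is available only for definable
      P, because the set of numbers satisfying P has to exist in K.\<close>
    obtain v where v: "v \<in> univ K" "Ext K v = {n \<in> Ext K w. P n}"
      using Separation[OF w(1) P(1)] by blast
    have "ind v" using P(2,3) zw sw by (simp add: v(2) ind_def)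
    then have "x \<in> Ext K v" using x v(1) by (simp add: w(2))
    then show "P x" by (simp add: v(2))
  qed
qed

lemma transitive_superset:
  assumes x: "x \<in> univ K"
  obtains t where "t \<in> univ K" "Ext K x \<subseteq> Ext K t" "\<And>y. y \<in> Ext K t \<Longrightarrow> Ext K y \<subseteq> Ext K t"
proof -
  obtain w where w: "w \<in> univ K" "zero \<in> Ext K w" "\<And>x. x \<in> Ext K w \<Longrightarrow> suc x \<in> Ext K w"
    and induct: "\<And>P x. Def K X (\<lambda>e. P (e 0)) \<Longrightarrow> P zero \<Longrightarrow> (\<And>n. n \<in> Ext K w \<Longrightarrow> P n \<Longrightarrow> P (suc n)) \<Longrightarrow>
       x \<in> Ext K w \<Longrightarrow> P x"
    using omega_exists by blast
  \<comment> \<open>A certificate is a set of pairs \<open>(k, \<Union>\<^sup>k x)\<close> in which every entry is justified by another one.\<close>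
  define cert where "cert f \<longleftrightarrow> (\<forall>q\<in>Ext K f. q = pair K zero x \<or>
      (\<exists>k\<in>Ext K w. \<exists>z\<in>univ K. pair K k z \<in> Ext K f \<and> q = pair K (suc k) (bigun z)))" for f
  define it where "it k z \<longleftrightarrow> (\<exists>f\<in>univ K. cert f \<and> pair K k z \<in> Ext K f)" for k z
  have tmw: "tm K X (\<lambda>e. w)" "tm K X (\<lambda>e. x)" using w(1) x by (auto intro: tm_const)
  have Dit: "Def K X (\<lambda>e. it (t e) (s e))" if "tm K X t" "tm K X s" for t s
    unfolding it_def cert_def by (intro Def_tms tmw tm_rename[OF that(1)] tm_rename[OF that(2)])
  have it_zero: "z = x" if "it zero z" "z \<in> univ K" for z
  proof -
    obtain f where f: "f \<in> univ K" "cert f" "pair K zero z \<in> Ext K f"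
      using \<open>it zero z\<close> unfolding it_def by blast
    then consider "pair K zero z = pair K zero x"
      | k y where "k \<in> univ K" "y \<in> univ K" "pair K zero z = pair K (suc k) (bigun y)"
      unfolding cert_def using Ext_univ by blast
    then show ?thesis using that(2) x suc_ne_zero by cases auto
  qed
  have it_suc: "\<exists>y\<in>univ K. it k y \<and> z = bigun y"
    if "it (suc k) z" "k \<in> Ext K w" "z \<in> univ K" for k z
  proof -
    have k: "k \<in> univ K" using that Ext_univ by blast
    obtain f where f: "f \<in> univ K" "cert f" "pair K (suc k) z \<in> Ext K f"
      using \<open>it (suc k) z\<close> unfolding it_def by blast
    then consider "pair K (suc k) z = pair K zero x"
      | k' y where "k' \<in> univ K" "y \<in> univ K" "pair K k' y \<in> Ext K f"
        "pair K (suc k) z = pair K (suc k') (bigun y)"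
      unfolding cert_def using Ext_univ by blast
    then show ?thesis
    proof cases
      case 1
      then show ?thesis using k that(3) x suc_ne_zero by auto
    next
      case 2
      then have "suc k = suc k'" "z = bigun y" using k that(3) by simp_all
      then have "k = k'" "z = bigun y" using suc_inject[OF k 2(1)] by simp_all
      then show ?thesis using 2 f unfolding it_def by blast
    qed
  qed
  have uniq: "\<forall>z\<in>univ K. \<forall>z'\<in>univ K. it k z \<longrightarrow> it k z' \<longrightarrow> z = z'" if k: "k \<in> Ext K w" for k
  proof (rule induct[OF _ _ _ k])
    show "Def K X (\<lambda>e. \<forall>z\<in>univ K. \<forall>z'\<in>univ K. it (e 0) z \<longrightarrow> it (e 0) z' \<longrightarrow> z = z')"
      by (intro Def_tms Dit)
    show "\<forall>z\<in>univ K. \<forall>z'\<in>univ K. it zero z \<longrightarrow> it zero z' \<longrightarrow> z = z'" using it_zero by blast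
    fix n assume "n \<in> Ext K w" "\<forall>z\<in>univ K. \<forall>z'\<in>univ K. it n z \<longrightarrow> it n z' \<longrightarrow> z = z'"
    then show "\<forall>z\<in>univ K. \<forall>z'\<in>univ K. it (suc n) z \<longrightarrow> it (suc n) z' \<longrightarrow> z = z'"
      using it_suc by metis
  qed
  have itx: "it zero x"
  proof -
    have s: "isset {pair K zero x}" using isset_one x by simp
    have "cert (the_set K {pair K zero x})" by (simp add: cert_def isset_Ext[OF s])
    then show ?thesis unfolding it_def using isset_univ[OF s] isset_Ext[OF s] by blast
  qed
  have it_step: "it (suc k) (bigun z)" if kz: "it k z" "k \<in> Ext K w" "z \<in> univ K" for k z
  proof -
    obtain f where f: "f \<in> univ K" "cert f" "pair K k z \<in> Ext K f" using kz unfolding it_def by blast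
    have p: "pair K (suc k) (bigun z) \<in> univ K" using kz Ext_univ by simp
    have s: "isset (insert (pair K (suc k) (bigun z)) (Ext K f))"
      using isset_insert[OF p isset_Ext_self[OF f(1)]] .
    let ?g = "the_set K (insert (pair K (suc k) (bigun z)) (Ext K f))"
    have "cert ?g" unfolding cert_def isset_Ext[OF s]
    proof
      fix q assume "q \<in> insert (pair K (suc k) (bigun z)) (Ext K f)"
      then show "q = pair K zero x \<or> (\<exists>k'\<in>Ext K w. \<exists>z'\<in>univ K.
           pair K k' z' \<in> insert (pair K (suc k) (bigun z)) (Ext K f) \<and> q = pair K (suc k') (bigun z'))"
      proof
        assume "q \<in> Ext K f"
        then show ?thesis using f(2) unfolding cert_def by blast
      qed (use f kz in blast)
    qed
    then show ?thesis unfolding it_def using isset_univ[OF s] isset_Ext[OF s] by blast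
  qed
  have ex: "\<exists>z\<in>univ K. it k z" if k: "k \<in> Ext K w" for k
  proof (rule induct[OF _ _ _ k])
    show "Def K X (\<lambda>e. \<exists>z\<in>univ K. it (e 0) z)" by (intro Def_tms Dit)
    show "\<exists>z\<in>univ K. it zero z" using itx x by blast
    fix n assume "n \<in> Ext K w" "\<exists>z\<in>univ K. it n z"
    then show "\<exists>z\<in>univ K. it (suc n) z" using it_step bigun by blast
  qed
  have "Def K X (\<lambda>e. it (e 0) (e (Suc 0)))" by (intro Dit tm_v)
  from Collection[OF w(1) this ex]
  obtain b where b: "b \<in> univ K" "\<forall>k\<in>Ext K w. \<exists>z\<in>Ext K b. it k z" by blast
  have "Def K X (\<lambda>e. \<exists>k\<in>Ext K w. it k (e 0))" by (intro Def_tms tmw Dit)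
  then have "\<exists>c\<in>univ K. Ext K c = {z \<in> Ext K b. \<exists>k\<in>Ext K w. it k z}"
    by (rule Separation[OF b(1)])
  then obtain b' where b': "b' \<in> univ K" "Ext K b' = {z \<in> Ext K b. \<exists>k\<in>Ext K w. it k z}"
    by blast
  have mem_b': "z \<in> Ext K b'" if "k \<in> Ext K w" "it k z" "z \<in> univ K" for k z
  proof -
    obtain z' where z': "z' \<in> Ext K b" "it k z'" using b(2) \<open>k \<in> Ext K w\<close> by blast
    have "z' = z" using uniq[OF that(1)] that z' Ext_univ by blast
    then show ?thesis using z' that b' by blast
  qed
  show thesis
  proof
    show "bigun b' \<in> univ K" using b' by simp
    show "Ext K x \<subseteq> Ext K (bigun b')" using mem_b'[OF w(2) itx x] b'(1) by auto
    fix y assume "y \<in> Ext K (bigun b')"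
    then obtain z where z: "z \<in> Ext K b'" "y \<in> Ext K z" using b'(1) by auto
    then obtain k where k: "k \<in> Ext K w" "it k z" using b'(2) by blast
    have zu: "z \<in> univ K" using z Ext_univ by blast
    have "bigun z \<in> Ext K b'" using mem_b'[OF w(3)[OF k(1)] it_step[OF k(2,1) zu]] zu by simp
    moreover have "Ext K y \<subseteq> Ext K (bigun z)" using z(2) zu by auto
    ultimately show "Ext K y \<subseteq> Ext K (bigun b')" using b'(1) by auto
  qed
qed

text \<open>Foundation is an axiom about sets only. Inside a transitive superset of x the
  counterexamples form a set by separation, and a minimal one contradicts the induction
  step.\<close>

lemma mem_induct:
  assumes "Def K X (\<lambda>e. P (e 0))" "\<And>x. x \<in> univ K \<Longrightarrow> (\<And>y. y \<in> Ext K x \<Longrightarrow> P y) \<Longrightarrow> P x"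
    "x \<in> univ K"
  shows "P x"
proof (rule ccontr)
  assume nP: "\<not> P x"
  obtain t where t: "t \<in> univ K" "Ext K x \<subseteq> Ext K t" "\<And>y. y \<in> Ext K t \<Longrightarrow> Ext K y \<subseteq> Ext K t"
    using transitive_superset[OF assms(3)] by blast
  obtain c where c: "c \<in> univ K" "Ext K c = {y \<in> Ext K t. \<not> P y}"
    using Separation[OF t(1) Def_neg[OF assms(1)]] by blast
  obtain y where "y \<in> Ext K x" "\<not> P y" using assms(2)[OF assms(3)] nP by blast
  then have "Ext K c \<noteq> {}" using c t by blast
  from foundation[OF c(1) this] obtain z where z: "z \<in> Ext K c" "Ext K z \<inter> Ext K c = {}" by blast
  have "P u" if "u \<in> Ext K z" for u
    using z c t(3) that by blast
  then have "P z" using assms(2) z(1) Ext_univ by blast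
  then show False using z c by blast
qed

text \<open>The strict closure: x itself is not a member (\<open>not_mem_TC\<close>). Being an
  intersection, it is definable without recursion.\<close>

definition TC :: "'a \<Rightarrow> 'a set" where
  "TC x = {z \<in> univ K. \<forall>t\<in>univ K. Ext K x \<subseteq> Ext K t \<and> (\<forall>y\<in>Ext K t. Ext K y \<subseteq> Ext K t) \<longrightarrow> z \<in> Ext K t}"

lemma Def_TC:
  assumes "tm K X t" "tm K X s"
  shows "Def K X (\<lambda>e. t e \<in> TC (s e))"
proof -
  have "Def K X (\<lambda>e. \<forall>u\<in>univ K. Ext K (s e) \<subseteq> Ext K u \<and> (\<forall>y\<in>Ext K u. Ext K y \<subseteq> Ext K u) \<longrightarrow>
      t e \<in> Ext K u)"
    by (intro Def_tms tm_rename[OF assms(1)] tm_rename[OF assms(2)])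
  then show ?thesis
    by (rule Def_cong[THEN iffD1, rotated]) (simp add: TC_def tm_in[OF assms(1)])
qed

lemma isset_TC: "x \<in> univ K \<Longrightarrow> isset (TC x)"
proof -
  assume x: "x \<in> univ K"
  obtain t where t: "t \<in> univ K" "Ext K x \<subseteq> Ext K t" "\<And>y. y \<in> Ext K t \<Longrightarrow> Ext K y \<subseteq> Ext K t"
    using transitive_superset[OF x] by blast
  have "Def K X (\<lambda>e. e 0 \<in> TC x)" by (intro Def_TC tm_v tm_const x)
  moreover have "TC x \<subseteq> Ext K t" using t unfolding TC_def by blast
  ultimately show ?thesis using isset_subset t(1) by blast
qed

lemma TC_univ: "z \<in> TC x \<Longrightarrow> z \<in> univ K" by (simp add: TC_def)

lemma Ext_subset_TC: "Ext K x \<subseteq> TC x"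
  unfolding TC_def using Ext_univ by blast

lemma TC_trans1: "z \<in> TC x \<Longrightarrow> Ext K z \<subseteq> TC x"
  unfolding TC_def using Ext_univ by blast

lemma TC_trans: assumes "z \<in> TC x" "x \<in> univ K" shows "TC z \<subseteq> TC x"
proof -
  have s: "isset (TC x)" using assms isset_TC by blast
  show ?thesis
  proof
    fix u assume "u \<in> TC z"
    then have "\<forall>t\<in>univ K. Ext K z \<subseteq> Ext K t \<and> (\<forall>y\<in>Ext K t. Ext K y \<subseteq> Ext K t) \<longrightarrow> u \<in> Ext K t"
      unfolding TC_def[of z] by blast
    from bspec[OF this isset_univ[OF s], unfolded isset_Ext[OF s]]
    show "u \<in> TC x" using TC_trans1 assms(1) by blast
  qed
qed

text \<open>The members of \<open>TC x\<close> that satisfy the conclusion form a transitive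
  superset of x, and \<open>TC x\<close> is contained in every such set.\<close>

lemma TC_cases: assumes "z \<in> TC x" "x \<in> univ K" shows "z \<in> Ext K x \<or> (\<exists>y\<in>Ext K x. z \<in> TC y)"
proof -
  have s: "isset (TC x)" using assms isset_TC by blast
  have "Def K X (\<lambda>e. e 0 \<in> Ext K x \<or> (\<exists>y\<in>Ext K x. e 0 \<in> TC y))"
    by (intro Def_tms Def_TC tm_const assms)
  from Separation[OF isset_univ[OF s] this] obtain t where
    t: "t \<in> univ K" "Ext K t = {z \<in> TC x. z \<in> Ext K x \<or> (\<exists>y\<in>Ext K x. z \<in> TC y)}"
    unfolding isset_Ext[OF s] by blast
  have 1: "Ext K x \<subseteq> Ext K t" using t(2) Ext_subset_TC by blast
  have 2: "Ext K y \<subseteq> Ext K t" if "y \<in> Ext K t" for y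
    using that TC_trans1 Ext_subset_TC unfolding t(2) by blast
  have "z \<in> Ext K t" using assms(1) t(1) 1 2 unfolding TC_def by blast
  then show ?thesis using t(2) by blast
qed

lemma TC_induct:
  assumes "Def K X (\<lambda>e. P (e 0))" "\<And>x. x \<in> univ K \<Longrightarrow> (\<And>y. y \<in> TC x \<Longrightarrow> P y) \<Longrightarrow> P x"
    "x \<in> univ K"
  shows "P x"
proof -
  have P: "Def K X (\<lambda>e. P (t e))" if "tm K X t" for t
    using Def_inst[OF that, of "\<lambda>a _. P a"] assms(1) by simp
  have "\<forall>z\<in>univ K. z \<in> TC x \<longrightarrow> P z"
  proof (rule mem_induct[OF _ _ assms(3)])
    show "Def K X (\<lambda>e. \<forall>z\<in>univ K. z \<in> TC (e 0) \<longrightarrow> P z)"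
      by (intro Def_tms Def_TC P)
    fix x assume x: "x \<in> univ K" and IH: "\<And>y. y \<in> Ext K x \<Longrightarrow> \<forall>z\<in>univ K. z \<in> TC y \<longrightarrow> P z"
    show "\<forall>z\<in>univ K. z \<in> TC x \<longrightarrow> P z"
    proof (intro ballI impI)
      fix z assume z: "z \<in> univ K" "z \<in> TC x"
      from TC_cases[OF z(2) x] show "P z"
        using IH assms(2)[OF z(1)] z(1) TC_univ by blast
    qed
  qed
  then show ?thesis using assms(2,3) TC_univ by blast
qed

lemma not_mem_TC: "x \<in> univ K \<Longrightarrow> x \<notin> TC x"
proof (erule TC_induct[rotated 2])
  show "Def K X (\<lambda>e. e 0 \<notin> TC (e 0))" by (intro Def_tms Def_TC)
qed blast

section \<open>Recursion along transitive closures\<close>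

definition restr :: "'a \<Rightarrow> 'a \<Rightarrow> 'a" where
  "restr f x = the_set K {q \<in> Ext K f. \<exists>z\<in>univ K. \<exists>v\<in>univ K. z \<in> TC x \<and> q = pair K z v}"

lemma tm_restr:
  assumes "tm K X t" "tm K X s"
  shows "tm K X (\<lambda>e. restr (t e) (s e))"
  unfolding restr_def
  by (rule tm_sep[OF assms(1), of "\<lambda>q e. \<exists>z\<in>univ K. \<exists>v\<in>univ K. z \<in> TC (s e) \<and> q = pair K z v"])
    (intro Def_tms Def_TC tm_rename[OF assms(2)])

lemma restr:
  assumes "f \<in> univ K" "x \<in> univ K"
  shows "restr f x \<in> univ K"
    "Ext K (restr f x) = {q \<in> Ext K f. \<exists>z\<in>univ K. \<exists>v\<in>univ K. z \<in> TC x \<and> q = pair K z v}"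
proof -
  have "Def K X (\<lambda>e. \<exists>z\<in>univ K. \<exists>v\<in>univ K. z \<in> TC x \<and> e 0 = pair K z v)"
    by (intro Def_tms Def_TC tm_const assms)
  then have "isset {q \<in> Ext K f. \<exists>z\<in>univ K. \<exists>v\<in>univ K. z \<in> TC x \<and> q = pair K z v}"
    by (rule isset_Collect[OF assms(1)])
  then show "restr f x \<in> univ K"
    "Ext K (restr f x) = {q \<in> Ext K f. \<exists>z\<in>univ K. \<exists>v\<in>univ K. z \<in> TC x \<and> q = pair K z v}"
    unfolding restr_def by (rule isset_univ, rule isset_Ext)
qed

definition rec_cert :: "('a \<Rightarrow> 'a \<Rightarrow> 'a \<Rightarrow> 'a) \<Rightarrow> 'a \<Rightarrow> 'a \<Rightarrow> bool" where
  "rec_cert G c f \<longleftrightarrow> (\<forall>q\<in>Ext K f. \<exists>x\<in>univ K. \<exists>y\<in>univ K. q = pair K x y \<and>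
     (\<forall>z\<in>univ K. z \<in> TC x \<longrightarrow> (\<exists>v\<in>univ K. pair K z v \<in> Ext K f)) \<and> y = G c x (restr f x))"

definition rec_val :: "('a \<Rightarrow> 'a \<Rightarrow> 'a \<Rightarrow> 'a) \<Rightarrow> 'a \<Rightarrow> 'a \<Rightarrow> 'a \<Rightarrow> bool" where
  "rec_val G c x y \<longleftrightarrow> (\<exists>f\<in>univ K. rec_cert G c f \<and> pair K x y \<in> Ext K f)"

definition trec :: "('a \<Rightarrow> 'a \<Rightarrow> 'a \<Rightarrow> 'a) \<Rightarrow> 'a \<Rightarrow> 'a \<Rightarrow> 'a" where
  "trec G c x = (THE y. y \<in> univ K \<and> rec_val G c x y)"

lemma rec_certD:
  assumes "rec_cert G c f" "pair K x y \<in> Ext K f" "x \<in> univ K" "y \<in> univ K"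
  shows "y = G c x (restr f x)" "z \<in> TC x \<Longrightarrow> \<exists>v\<in>univ K. pair K z v \<in> Ext K f"
proof -
  obtain x' y' where *: "x' \<in> univ K" "y' \<in> univ K" "pair K x y = pair K x' y'"
     "\<forall>z\<in>univ K. z \<in> TC x' \<longrightarrow> (\<exists>v\<in>univ K. pair K z v \<in> Ext K f)" "y' = G c x' (restr f x')"
    using assms(1,2) unfolding rec_cert_def by blast
  then have "x' = x" "y' = y" using assms by simp_all
  with * show "y = G c x (restr f x)" "z \<in> TC x \<Longrightarrow> \<exists>v\<in>univ K. pair K z v \<in> Ext K f"
    using TC_univ by blast+
qed

lemma restr_cong:
  assumes "f \<in> univ K" "g \<in> univ K" "x \<in> univ K"
    "\<And>z v. z \<in> TC x \<Longrightarrow> v \<in> univ K \<Longrightarrow> pair K z v \<in> Ext K f \<longleftrightarrow> pair K z v \<in> Ext K g"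
  shows "restr f x = restr g x"
proof (rule extensionality)
  show "Ext K (restr f x) = Ext K (restr g x)"
    unfolding restr(2)[OF assms(1,3)] restr(2)[OF assms(2,3)] using assms(4) by auto
qed (use assms restr in auto)

context
  fixes G :: "'a \<Rightarrow> 'a \<Rightarrow> 'a \<Rightarrow> 'a"
  assumes tmG: "tm K X (\<lambda>e. G (e 0) (e (Suc 0)) (e (Suc (Suc 0))))"
begin

lemma G_univ: "a \<in> univ K \<Longrightarrow> b \<in> univ K \<Longrightarrow> c \<in> univ K \<Longrightarrow> G a b c \<in> univ K"
  using tm_in[OF tmG, of "case_nat a (case_nat b (\<lambda>_. c))"]
    Env_case_nat[OF Env_case_nat, of "\<lambda>_. c" K b a] by (auto simp: Env_def)

lemma Def_rec_cert:
  assumes "tm K X t" "tm K X s"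
  shows "Def K X (\<lambda>e. rec_cert G (t e) (s e))"
  unfolding rec_cert_def
  by (intro Def_tms Def_TC tm_comp3[OF _ _ _ tmG] tm_restr tm_rename[OF assms(1)]
      tm_rename[OF assms(2)] assms)

lemma Def_rec_val:
  assumes "tm K X t" "tm K X s" "tm K X r"
  shows "Def K X (\<lambda>e. rec_val G (t e) (s e) (r e))"
  unfolding rec_val_def
  by (intro Def_tms Def_rec_cert tm_rename[OF assms(1)] tm_rename[OF assms(2)]
      tm_rename[OF assms(3)])

text \<open>By the induction hypothesis two certificates have the same entries on
  \<open>TC x\<close>, so both apply \<open>G\<close> to the same restriction.\<close>

lemma rec_val_unique:
  assumes c: "c \<in> univ K" and x: "x \<in> univ K"
  shows "\<forall>y\<in>univ K. \<forall>y'\<in>univ K. rec_val G c x y \<longrightarrow> rec_val G c x y' \<longrightarrow> y = y'"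
proof (rule TC_induct[OF _ _ x])
  show "Def K X (\<lambda>e. \<forall>y\<in>univ K. \<forall>y'\<in>univ K. rec_val G c (e 0) y \<longrightarrow> rec_val G c (e 0) y' \<longrightarrow> y = y')"
    by (intro Def_tms Def_rec_val tm_const c)
  fix x
  assume x: "x \<in> univ K"
    and IH: "\<And>z. z \<in> TC x \<Longrightarrow> \<forall>y\<in>univ K. \<forall>y'\<in>univ K. rec_val G c z y \<longrightarrow> rec_val G c z y' \<longrightarrow> y = y'"
  have sub: "pair K z v \<in> Ext K g"
    if H: "rec_cert G c f" "rec_cert G c g" "f \<in> univ K" "g \<in> univ K" "y \<in> univ K"
      "pair K x y \<in> Ext K g" "z \<in> TC x" "v \<in> univ K" "pair K z v \<in> Ext K f" for f g y z v
  proof -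
    obtain v' where v': "v' \<in> univ K" "pair K z v' \<in> Ext K g"
      using rec_certD(2)[OF H(2,6) x H(5,7)] by blast
    have "v = v'" using IH[OF H(7)] H v' unfolding rec_val_def by blast
    then show ?thesis using v' by simp
  qed
  show "\<forall>y\<in>univ K. \<forall>y'\<in>univ K. rec_val G c x y \<longrightarrow> rec_val G c x y' \<longrightarrow> y = y'"
  proof (intro ballI impI)
    fix y y' assume y: "y \<in> univ K" "y' \<in> univ K" "rec_val G c x y" "rec_val G c x y'"
    obtain f where f: "f \<in> univ K" "rec_cert G c f" "pair K x y \<in> Ext K f"
      using y(3) unfolding rec_val_def by blast
    obtain g where g: "g \<in> univ K" "rec_cert G c g" "pair K x y' \<in> Ext K g"
      using y(4) unfolding rec_val_def by blast
    have "restr f x = restr g x"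
      by (rule restr_cong[OF f(1) g(1) x]) (use sub f g y in blast)
    then show "y = y'"
      using rec_certD(1)[OF f(2,3) x y(1)] rec_certD(1)[OF g(2,3) x y(2)] by simp
  qed
qed

lemma rec_val_exists:
  assumes c: "c \<in> univ K" and x: "x \<in> univ K"
  shows "\<exists>y\<in>univ K. rec_val G c x y"
proof (rule TC_induct[OF _ _ x])
  show "Def K X (\<lambda>e. \<exists>y\<in>univ K. rec_val G c (e 0) y)"
    by (intro Def_tms Def_rec_val tm_const c)
  fix x
  assume x: "x \<in> univ K" and IH: "\<And>z. z \<in> TC x \<Longrightarrow> \<exists>y\<in>univ K. rec_val G c z y"
  have s: "isset (TC x)" using isset_TC x .
  have D: "Def K X (\<lambda>e. rec_cert G c (e (Suc 0)) \<and> (\<exists>v\<in>univ K. pair K (e 0) v \<in> Ext K (e (Suc 0))))"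
    by (intro Def_tms Def_rec_cert tm_const c)
  have "\<exists>b\<in>univ K. \<forall>z\<in>Ext K (the_set K (TC x)). \<exists>f\<in>Ext K b.
      rec_cert G c f \<and> (\<exists>v\<in>univ K. pair K z v \<in> Ext K f)"
    by (rule Collection[OF isset_univ[OF s] D])
      (use IH[unfolded rec_val_def] in \<open>unfold isset_Ext[OF s], blast\<close>)
  then obtain b where b: "b \<in> univ K"
    "\<forall>z\<in>TC x. \<exists>f\<in>Ext K b. rec_cert G c f \<and> (\<exists>v\<in>univ K. pair K z v \<in> Ext K f)"
    unfolding isset_Ext[OF s] by blast
  have "Def K X (\<lambda>e. rec_cert G c (e 0))" by (intro Def_rec_cert tm_const c tm_v)
  then have "\<exists>b'\<in>univ K. Ext K b' = {f \<in> Ext K b. rec_cert G c f}" by (rule Separation[OF b(1)])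
  then obtain b' where b': "b' \<in> univ K" "Ext K b' = {f \<in> Ext K b. rec_cert G c f}" by blast
  \<comment> \<open>Collection gives a set with a certificate for each z, but none is singled out.
    All certificates in it are united instead, which needs no choice; uniqueness makes them
    agree.\<close>
  define g where "g = bigun b'"
  have g: "g \<in> univ K" "Ext K g = (\<Union>f\<in>{f \<in> Ext K b. rec_cert G c f}. Ext K f)"
    using b' by (simp_all add: g_def)
  have restr_eq: "restr g x' = restr f x'"
    if f: "f \<in> Ext K b" "rec_cert G c f" "pair K x' y' \<in> Ext K f" and u: "x' \<in> univ K" "y' \<in> univ K"
    for f x' y'
  proof (rule restr_cong[OF g(1) Ext_univ[OF f(1)] u(1)])
    fix z v assume z: "z \<in> TC x'" "v \<in> univ K"
    show "pair K z v \<in> Ext K g \<longleftrightarrow> pair K z v \<in> Ext K f"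
    proof
      assume "pair K z v \<in> Ext K g"
      then have "rec_val G c z v" unfolding g(2) rec_val_def using Ext_univ by blast
      moreover obtain v' where v': "v' \<in> univ K" "pair K z v' \<in> Ext K f"
        using rec_certD(2)[OF f(2,3) u z(1)] by blast
      moreover from v' have "rec_val G c z v'" unfolding rec_val_def using f Ext_univ by blast
      ultimately show "pair K z v \<in> Ext K f"
        using rec_val_unique[OF c TC_univ[OF z(1)]] z(2) by blast
    qed (use f g(2) in blast)
  qed
  have "rec_cert G c g" unfolding rec_cert_def
  proof
    fix q assume "q \<in> Ext K g"
    then obtain f where f: "f \<in> Ext K b" "rec_cert G c f" "q \<in> Ext K f" using g by blast
    then obtain x' y' where *: "x' \<in> univ K" "y' \<in> univ K" "q = pair K x' y'"
     "\<forall>z\<in>univ K. z \<in> TC x' \<longrightarrow> (\<exists>v\<in>univ K. pair K z v \<in> Ext K f)" "y' = G c x' (restr f x')"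
      unfolding rec_cert_def by blast
    moreover have "Ext K f \<subseteq> Ext K g" using f g(2) by blast
    moreover have "restr g x' = restr f x'" using restr_eq[OF f(1,2)] f(3) * by blast
    ultimately show "\<exists>x\<in>univ K. \<exists>y\<in>univ K. q = pair K x y \<and>
     (\<forall>z\<in>univ K. z \<in> TC x \<longrightarrow> (\<exists>v\<in>univ K. pair K z v \<in> Ext K g)) \<and> y = G c x (restr g x)"
      by (intro bexI[of _ x'] bexI[of _ y']) (auto 0 3)
  qed note cert_g = this
  have dom: "\<exists>v\<in>univ K. pair K z v \<in> Ext K g" if "z \<in> TC x" for z
    using b(2) that g(2) by blast
  show "\<exists>y\<in>univ K. rec_val G c x y"
  proof (cases "\<exists>v\<in>univ K. pair K x v \<in> Ext K g")
    case True
    then show ?thesis using cert_g g(1) unfolding rec_val_def by blast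
  next
    case False
    define y where "y = G c x (restr g x)"
    have y: "y \<in> univ K" unfolding y_def using G_univ c x restr(1)[OF g(1) x] by blast
    have s: "isset (insert (pair K x y) (Ext K g))"
      using isset_insert isset_Ext_self g(1) x y by simp
    define h where "h = the_set K (insert (pair K x y) (Ext K g))"
    have h: "h \<in> univ K" "Ext K h = insert (pair K x y) (Ext K g)"
      using isset_univ[OF s] isset_Ext[OF s] by (simp_all add: h_def)
    \<comment> \<open>Since \<open>g\<close> has no value at x and its domain is closed under
      transitive closures, x is in no \<open>TC x'\<close> for x' in the domain. So the new entry
      leaves the old ones justified.\<close>
    have restr_h: "restr h x' = restr g x'" if "x \<notin> TC x'" "x' \<in> univ K" for x'
      by (rule restr_cong[OF h(1) g(1) that(2)]) (use that h(2) x y TC_univ in auto)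
    have "rec_cert G c h" unfolding rec_cert_def
    proof
      fix q assume "q \<in> Ext K h"
      then consider "q = pair K x y" | "q \<in> Ext K g" using h(2) by blast
      then show "\<exists>x\<in>univ K. \<exists>y\<in>univ K. q = pair K x y \<and>
       (\<forall>z\<in>univ K. z \<in> TC x \<longrightarrow> (\<exists>v\<in>univ K. pair K z v \<in> Ext K h)) \<and> y = G c x (restr h x)"
      proof cases
        case 1
        moreover have "y = G c x (restr h x)" using restr_h[OF not_mem_TC[OF x] x] y_def by simp
        ultimately show ?thesis using x y dom h(2) by blast
      next
        case 2
        then obtain x' y' where *: "x' \<in> univ K" "y' \<in> univ K" "q = pair K x' y'"
          "\<forall>z\<in>univ K. z \<in> TC x' \<longrightarrow> (\<exists>v\<in>univ K. pair K z v \<in> Ext K g)" "y' = G c x' (restr g x')"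
          using cert_g unfolding rec_cert_def by blast
        moreover have "x \<notin> TC x'" using *(4) False x by blast
        moreover have "Ext K g \<subseteq> Ext K h" using h(2) by blast
        ultimately show ?thesis using restr_h
          by (intro bexI[of _ x'] bexI[of _ y']) (auto 0 3)
      qed
    qed
    then show ?thesis using h y unfolding rec_val_def by blast
  qed
qed

lemma trec:
  assumes "c \<in> univ K" "x \<in> univ K"
  shows "trec G c x \<in> univ K" "y \<in> univ K \<Longrightarrow> rec_val G c x y \<longleftrightarrow> trec G c x = y"
proof -
  have ex1: "\<exists>!y. y \<in> univ K \<and> rec_val G c x y"
    using rec_val_exists[OF assms] rec_val_unique[OF assms] by blast
  show "trec G c x \<in> univ K" "y \<in> univ K \<Longrightarrow> rec_val G c x y \<longleftrightarrow> trec G c x = y"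
    using theI'[OF ex1] ex1 unfolding trec_def[symmetric] by blast+
qed

lemma trec_unfold:
  assumes c: "c \<in> univ K" and x: "x \<in> univ K"
  shows "\<exists>r\<in>univ K. Ext K r = (\<lambda>z. pair K z (trec G c z)) ` TC x \<and> trec G c x = G c x r"
proof -
  obtain f where f: "f \<in> univ K" "rec_cert G c f" "pair K x (trec G c x) \<in> Ext K f"
    using trec[OF assms] unfolding rec_val_def by blast
  have "Ext K (restr f x) = (\<lambda>z. pair K z (trec G c z)) ` TC x"
    unfolding restr(2)[OF f(1) x]
  proof safe
    fix z v assume z: "z \<in> univ K" "v \<in> univ K" "z \<in> TC x" "pair K z v \<in> Ext K f"
    then have "trec G c z = v" using trec(2)[OF c z(1,2)] f unfolding rec_val_def by blast
    then show "pair K z v \<in> (\<lambda>z. pair K z (trec G c z)) ` TC x" using z(3) by blast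
  next
    fix z assume z: "z \<in> TC x"
    obtain v where v: "v \<in> univ K" "pair K z v \<in> Ext K f"
      using rec_certD(2)[OF f(2,3) x trec(1)[OF assms] z] by blast
    then have "trec G c z = v" using trec(2)[OF c TC_univ[OF z] v(1)] f unfolding rec_val_def by blast
    then show "pair K z (trec G c z) \<in> Ext K f" using v by simp
    show "\<exists>z'\<in>univ K. \<exists>v\<in>univ K. z' \<in> TC x \<and> pair K z (trec G c z) = pair K z' v"
      using z TC_univ trec(1)[OF c] by blast
  qed
  moreover have "trec G c x = G c x (restr f x)" using rec_certD(1)[OF f(2,3) x trec(1)[OF assms]] .
  ultimately show ?thesis using restr(1)[OF f(1) x] by blast
qed

lemma tm_trec:
  assumes "tm K X t" "tm K X s"
  shows "tm K X (\<lambda>e. trec G (t e) (s e))"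
proof -
  have "Def K X (\<lambda>e. rec_val G (t (\<lambda>n. e (Suc n))) (s (\<lambda>n. e (Suc n))) (e 0))"
    by (intro Def_rec_val tm_rename[OF assms(1)] tm_rename[OF assms(2)] tm_v)
  then have "Def K X (\<lambda>e. e 0 = trec G (t (\<lambda>n. e (Suc n))) (s (\<lambda>n. e (Suc n))))"
    by (rule Def_cong[THEN iffD1, rotated])
      (use trec(2) tm_in[OF assms(1)] tm_in[OF assms(2)] in auto)
  then show ?thesis unfolding tm_def using trec(1) tm_in[OF assms(1)] tm_in[OF assms(2)] by blast
qed

end

text \<open>Recursion along a definable relation \<open>\<Phi> c x r y\<close>, read as \<open>y\<close> being the value at \<open>x\<close> when
  \<open>r\<close> is the restriction of the function to the transitive closure of \<open>x\<close>; where \<open>\<Phi>\<close> does not determine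
  a unique \<open>y\<close>, the value is the empty set.\<close>

definition select :: "('a \<Rightarrow> 'a \<Rightarrow> 'a \<Rightarrow> 'a \<Rightarrow> bool) \<Rightarrow> 'a \<Rightarrow> 'a \<Rightarrow> 'a \<Rightarrow> 'a" where
  "select \<Phi> c x r = (if \<exists>!y. y \<in> univ K \<and> \<Phi> c x r y then THE y. y \<in> univ K \<and> \<Phi> c x r y else zero)"

definition setrec :: "('a \<Rightarrow> 'a \<Rightarrow> 'a \<Rightarrow> 'a \<Rightarrow> bool) \<Rightarrow> 'a \<Rightarrow> 'a \<Rightarrow> 'a" where
  "setrec \<Phi> = trec (select \<Phi>)"

lemma select_eq:
  assumes "y \<in> univ K" "\<Phi> c x r y" "\<And>y'. y' \<in> univ K \<Longrightarrow> \<Phi> c x r y' \<Longrightarrow> y' = y"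
  shows "select \<Phi> c x r = y"
proof -
  have "\<exists>!y. y \<in> univ K \<and> \<Phi> c x r y"
    by (rule ex1I[of _ y]) (use assms in blast)+
  moreover have "(THE y. y \<in> univ K \<and> \<Phi> c x r y) = y"
    by (rule the_equality) (use assms in blast)+
  ultimately show ?thesis unfolding select_def by simp
qed

lemma select_cases: "select \<Phi> c x r = zero \<or> \<Phi> c x r (select \<Phi> c x r)"
proof (cases "\<exists>!y. y \<in> univ K \<and> \<Phi> c x r y")
  case True
  from theI'[OF this] True show ?thesis by (simp add: select_def)
qed (simp add: select_def)

lemma select_univ: "select \<Phi> c x r \<in> univ K"
proof (cases "\<exists>!y. y \<in> univ K \<and> \<Phi> c x r y")
  case True
  from theI'[OF this] True show ?thesis by (simp add: select_def)
qed (simp add: select_def)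

context
  fixes \<Phi> :: "'a \<Rightarrow> 'a \<Rightarrow> 'a \<Rightarrow> 'a \<Rightarrow> bool"
  assumes Def\<Phi>: "\<And>i j k l. Def K X (\<lambda>e. \<Phi> (e i) (e j) (e k) (e l))"
begin

lemma tm_select: "tm K X (\<lambda>e. select \<Phi> (e 0) (e (Suc 0)) (e (Suc (Suc 0))))"
proof -
  define Q where "Q c x r y \<longleftrightarrow> \<Phi> c x r y \<and> (\<forall>y'\<in>univ K. \<Phi> c x r y' \<longrightarrow> y' = y)" for c x r y
  have eq: "(Q c x r y \<or> \<not> (\<exists>y\<in>univ K. Q c x r y) \<and> y = zero) \<longleftrightarrow> y = select \<Phi> c x r"
    if "y \<in> univ K" for c x r y
  proof (cases "\<exists>y\<in>univ K. Q c x r y")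
    case True
    then obtain y0 where y0: "y0 \<in> univ K" "Q c x r y0" by blast
    have "select \<Phi> c x r = y0"
      by (rule select_eq) (use y0[unfolded Q_def] in blast)+
    then show ?thesis using y0 that unfolding Q_def by blast
  next
    case False
    then have "\<not> (\<exists>!y. y \<in> univ K \<and> \<Phi> c x r y)" unfolding Q_def by blast
    then have "select \<Phi> c x r = zero" unfolding select_def by auto
    with False that show ?thesis by auto
  qed
  have D: "Def K X (\<lambda>e. Q (e (Suc 0)) (e (Suc (Suc 0))) (e (Suc (Suc (Suc 0)))) (e 0) \<or>
      \<not> (\<exists>y\<in>univ K. Q (e (Suc 0)) (e (Suc (Suc 0))) (e (Suc (Suc (Suc 0)))) y) \<and> e 0 = zero)"
    unfolding Q_def by (intro Def_tms Def\<Phi>)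
  have "Def K X (\<lambda>e. e 0 = select \<Phi> (e (Suc 0)) (e (Suc (Suc 0))) (e (Suc (Suc (Suc 0)))))"
    by (rule Def_cong[THEN iffD1, OF _ D]) (rule eq, simp)
  then show ?thesis unfolding tm_def using select_univ by simp
qed

lemmas tm_setrec = tm_trec[OF tm_select, folded setrec_def]
lemmas setrec_univ = trec(1)[OF tm_select, folded setrec_def]

lemma setrec_unfold:
  assumes "c \<in> univ K" "x \<in> univ K"
  obtains r where "r \<in> univ K"
    "\<And>z w. z \<in> univ K \<Longrightarrow> w \<in> univ K \<Longrightarrow> pair K z w \<in> Ext K r \<longleftrightarrow> z \<in> TC x \<and> w = setrec \<Phi> c z"
    "\<And>y. y \<in> univ K \<Longrightarrow> \<Phi> c x r y \<Longrightarrow> (\<And>y'. y' \<in> univ K \<Longrightarrow> \<Phi> c x r y' \<Longrightarrow> y' = y) \<Longrightarrow> setrec \<Phi> c x = y"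
    "setrec \<Phi> c x = zero \<or> \<Phi> c x r (setrec \<Phi> c x)"
proof -
  obtain r where r: "r \<in> univ K" "Ext K r = (\<lambda>z. pair K z (setrec \<Phi> c z)) ` TC x"
    "setrec \<Phi> c x = select \<Phi> c x r"
    using trec_unfold[OF tm_select assms] unfolding setrec_def by blast
  show thesis
  proof (rule that[OF r(1)])
    fix z w assume "z \<in> univ K" "w \<in> univ K"
    then show "pair K z w \<in> Ext K r \<longleftrightarrow> z \<in> TC x \<and> w = setrec \<Phi> c z"
      unfolding r(2) using setrec_univ[OF assms(1)] TC_univ by (auto simp: image_iff)
  next
    show "setrec \<Phi> c x = zero \<or> \<Phi> c x r (setrec \<Phi> c x)" unfolding r(3) by (rule select_cases)
  next
    fix y assume "y \<in> univ K" "\<Phi> c x r y" "\<And>y'. y' \<in> univ K \<Longrightarrow> \<Phi> c x r y' \<Longrightarrow> y' = y"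
    then show "setrec \<Phi> c x = y" unfolding r(3) by (rule select_eq)
  qed
qed

end

section \<open>Ordinals and the cumulative hierarchy\<close>

definition transitive :: "'a \<Rightarrow> bool" where
  "transitive x \<longleftrightarrow> (\<forall>y\<in>Ext K x. Ext K y \<subseteq> Ext K x)"

text \<open>Under foundation, a transitive set of transitive sets is already an ordinal in the sense
  of \<open>Ord\<close> (\<open>Ord_iff\<close>). All quantifiers here are bounded, so the notion is
  absolute between M and N, which the quantifier over subsets in \<open>Ord\<close> does not
  show.\<close>

definition On :: "'a \<Rightarrow> bool" where
  "On x \<longleftrightarrow> transitive x \<and> (\<forall>y\<in>Ext K x. transitive y)"

lemma Def_transitive: "tm K X t \<Longrightarrow> Def K X (\<lambda>e. transitive (t e))"
  unfolding transitive_def by (rule Def_inst[of K X t "\<lambda>a _. \<forall>y\<in>Ext K a. Ext K y \<subseteq> Ext K a"])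
    (assumption | intro Def_tms)+

lemma Def_On: "tm K X t \<Longrightarrow> Def K X (\<lambda>e. On (t e))"
  unfolding On_def
  by (rule Def_inst[of K X t "\<lambda>a _. transitive a \<and> (\<forall>y\<in>Ext K a. transitive y)"])
    (assumption | intro Def_tms Def_transitive)+

lemma On_mem: "On x \<Longrightarrow> y \<in> Ext K x \<Longrightarrow> On y"
  unfolding On_def transitive_def by blast

lemma On_trans: "On x \<Longrightarrow> y \<in> Ext K x \<Longrightarrow> z \<in> Ext K y \<Longrightarrow> z \<in> Ext K x"
  unfolding On_def transitive_def by blast

text \<open>Double induction on membership: if a and b were incomparable, the two induction
  hypotheses would place the elements of each in the other, making a and b equal.\<close>

lemma On_linear_aux:
  assumes a: "a \<in> univ K"
  shows "\<forall>b\<in>univ K. On a \<longrightarrow> On b \<longrightarrow> a \<in> Ext K b \<or> a = b \<or> b \<in> Ext K a"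
proof (rule mem_induct[OF _ _ a])
  show "Def K X (\<lambda>e. \<forall>b\<in>univ K. On (e 0) \<longrightarrow> On b \<longrightarrow> e 0 \<in> Ext K b \<or> e 0 = b \<or> b \<in> Ext K (e 0))"
    by (intro Def_tms Def_On)
  fix a
  assume a: "a \<in> univ K" and IHa: "\<And>a'. a' \<in> Ext K a \<Longrightarrow>
      \<forall>b\<in>univ K. On a' \<longrightarrow> On b \<longrightarrow> a' \<in> Ext K b \<or> a' = b \<or> b \<in> Ext K a'"
  show "\<forall>b\<in>univ K. On a \<longrightarrow> On b \<longrightarrow> a \<in> Ext K b \<or> a = b \<or> b \<in> Ext K a"
  proof
    fix b assume b: "b \<in> univ K"
    show "On a \<longrightarrow> On b \<longrightarrow> a \<in> Ext K b \<or> a = b \<or> b \<in> Ext K a"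
    proof (rule mem_induct[OF _ _ b])
      show "Def K X (\<lambda>e. On a \<longrightarrow> On (e 0) \<longrightarrow> a \<in> Ext K (e 0) \<or> a = e 0 \<or> e 0 \<in> Ext K a)"
        by (intro Def_tms Def_On tm_const a)
      fix b
      assume b: "b \<in> univ K" and IHb: "\<And>b'. b' \<in> Ext K b \<Longrightarrow>
          On a \<longrightarrow> On b' \<longrightarrow> a \<in> Ext K b' \<or> a = b' \<or> b' \<in> Ext K a"
      show "On a \<longrightarrow> On b \<longrightarrow> a \<in> Ext K b \<or> a = b \<or> b \<in> Ext K a"
      proof (intro impI)
        assume On: "On a" "On b"
        show "a \<in> Ext K b \<or> a = b \<or> b \<in> Ext K a"
        proof (rule ccontr)
          assume n: "\<not> ?thesis"
          have 1: "a' \<in> Ext K b" if "a' \<in> Ext K a" for a'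
            using IHa[OF that] b On_mem[OF On(1) that] On(2) On_trans[OF On(1) that] that n by blast
          have 2: "b' \<in> Ext K a" if "b' \<in> Ext K b" for b'
            using IHb[OF that] On(1) On_mem[OF On(2) that] On_trans[OF On(2) that] that n by blast
          have "a = b" using extensionality[OF a b] 1 2 by blast
          with n show False by blast
        qed
      qed
    qed
  qed
qed

lemma Ord_iff: "x \<in> Ord K \<longleftrightarrow> x \<in> univ K \<and> On x"
proof
  assume "x \<in> Ord K"
  then have x: "x \<in> univ K" "\<forall>y\<in>Ext K x. Ext K y \<subseteq> Ext K x"
    "\<forall>y\<in>Ext K x. \<forall>z\<in>Ext K x. \<forall>w\<in>Ext K x. y \<in> Ext K z \<and> z \<in> Ext K w \<longrightarrow> y \<in> Ext K w"
    unfolding Ord_def mem_Collect_eq by - (elim conjE, assumption)+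
  have "Ext K z \<subseteq> Ext K y" if "y \<in> Ext K x" "z \<in> Ext K y" for y z
    using that x(2,3) by blast
  then show "x \<in> univ K \<and> On x" using x(1,2) unfolding On_def transitive_def by blast
next
  assume x: "x \<in> univ K \<and> On x"
  have mem: "y \<in> univ K \<and> On y" if "y \<in> Ext K x" for y
    using that x Ext_univ On_mem by blast
  have lin: "\<forall>y\<in>Ext K x. \<forall>z\<in>Ext K x. y \<in> Ext K z \<or> y = z \<or> z \<in> Ext K y"
    using On_linear_aux mem by blast
  have min: "\<exists>m\<in>Ext K s. \<forall>y\<in>Ext K s. m = y \<or> m \<in> Ext K y"
    if s: "s \<in> univ K" "Ext K s \<subseteq> Ext K x" "Ext K s \<noteq> {}" for s
  proof -
    obtain m where "m \<in> Ext K s" "Ext K m \<inter> Ext K s = {}" using foundation[OF s(1,3)] by blast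
    then show ?thesis using lin s(2) by blast
  qed
  show "x \<in> Ord K"
    unfolding Ord_def mem_Collect_eq
  proof (intro conjI)
    show "x \<in> univ K" using x by blast
    show "\<forall>y\<in>Ext K x. Ext K y \<subseteq> Ext K x" using x unfolding On_def transitive_def by blast
    show "\<forall>y\<in>Ext K x. y \<notin> Ext K y" using not_mem_self by blast
    show "\<forall>y\<in>Ext K x. \<forall>z\<in>Ext K x. \<forall>w\<in>Ext K x. y \<in> Ext K z \<and> z \<in> Ext K w \<longrightarrow> y \<in> Ext K w"
      using mem On_trans by blast
    show "\<forall>s\<in>univ K. Ext K s \<subseteq> Ext K x \<and> Ext K s \<noteq> {} \<longrightarrow>
        (\<exists>m\<in>Ext K s. \<forall>y\<in>Ext K s. m = y \<or> m \<in> Ext K y)" using min by blast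
  qed (rule lin)
qed

lemma Def_Ord:
  assumes "tm K X t"
  shows "Def K X (\<lambda>e. t e \<in> Ord K)"
  by (rule Def_cong[THEN iffD1, OF _ Def_On[OF assms]]) (simp add: Ord_iff tm_in[OF assms])

lemma Ord_univ: "x \<in> Ord K \<Longrightarrow> x \<in> univ K"
  by (simp add: Ord_def)

lemma Ord_mem: "x \<in> Ord K \<Longrightarrow> y \<in> Ext K x \<Longrightarrow> y \<in> Ord K"
  using On_mem Ext_univ by (auto simp: Ord_iff)

lemma Ord_trans: "x \<in> Ord K \<Longrightarrow> y \<in> Ext K x \<Longrightarrow> z \<in> Ext K y \<Longrightarrow> z \<in> Ext K x"
  using On_trans by (auto simp: Ord_iff)

lemma Ord_linear: "x \<in> Ord K \<Longrightarrow> y \<in> Ord K \<Longrightarrow> x \<in> Ext K y \<or> x = y \<or> y \<in> Ext K x"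
  using On_linear_aux by (auto simp: Ord_iff)

lemma zero_Ord: "zero \<in> Ord K"
  by (simp add: Ord_iff On_def transitive_def)

lemma least_exists:
  assumes "Def K X (\<lambda>e. P (e 0))" "a \<in> univ K" "P a"
  shows "\<exists>b\<in>univ K. P b \<and> (\<forall>c\<in>Ext K b. \<not> P c)"
proof (rule ccontr)
  assume n: "\<not> ?thesis"
  have "\<not> P a"
    by (rule mem_induct[OF Def_neg[OF assms(1)] _ assms(2)]) (use n in blast)
  then show False using assms(3) by blast
qed

lemma Ord_bound:
  assumes s: "s \<in> univ K" and sub: "Ext K s \<subseteq> Ord K"
  shows "\<exists>a\<in>Ord K. Ext K s \<subseteq> Ext K a"
proof -
  have i: "isset (Ext K s \<union> Ext K (bigun s))"
    by (intro isset_Un isset_Ext_self s bigun(1))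
  \<comment> \<open>The union alone would only be a supremum; including the elements of
    \<open>s\<close> makes the bound strict.\<close>
  define a where "a = the_set K (Ext K s \<union> Ext K (bigun s))"
  have a: "a \<in> univ K" "Ext K a = Ext K s \<union> (\<Union>y\<in>Ext K s. Ext K y)"
    using isset_univ[OF i] isset_Ext[OF i] s by (simp_all add: a_def)
  have "On y" if "y \<in> Ext K a" for y using that sub Ord_iff On_mem unfolding a(2) by blast
  moreover have "transitive a" unfolding transitive_def a(2)
    using sub Ord_trans by blast
  ultimately have "a \<in> Ord K" using a(1) unfolding Ord_iff On_def by blast
  then show ?thesis using a(2) by blast
qed

definition V_step :: "'a \<Rightarrow> 'a \<Rightarrow> 'a \<Rightarrow> 'a \<Rightarrow> bool" where
  "V_step c x r y \<longleftrightarrow> (\<forall>z\<in>univ K. z \<in> Ext K y \<longleftrightarrow>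
     (\<exists>b\<in>Ext K x. \<exists>w\<in>univ K. pair K b w \<in> Ext K r \<and> Ext K z \<subseteq> Ext K w))"

lemma Def_V_step: "Def K X (\<lambda>e. V_step (e i) (e j) (e k) (e l))"
  unfolding V_step_def by (intro Def_tms)

text \<open>\<open>V x\<close> is \<open>V\<^sub>\<alpha>\<close> for \<open>\<alpha>\<close> the rank of \<open>x\<close>.\<close>

definition V :: "'a \<Rightarrow> 'a" where "V x = setrec V_step zero x"

lemma tm_V: "tm K X t \<Longrightarrow> tm K X (\<lambda>e. V (t e))"
  unfolding V_def by (rule tm_setrec[where \<Phi> = V_step, OF Def_V_step tm_zero])

lemma V_univ [simp]: "x \<in> univ K \<Longrightarrow> V x \<in> univ K"
  unfolding V_def by (rule setrec_univ[where \<Phi> = V_step, OF Def_V_step zero(1)])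

lemma Ext_V:
  assumes x: "x \<in> univ K"
  shows "Ext K (V x) = {z \<in> univ K. \<exists>b\<in>Ext K x. Ext K z \<subseteq> Ext K (V b)}"
proof -
  obtain r where r: "r \<in> univ K"
    "\<And>z w. z \<in> univ K \<Longrightarrow> w \<in> univ K \<Longrightarrow> pair K z w \<in> Ext K r \<longleftrightarrow> z \<in> TC x \<and> w = V z"
    "\<And>y. y \<in> univ K \<Longrightarrow> V_step zero x r y \<Longrightarrow>
      (\<And>y'. y' \<in> univ K \<Longrightarrow> V_step zero x r y' \<Longrightarrow> y' = y) \<Longrightarrow> V x = y"
    using setrec_unfold[where \<Phi> = V_step, OF Def_V_step zero(1) x] unfolding V_def by metis
  have step: "V_step zero x r y \<longleftrightarrow> Ext K y = {z \<in> univ K. \<exists>b\<in>Ext K x. Ext K z \<subseteq> Ext K (V b)}" for y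
  proof -
    have "(\<exists>w\<in>univ K. pair K b w \<in> Ext K r \<and> Ext K z \<subseteq> Ext K w) \<longleftrightarrow> Ext K z \<subseteq> Ext K (V b)"
      if "b \<in> Ext K x" for b z
      using r(2)[OF Ext_univ[OF that]] V_univ[OF Ext_univ[OF that]] that Ext_subset_TC by blast
    then have "V_step zero x r y \<longleftrightarrow>
        (\<forall>z\<in>univ K. z \<in> Ext K y \<longleftrightarrow> (\<exists>b\<in>Ext K x. Ext K z \<subseteq> Ext K (V b)))"
      by (simp add: V_step_def)
    also have "\<dots> \<longleftrightarrow> Ext K y = {z \<in> univ K. \<exists>b\<in>Ext K x. Ext K z \<subseteq> Ext K (V b)}"
      using Ext_univ by blast
    finally show ?thesis .
  qed
  \<comment> \<open>Replacement and power set bound the intended value. Hence the step relation has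
    a unique solution, and the default value of \<open>setrec\<close> is not taken.\<close>
  have i: "isset (V ` Ext K x)" by (rule isset_image[OF x tm_V[OF tm_v]])
  define u where "u = bigun (the_set K (V ` Ext K x))"
  have u: "u \<in> univ K" "Ext K u = (\<Union>b\<in>Ext K x. Ext K (V b))"
    unfolding u_def using isset_univ[OF i] isset_Ext[OF i] by auto
  obtain p where p: "p \<in> univ K" "Ext K p = {z \<in> univ K. Ext K z \<subseteq> Ext K u}" using powerset[OF u(1)] by blast
  have "isset {z \<in> univ K. \<exists>b\<in>Ext K x. Ext K z \<subseteq> Ext K (V b)}"
  proof (rule isset_bounded[OF p(1)])
    show "Def K X (\<lambda>e. \<exists>b\<in>Ext K x. Ext K (e 0) \<subseteq> Ext K (V b))"
      by (intro Def_tms tm_V tm_const x)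
  qed (use p(2) u(2) in blast)
  then obtain y where y: "y \<in> univ K" "Ext K y = {z \<in> univ K. \<exists>b\<in>Ext K x. Ext K z \<subseteq> Ext K (V b)}"
    unfolding isset_def by blast
  have "V x = y"
  proof (rule r(3)[OF y(1)])
    show "V_step zero x r y" unfolding step by (rule y(2))
    show "y' = y" if "y' \<in> univ K" "V_step zero x r y'" for y'
      using extensionality[OF that(1) y(1)] that(2) y(2) unfolding step by simp
  qed
  then show ?thesis using y(2) by simp
qed

lemma V_mono: assumes "a \<in> Ord K" "b \<in> Ext K a" shows "Ext K (V b) \<subseteq> Ext K (V a)"
  unfolding Ext_V[OF Ord_univ[OF assms(1)]] Ext_V[OF Ext_univ[OF assms(2)]]
  using Ord_trans[OF assms] by blast

lemma subset_V_self:
  assumes x: "x \<in> univ K"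
  shows "Ext K x \<subseteq> Ext K (V x)"
proof (rule mem_induct[OF _ _ x])
  show "Def K X (\<lambda>e. Ext K (e 0) \<subseteq> Ext K (V (e 0)))" by (intro Def_tms tm_V)
  fix x assume "x \<in> univ K" "\<And>y. y \<in> Ext K x \<Longrightarrow> Ext K y \<subseteq> Ext K (V y)"
  then show "Ext K x \<subseteq> Ext K (V x)" unfolding Ext_V[OF \<open>x \<in> univ K\<close>] using Ext_univ by blast
qed

lemma subset_V_exists:
  assumes x: "x \<in> univ K"
  shows "\<exists>a\<in>univ K. a \<in> Ord K \<and> Ext K x \<subseteq> Ext K (V a)"
proof (rule mem_induct[OF _ _ x])
  show "Def K X (\<lambda>e. \<exists>a\<in>univ K. a \<in> Ord K \<and> Ext K (e 0) \<subseteq> Ext K (V a))"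
    by (intro Def_tms tm_V Def_Ord)
  fix x assume x: "x \<in> univ K"
    and IH: "\<And>y. y \<in> Ext K x \<Longrightarrow> \<exists>a\<in>univ K. a \<in> Ord K \<and> Ext K y \<subseteq> Ext K (V a)"
  have D: "Def K X (\<lambda>e. e (Suc 0) \<in> Ord K \<and> Ext K (e 0) \<subseteq> Ext K (V (e (Suc 0))))"
    by (intro Def_tms tm_V Def_Ord)
  have "\<exists>b\<in>univ K. \<forall>y\<in>Ext K x. \<exists>a\<in>Ext K b. a \<in> Ord K \<and> Ext K y \<subseteq> Ext K (V a)"
    by (rule Collection[OF x D]) (use IH in blast)
  then obtain b where b: "b \<in> univ K" "\<forall>y\<in>Ext K x. \<exists>a\<in>Ext K b. a \<in> Ord K \<and> Ext K y \<subseteq> Ext K (V a)"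
    by blast
  have "\<exists>b'\<in>univ K. Ext K b' = {a \<in> Ext K b. a \<in> Ord K}"
    by (rule Separation[OF b(1)]) (intro Def_Ord tm_v)
  then obtain b' where b': "b' \<in> univ K" "Ext K b' = {a \<in> Ext K b. a \<in> Ord K}" by blast
  obtain a where a: "a \<in> Ord K" "Ext K b' \<subseteq> Ext K a" using Ord_bound[OF b'(1)] b'(2) by blast
  have "Ext K x \<subseteq> Ext K (V a)" unfolding Ext_V[OF Ord_univ[OF a(1)]]
    using b(2) b'(2) a(2) Ext_univ by blast
  then show "\<exists>a\<in>univ K. a \<in> Ord K \<and> Ext K x \<subseteq> Ext K (V a)" using a(1) Ord_univ by blast
qed

lemma codes_fun_pair:
  assumes "codes_fun K f d F" "d \<in> univ K" "x \<in> univ K" "y \<in> univ K"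
  shows "pair K x y \<in> Ext K f \<longleftrightarrow> x \<in> Ext K d \<and> y = F x"
proof -
  have "F z \<in> univ K" if "z \<in> Ext K d" for z using assms(1) that unfolding codes_fun_def by blast
  then show ?thesis using assms Ext_univ unfolding codes_fun_def by (auto simp: image_iff)
qed

lemma is_V_iff: "is_V K a v \<longleftrightarrow> a \<in> Ord K \<and> v = V a"
proof
  assume "is_V K a v"
  then obtain f F where a: "a \<in> Ord K" and v: "v \<in> univ K" and f: "codes_fun K f a F"
    and F: "\<forall>\<alpha>\<in>Ext K a. Ext K (F \<alpha>) = {z \<in> univ K. \<exists>\<beta>\<in>Ext K \<alpha>. Ext K z \<subseteq> Ext K (F \<beta>)}"
    and vF: "Ext K v = {z \<in> univ K. \<exists>\<beta>\<in>Ext K a. Ext K z \<subseteq> Ext K (F \<beta>)}"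
    unfolding is_V_def by blast
  have au: "a \<in> univ K" using a Ord_univ by blast
  have fu: "f \<in> univ K" and Fu: "\<And>b. b \<in> Ext K a \<Longrightarrow> F b \<in> univ K"
    using f unfolding codes_fun_def by auto
  have FV: "F b = V b" if b: "b \<in> Ext K a" for b
  proof -
    \<comment> \<open>\<open>F\<close> is a function of the metatheory. The induction needs a
      definable statement, so it refers to the values through the code \<open>f\<close>.\<close>
    have "b \<in> Ext K a \<longrightarrow> (\<forall>w\<in>univ K. pair K b w \<in> Ext K f \<longrightarrow> w = V b)"
    proof (rule mem_induct[OF _ _ Ext_univ[OF b]])
      show "Def K X (\<lambda>e. e 0 \<in> Ext K a \<longrightarrow> (\<forall>w\<in>univ K. pair K (e 0) w \<in> Ext K f \<longrightarrow> w = V (e 0)))"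
        by (intro Def_tms tm_V tm_const au fu)
      fix c assume c: "c \<in> univ K"
        and IH: "\<And>b. b \<in> Ext K c \<Longrightarrow> b \<in> Ext K a \<longrightarrow> (\<forall>w\<in>univ K. pair K b w \<in> Ext K f \<longrightarrow> w = V b)"
      show "c \<in> Ext K a \<longrightarrow> (\<forall>w\<in>univ K. pair K c w \<in> Ext K f \<longrightarrow> w = V c)"
      proof (intro impI ballI)
        fix w assume ca: "c \<in> Ext K a" and w: "w \<in> univ K" "pair K c w \<in> Ext K f"
        have "w = F c" using codes_fun_pair[OF f au c w(1)] w(2) by blast
        moreover have "F b = V b" if "b \<in> Ext K c" for b
        proof -
          have ba: "b \<in> Ext K a" using Ord_trans[OF a ca that] .
          then have "pair K b (F b) \<in> Ext K f"
            using codes_fun_pair[OF f au Ext_univ[OF ba] Fu[OF ba]] by blast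
          then show ?thesis using IH[OF that] ba Fu[OF ba] by blast
        qed
        ultimately have "Ext K w = Ext K (V c)" using F ca Ext_V[OF c] by simp
        then show "w = V c" using extensionality w(1) c by simp
      qed
    qed
    moreover have "pair K b (F b) \<in> Ext K f"
      using codes_fun_pair[OF f au Ext_univ[OF b] Fu[OF b]] b by blast
    ultimately show ?thesis using b Fu[OF b] by blast
  qed
  then have "Ext K v = Ext K (V a)" using vF Ext_V[OF au] by simp
  then show "a \<in> Ord K \<and> v = V a" using a au v extensionality by simp
next
  assume *: "a \<in> Ord K \<and> v = V a"
  then have a: "a \<in> univ K" using Ord_univ by blast
  have "tm K X (\<lambda>e. pair K (e 0) (V (e 0)))" by (intro tm_pair tm_V tm_v)
  then have "isset ((\<lambda>x. pair K x (V x)) ` Ext K a)" by (rule isset_image[OF a])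
  then obtain f where "f \<in> univ K" "Ext K f = (\<lambda>x. pair K x (V x)) ` Ext K a"
    unfolding isset_def by blast
  then have "codes_fun K f a V" unfolding codes_fun_def using Ext_univ by auto
  moreover have "\<forall>\<alpha>\<in>Ext K a. Ext K (V \<alpha>) = {z \<in> univ K. \<exists>\<beta>\<in>Ext K \<alpha>. Ext K z \<subseteq> Ext K (V \<beta>)}"
    using Ext_V Ext_univ by blast
  ultimately show "is_V K a v" unfolding is_V_def using * Ext_V[OF a] V_univ[OF a] by blast
qed

lemma is_rank_iff:
  "is_rank K x a \<longleftrightarrow> a \<in> Ord K \<and> Ext K x \<subseteq> Ext K (V a) \<and> (\<forall>b\<in>Ext K a. \<not> Ext K x \<subseteq> Ext K (V b))"
  unfolding is_rank_def is_V_iff using Ord_mem by blast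

lemma is_rank_exists:
  assumes x: "x \<in> univ K"
  shows "\<exists>a. is_rank K x a"
proof -
  have D: "Def K X (\<lambda>e. e 0 \<in> Ord K \<and> Ext K x \<subseteq> Ext K (V (e 0)))"
    by (intro Def_tms Def_Ord tm_V tm_const x)
  obtain a where a: "a \<in> univ K" "a \<in> Ord K \<and> Ext K x \<subseteq> Ext K (V a)"
    using subset_V_exists[OF x] by blast
  have "\<exists>b\<in>univ K. (b \<in> Ord K \<and> Ext K x \<subseteq> Ext K (V b)) \<and>
      (\<forall>c\<in>Ext K b. \<not> (c \<in> Ord K \<and> Ext K x \<subseteq> Ext K (V c)))"
    by (rule least_exists[OF D a])
  then show ?thesis unfolding is_rank_iff using Ord_mem by blast
qed

section \<open>Satisfaction in a set\<close>

lemma tm_tagged: "tm K X t \<Longrightarrow> tm K X (\<lambda>e. tagged K k (t e))"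
  unfolding tagged_def by (rule tm_pair[OF tm_const[OF numeral_in(1)]])

lemma tm_codes:
  "tm K X t \<Longrightarrow> tm K X (\<lambda>e. cVar K (t e))"
  "tm K X t \<Longrightarrow> tm K X (\<lambda>e. cConst K (t e))"
  "tm K X t \<Longrightarrow> tm K X s \<Longrightarrow> tm K X (\<lambda>e. cEq K (t e) (s e))"
  "tm K X t \<Longrightarrow> tm K X s \<Longrightarrow> tm K X (\<lambda>e. cMem K (t e) (s e))"
  "tm K X t \<Longrightarrow> tm K X (\<lambda>e. cNeg K (t e))"
  "tm K X t \<Longrightarrow> tm K X s \<Longrightarrow> tm K X (\<lambda>e. cOr K (t e) (s e))"
  "tm K X t \<Longrightarrow> tm K X s \<Longrightarrow> tm K X (\<lambda>e. cEx K (t e) (s e))"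
  unfolding cVar_def cConst_def cEq_def cMem_def cNeg_def cOr_def cEx_def
  by (intro tm_tagged tm_pair; assumption)+

lemma tagged_univ [simp]: "a \<in> univ K \<Longrightarrow> tagged K k a \<in> univ K"
  by (simp add: tagged_def numeral_in)

lemma tagged_inject [simp]:
  "a \<in> univ K \<Longrightarrow> b \<in> univ K \<Longrightarrow> tagged K k a = tagged K l b \<longleftrightarrow> k = l \<and> a = b"
  by (simp add: tagged_def numeral_in)

lemma codes_univ [simp]:
  "a \<in> univ K \<Longrightarrow> cVar K a \<in> univ K" "a \<in> univ K \<Longrightarrow> cConst K a \<in> univ K"
  "a \<in> univ K \<Longrightarrow> b \<in> univ K \<Longrightarrow> cEq K a b \<in> univ K"
  "a \<in> univ K \<Longrightarrow> b \<in> univ K \<Longrightarrow> cMem K a b \<in> univ K"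
  "a \<in> univ K \<Longrightarrow> cNeg K a \<in> univ K"
  "a \<in> univ K \<Longrightarrow> b \<in> univ K \<Longrightarrow> cOr K a b \<in> univ K"
  "a \<in> univ K \<Longrightarrow> b \<in> univ K \<Longrightarrow> cEx K a b \<in> univ K"
  by (simp_all add: cVar_def cConst_def cEq_def cMem_def cNeg_def cOr_def cEx_def)

lemmas code_defs = cVar_def cConst_def cEq_def cMem_def cNeg_def cOr_def cEx_def

lemma mem_TC_pair:
  assumes "a \<in> univ K" "b \<in> univ K"
  shows "a \<in> TC (pair K a b)" "b \<in> TC (pair K a b)"
proof -
  have "the_set K {a, b} \<in> TC (pair K a b)"
    using Ext_subset_TC[of "pair K a b"] Ext_pair[OF assms] by blast
  from TC_trans1[OF this] show "a \<in> TC (pair K a b)" "b \<in> TC (pair K a b)"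
    using isset_Ext[OF isset_two[OF assms]] by auto
qed

text \<open>This puts the immediate subformulas within reach of recursion along transitive
  closures.\<close>

lemma mem_TC_codes:
  assumes "a \<in> univ K" "b \<in> univ K"
  shows "a \<in> TC (tagged K k a)" "a \<in> TC (tagged K k (pair K a b))" "b \<in> TC (tagged K k (pair K a b))"
proof -
  have *: "c \<in> TC (tagged K k c)" if "c \<in> univ K" for c
    unfolding tagged_def by (rule mem_TC_pair[OF numeral_in(1) that])
  then show "a \<in> TC (tagged K k a)" using assms by blast
  have "TC (pair K a b) \<subseteq> TC (tagged K k (pair K a b))"
    by (rule TC_trans[OF *]) (use assms in simp_all)
  then show "a \<in> TC (tagged K k (pair K a b))" "b \<in> TC (tagged K k (pair K a b))"
    using mem_TC_pair[OF assms] by blast+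
qed

definition upd :: "'a \<Rightarrow> 'a \<Rightarrow> 'a \<Rightarrow> 'a" where
  "upd e i x = the_set K (insert (pair K i x) {p \<in> Ext K e. \<forall>y\<in>univ K. p \<noteq> pair K i y})"

lemma isset_upd:
  assumes "e \<in> univ K" "i \<in> univ K" "x \<in> univ K"
  shows "isset (insert (pair K i x) {p \<in> Ext K e. \<forall>y\<in>univ K. p \<noteq> pair K i y})"
proof (rule isset_insert)
  have "Def K X (\<lambda>e. \<forall>y\<in>univ K. e 0 \<noteq> pair K i y)" by (intro Def_tms tm_const assms)
  then show "isset {p \<in> Ext K e. \<forall>y\<in>univ K. p \<noteq> pair K i y}" by (rule isset_Collect[OF assms(1)])
qed (use assms in simp)

lemma upd:
  assumes "e \<in> univ K" "i \<in> univ K" "x \<in> univ K"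
  shows "upd e i x \<in> univ K"
    "Ext K (upd e i x) = insert (pair K i x) {p \<in> Ext K e. \<forall>y\<in>univ K. p \<noteq> pair K i y}"
  unfolding upd_def using isset_upd[OF assms] isset_univ isset_Ext by auto

lemma tm_upd:
  assumes "tm K X t" "tm K X s" "tm K X r"
  shows "tm K X (\<lambda>e. upd (t e) (s e) (r e))"
  unfolding upd_def
proof (rule tm_the_set)
  show "Def K X (\<lambda>e. e 0 \<in> insert (pair K (s (\<lambda>n. e (Suc n))) (r (\<lambda>n. e (Suc n))))
      {p \<in> Ext K (t (\<lambda>n. e (Suc n))). \<forall>y\<in>univ K. p \<noteq> pair K (s (\<lambda>n. e (Suc n))) y})"
    unfolding insert_iff mem_Collect_eq
    by (intro Def_tms tm_rename[OF assms(1)] tm_rename[OF assms(2)] tm_rename[OF assms(3)])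
qed (use isset_upd assms tm_in in blast)

lemma pair_mem_upd:
  assumes "e \<in> univ K" "i \<in> univ K" "x \<in> univ K" "j \<in> univ K" "y \<in> univ K"
  shows "pair K j y \<in> Ext K (upd e i x) \<longleftrightarrow> (if j = i then y = x else pair K j y \<in> Ext K e)"
  unfolding upd(2)[OF assms(1-3)] using assms by auto

lemma upd_same:
  assumes "e \<in> univ K" "i \<in> univ K" "x \<in> univ K" "y \<in> univ K"
  shows "upd (upd e i x) i y = upd e i y"
proof (rule extensionality)
  show "Ext K (upd (upd e i x) i y) = Ext K (upd e i y)"
    using assms by (auto simp: upd)
qed (use assms upd in simp_all)

lemma upd_commute:
  assumes "e \<in> univ K" "i \<in> univ K" "x \<in> univ K" "j \<in> univ K" "y \<in> univ K" "i \<noteq> j"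
  shows "upd (upd e i x) j y = upd (upd e j y) i x"
proof (rule extensionality)
  show "Ext K (upd (upd e i x) j y) = Ext K (upd (upd e j y) i x)"
    using assms by (auto simp: upd)
qed (use assms upd in simp_all)

text \<open>Assignments are arbitrary relations between elements of \<open>u\<close>, so that no code for functions
  from variables to values is needed.\<close>

definition assignment :: "'a \<Rightarrow> 'a \<Rightarrow> bool" where
  "assignment u e \<longleftrightarrow> (\<forall>p\<in>Ext K e. \<forall>q\<in>Ext K p. Ext K q \<subseteq> Ext K u)"

lemma Def_assignment:
  assumes "tm K X t" "tm K X s"
  shows "Def K X (\<lambda>e. assignment (t e) (s e))"
  unfolding assignment_def
  by (intro Def_tms tm_rename[OF assms(1)] tm_rename[OF assms(2)] assms)

lemma assignment_zero: "assignment u zero"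
  by (simp add: assignment_def)

lemma assignment_upd:
  assumes "assignment u e" "e \<in> univ K" "i \<in> Ext K u" "x \<in> Ext K u"
  shows "assignment u (upd e i x)"
proof -
  have u: "i \<in> univ K" "x \<in> univ K" using assms Ext_univ by auto
  have "Ext K q \<subseteq> Ext K u" if "q \<in> Ext K (pair K i x)" for q
    using that assms(3,4) isset_Ext[OF isset_one[OF u(1)]] isset_Ext[OF isset_two[OF u]]
    unfolding Ext_pair[OF u] by auto
  then show ?thesis using assms(1) unfolding assignment_def upd(2)[OF assms(2) u] by blast
qed

text \<open>Unfolded, the condition on e says that it belongs to the third power set of u. So the
  assignments satisfying a formula form a set, which can be the value of a recursion.\<close>

lemma assignment_bound:
  assumes "u \<in> univ K"
  shows "\<exists>a\<in>univ K. \<forall>e\<in>univ K. assignment u e \<longrightarrow> e \<in> Ext K a"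
proof -
  obtain p1 where p1: "p1 \<in> univ K" "Ext K p1 = {z \<in> univ K. Ext K z \<subseteq> Ext K u}"
    using powerset[OF assms] by blast
  obtain p2 where p2: "p2 \<in> univ K" "Ext K p2 = {z \<in> univ K. Ext K z \<subseteq> Ext K p1}"
    using powerset[OF p1(1)] by blast
  obtain p3 where p3: "p3 \<in> univ K" "Ext K p3 = {z \<in> univ K. Ext K z \<subseteq> Ext K p2}"
    using powerset[OF p2(1)] by blast
  have "e \<in> Ext K p3" if "e \<in> univ K" "assignment u e" for e
    unfolding p3(2)
  proof (intro CollectI conjI subsetI that(1))
    fix p assume p: "p \<in> Ext K e"
    show "p \<in> Ext K p2" unfolding p2(2)
    proof (intro CollectI conjI subsetI Ext_univ[OF p])
      fix q assume q: "q \<in> Ext K p"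
      show "q \<in> Ext K p1" unfolding p1(2) using that(2) p q Ext_univ[OF q]
        unfolding assignment_def by blast
    qed
  qed
  then show ?thesis using p3(1) by blast
qed

text \<open>A relation, since an assignment may give a variable no value or several.\<close>

definition denotes :: "'a \<Rightarrow> 'a \<Rightarrow> 'a \<Rightarrow> bool" where
  "denotes t e x \<longleftrightarrow> t = cConst K x \<or> (\<exists>i\<in>univ K. t = cVar K i \<and> pair K i x \<in> Ext K e)"

lemma Def_denotes:
  assumes "tm K X t" "tm K X s" "tm K X r"
  shows "Def K X (\<lambda>e. denotes (t e) (s e) (r e))"
  unfolding denotes_def
  by (intro Def_tms tm_codes tm_rename[OF assms(1)] tm_rename[OF assms(2)] tm_rename[OF assms(3)] assms)

text \<open>The set \<open>r\<close> supplies, for each subformula, the set of assignments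
  satisfying it. Any set may stand for the formula; one that has none of the five shapes is
  satisfied by nothing. The Tarski clauses for \<open>Sat\<close> thus hold without a check that the
  parts are formulas.\<close>

definition sat_clause :: "'a \<Rightarrow> 'a \<Rightarrow> 'a \<Rightarrow> 'a \<Rightarrow> bool" where
  "sat_clause u \<phi> r e \<longleftrightarrow>
     (\<exists>t\<in>univ K. \<exists>s\<in>univ K. \<phi> = cEq K t s \<and> (\<exists>x\<in>Ext K u. denotes t e x \<and> denotes s e x)) \<or>
     (\<exists>t\<in>univ K. \<exists>s\<in>univ K. \<phi> = cMem K t s \<and>
        (\<exists>x\<in>Ext K u. \<exists>y\<in>Ext K u. denotes t e x \<and> denotes s e y \<and> x \<in> Ext K y)) \<or>
     (\<exists>\<psi>\<in>univ K. \<exists>\<tau>\<in>univ K. \<phi> = cNeg K \<psi> \<and> pair K \<psi> \<tau> \<in> Ext K r \<and> e \<notin> Ext K \<tau>) \<or>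
     (\<exists>\<psi>\<in>univ K. \<exists>\<chi>\<in>univ K. \<exists>\<tau>\<in>univ K. \<exists>\<sigma>\<in>univ K. \<phi> = cOr K \<psi> \<chi> \<and>
        pair K \<psi> \<tau> \<in> Ext K r \<and> pair K \<chi> \<sigma> \<in> Ext K r \<and> (e \<in> Ext K \<tau> \<or> e \<in> Ext K \<sigma>)) \<or>
     (\<exists>i\<in>univ K. \<exists>\<psi>\<in>univ K. \<exists>\<tau>\<in>univ K. \<phi> = cEx K i \<psi> \<and> pair K \<psi> \<tau> \<in> Ext K r \<and>
        (\<exists>x\<in>Ext K u. upd e i x \<in> Ext K \<tau>))"

lemma Def_sat_clause:
  assumes "tm K X t" "tm K X s" "tm K X r" "tm K X q"
  shows "Def K X (\<lambda>e. sat_clause (t e) (s e) (r e) (q e))"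
  unfolding sat_clause_def
  by (intro Def_tms tm_codes Def_denotes tm_upd tm_rename[OF assms(1)] tm_rename[OF assms(2)]
      tm_rename[OF assms(3)] tm_rename[OF assms(4)])

definition sat_step :: "'a \<Rightarrow> 'a \<Rightarrow> 'a \<Rightarrow> 'a \<Rightarrow> bool" where
  "sat_step u \<phi> r y \<longleftrightarrow> (\<forall>e\<in>univ K. e \<in> Ext K y \<longleftrightarrow> assignment u e \<and> sat_clause u \<phi> r e)"

lemma Def_sat_step: "Def K X (\<lambda>e. sat_step (e i) (e j) (e k) (e l))"
  unfolding sat_step_def by (intro Def_tms Def_assignment Def_sat_clause)

definition Sat :: "'a \<Rightarrow> 'a \<Rightarrow> 'a \<Rightarrow> bool" where
  "Sat u \<phi> e \<longleftrightarrow> e \<in> Ext K (setrec sat_step u \<phi>)"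

lemma Def_Sat:
  assumes "tm K X t" "tm K X s" "tm K X r"
  shows "Def K X (\<lambda>e. Sat (t e) (s e) (r e))"
  unfolding Sat_def
  by (intro Def_mem tm_setrec[where \<Phi> = sat_step, OF Def_sat_step] assms)

lemma Sat_unfold:
  assumes u: "u \<in> univ K" and \<phi>: "\<phi> \<in> univ K"
  obtains r where "r \<in> univ K"
    "\<And>z w. z \<in> univ K \<Longrightarrow> w \<in> univ K \<Longrightarrow> pair K z w \<in> Ext K r \<longleftrightarrow> z \<in> TC \<phi> \<and> w = setrec sat_step u z"
    "\<And>e. e \<in> univ K \<Longrightarrow> Sat u \<phi> e \<longleftrightarrow> assignment u e \<and> sat_clause u \<phi> r e"
proof -
  obtain r where r: "r \<in> univ K"
    "\<And>z w. z \<in> univ K \<Longrightarrow> w \<in> univ K \<Longrightarrow> pair K z w \<in> Ext K r \<longleftrightarrow> z \<in> TC \<phi> \<and> w = setrec sat_step u z"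
    "\<And>y. y \<in> univ K \<Longrightarrow> sat_step u \<phi> r y \<Longrightarrow>
      (\<And>y'. y' \<in> univ K \<Longrightarrow> sat_step u \<phi> r y' \<Longrightarrow> y' = y) \<Longrightarrow> setrec sat_step u \<phi> = y"
    using setrec_unfold[where \<Phi> = sat_step, OF Def_sat_step u \<phi>] by metis
  obtain a where a: "a \<in> univ K" "\<forall>e\<in>univ K. assignment u e \<longrightarrow> e \<in> Ext K a"
    using assignment_bound[OF u] by blast
  have "isset {e \<in> univ K. assignment u e \<and> sat_clause u \<phi> r e}"
  proof (rule isset_bounded[OF a(1)])
    show "Def K X (\<lambda>e. assignment u (e 0) \<and> sat_clause u \<phi> r (e 0))"
      by (intro Def_tms Def_assignment Def_sat_clause tm_const u \<phi> r(1))
  qed (use a(2) in blast)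
  then obtain y where y: "y \<in> univ K" "Ext K y = {e \<in> univ K. assignment u e \<and> sat_clause u \<phi> r e}"
    unfolding isset_def by blast
  have "setrec sat_step u \<phi> = y"
  proof (rule r(3)[OF y(1)])
    show "sat_step u \<phi> r y" unfolding sat_step_def y(2) by blast
    fix y' assume y': "y' \<in> univ K" "sat_step u \<phi> r y'"
    have "Ext K y' = Ext K y" unfolding y(2) using y'(2) Ext_univ unfolding sat_step_def by blast
    then show "y' = y" using extensionality y' y by blast
  qed
  then have "Sat u \<phi> e \<longleftrightarrow> assignment u e \<and> sat_clause u \<phi> r e" if "e \<in> univ K" for e
    unfolding Sat_def using y(2) that by simp
  then show thesis using that r(1,2) by blast
qed

lemma Sat_Eq:
  assumes "u \<in> univ K" "e \<in> univ K" "assignment u e" "t \<in> univ K" "s \<in> univ K"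
  shows "Sat u (cEq K t s) e \<longleftrightarrow> (\<exists>x\<in>Ext K u. denotes t e x \<and> denotes s e x)"
proof -
  obtain r where "Sat u (cEq K t s) e \<longleftrightarrow> assignment u e \<and> sat_clause u (cEq K t s) r e"
    using Sat_unfold[OF assms(1), of "cEq K t s"] assms by (metis codes_univ(3))
  then show ?thesis using assms unfolding sat_clause_def code_defs by auto
qed

lemma Sat_Mem:
  assumes "u \<in> univ K" "e \<in> univ K" "assignment u e" "t \<in> univ K" "s \<in> univ K"
  shows "Sat u (cMem K t s) e \<longleftrightarrow>
    (\<exists>x\<in>Ext K u. \<exists>y\<in>Ext K u. denotes t e x \<and> denotes s e y \<and> x \<in> Ext K y)"
proof -
  obtain r where "Sat u (cMem K t s) e \<longleftrightarrow> assignment u e \<and> sat_clause u (cMem K t s) r e"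
    using Sat_unfold[OF assms(1), of "cMem K t s"] assms by (metis codes_univ(4))
  then show ?thesis using assms unfolding sat_clause_def code_defs by auto
qed

lemma Sat_set_univ: "u \<in> univ K \<Longrightarrow> \<phi> \<in> univ K \<Longrightarrow> setrec sat_step u \<phi> \<in> univ K"
  by (rule setrec_univ[where \<Phi> = sat_step, OF Def_sat_step])

lemma Sat_Neg:
  assumes "u \<in> univ K" "e \<in> univ K" "assignment u e" "\<psi> \<in> univ K"
  shows "Sat u (cNeg K \<psi>) e \<longleftrightarrow> \<not> Sat u \<psi> e"
proof -
  obtain r where r: "\<And>z w. z \<in> univ K \<Longrightarrow> w \<in> univ K \<Longrightarrow>
      pair K z w \<in> Ext K r \<longleftrightarrow> z \<in> TC (cNeg K \<psi>) \<and> w = setrec sat_step u z"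
    "Sat u (cNeg K \<psi>) e \<longleftrightarrow> assignment u e \<and> sat_clause u (cNeg K \<psi>) r e"
    using Sat_unfold[OF assms(1), of "cNeg K \<psi>"] assms by (metis codes_univ(5))
  have "\<psi> \<in> TC (cNeg K \<psi>)" unfolding code_defs using mem_TC_codes(1) assms by blast
  then have "pair K \<psi> \<tau> \<in> Ext K r \<longleftrightarrow> \<tau> = setrec sat_step u \<psi>" if "\<tau> \<in> univ K" for \<tau>
    using r(1) assms that by blast
  then have "sat_clause u (cNeg K \<psi>) r e \<longleftrightarrow> e \<notin> Ext K (setrec sat_step u \<psi>)"
    using assms Sat_set_univ[OF assms(1,4)] unfolding sat_clause_def code_defs by auto
  then show ?thesis using r(2) assms(3) unfolding Sat_def by blast
qed

lemma Sat_Or: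
  assumes "u \<in> univ K" "e \<in> univ K" "assignment u e" "\<psi> \<in> univ K" "\<chi> \<in> univ K"
  shows "Sat u (cOr K \<psi> \<chi>) e \<longleftrightarrow> Sat u \<psi> e \<or> Sat u \<chi> e"
proof -
  obtain r where r: "\<And>z w. z \<in> univ K \<Longrightarrow> w \<in> univ K \<Longrightarrow>
      pair K z w \<in> Ext K r \<longleftrightarrow> z \<in> TC (cOr K \<psi> \<chi>) \<and> w = setrec sat_step u z"
    "Sat u (cOr K \<psi> \<chi>) e \<longleftrightarrow> assignment u e \<and> sat_clause u (cOr K \<psi> \<chi>) r e"
    using Sat_unfold[OF assms(1), of "cOr K \<psi> \<chi>"] assms by (metis codes_univ(6))
  have "\<psi> \<in> TC (cOr K \<psi> \<chi>)" "\<chi> \<in> TC (cOr K \<psi> \<chi>)"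
    unfolding code_defs using mem_TC_codes(2,3) assms by blast+
  then have "pair K \<psi> \<tau> \<in> Ext K r \<longleftrightarrow> \<tau> = setrec sat_step u \<psi>"
     "pair K \<chi> \<tau> \<in> Ext K r \<longleftrightarrow> \<tau> = setrec sat_step u \<chi>" if "\<tau> \<in> univ K" for \<tau>
    using r(1) assms that by blast+
  then have "sat_clause u (cOr K \<psi> \<chi>) r e \<longleftrightarrow>
      e \<in> Ext K (setrec sat_step u \<psi>) \<or> e \<in> Ext K (setrec sat_step u \<chi>)"
    using assms Sat_set_univ[OF assms(1,4)] Sat_set_univ[OF assms(1,5)]
    unfolding sat_clause_def code_defs by auto
  then show ?thesis using r(2) assms(3) unfolding Sat_def by blast
qed

lemma Sat_Ex:
  assumes "u \<in> univ K" "e \<in> univ K" "assignment u e" "i \<in> univ K" "\<psi> \<in> univ K"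
  shows "Sat u (cEx K i \<psi>) e \<longleftrightarrow> (\<exists>x\<in>Ext K u. Sat u \<psi> (upd e i x))"
proof -
  obtain r where r: "\<And>z w. z \<in> univ K \<Longrightarrow> w \<in> univ K \<Longrightarrow>
      pair K z w \<in> Ext K r \<longleftrightarrow> z \<in> TC (cEx K i \<psi>) \<and> w = setrec sat_step u z"
    "Sat u (cEx K i \<psi>) e \<longleftrightarrow> assignment u e \<and> sat_clause u (cEx K i \<psi>) r e"
    using Sat_unfold[OF assms(1), of "cEx K i \<psi>"] assms by (metis codes_univ(7))
  have "\<psi> \<in> TC (cEx K i \<psi>)"
    unfolding code_defs using mem_TC_codes(3) assms by blast
  then have "pair K \<psi> \<tau> \<in> Ext K r \<longleftrightarrow> \<tau> = setrec sat_step u \<psi>" if "\<tau> \<in> univ K" for \<tau>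
    using r(1) assms that by blast
  then have "sat_clause u (cEx K i \<psi>) r e \<longleftrightarrow>
      (\<exists>x\<in>Ext K u. upd e i x \<in> Ext K (setrec sat_step u \<psi>))"
    using assms Sat_set_univ[OF assms(1,5)]
    unfolding sat_clause_def code_defs by auto
  then show ?thesis using r(2) assms(3) unfolding Sat_def by blast
qed

section \<open>Names of ordinals and their values\<close>

definition witness_at :: "'a \<Rightarrow> 'a \<Rightarrow> 'a \<Rightarrow> 'a \<Rightarrow> 'a \<Rightarrow> bool" where
  "witness_at \<gamma> \<psi> e i z \<longleftrightarrow> (\<exists>x\<in>Ext K (V \<gamma>). Ext K x \<subseteq> Ext K (V z) \<and> Sat (V \<gamma>) \<psi> (upd e i x))"

text \<open>\<open>witness_at\<close> bounds the rank of the witness, so the minimal y is the least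
  rank of a witness: a canonical value even where no witness is canonical. It lies strictly below
  the value of n. If no such y exists, the recursion defaults to the empty set, which M and N share
  and which therefore never counts as a new value.\<close>

definition val_step :: "'a \<Rightarrow> 'a \<Rightarrow> 'a \<Rightarrow> 'a \<Rightarrow> bool" where
  "val_step c x r y \<longleftrightarrow> x = zero \<and> y = c \<or>
     (\<exists>\<psi>\<in>univ K. \<exists>e\<in>univ K. \<exists>i\<in>univ K. \<exists>n\<in>univ K. \<exists>\<gamma>\<in>univ K.
        x = pair K (pair K \<psi> (pair K e i)) n \<and> pair K n \<gamma> \<in> Ext K r \<and> \<gamma> \<in> Ord K \<and>
        y \<in> Ext K \<gamma> \<and> witness_at \<gamma> \<psi> e i y \<and> (\<forall>z\<in>Ext K y. \<not> witness_at \<gamma> \<psi> e i z))"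

text \<open>Sets are read as names of ordinals: \<open>\<emptyset>\<close> names \<open>c\<close>, and if \<open>n\<close> names \<open>\<gamma>\<close> then
  the pair of \<open>(\<psi>, e, i)\<close> and \<open>n\<close> names the least rank of a witness for \<open>\<exists>v\<^sub>i \<psi>\<close> in \<open>V\<^sub>\<gamma>\<close> under
  the assignment \<open>e\<close>.\<close>

definition val :: "'a \<Rightarrow> 'a \<Rightarrow> 'a" where "val c x = setrec val_step c x"

lemma Def_witness_at:
  "Def K X (\<lambda>e. witness_at (e i) (e j) (e k) (e l) (e m))"
  unfolding witness_at_def by (intro Def_tms Def_Sat tm_V tm_upd)

lemma Def_val_step: "Def K X (\<lambda>e. val_step (e i) (e j) (e k) (e l))"
  unfolding val_step_def by (intro Def_tms Def_witness_at Def_Ord)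

lemma tm_val: "tm K X t \<Longrightarrow> tm K X s \<Longrightarrow> tm K X (\<lambda>e. val (t e) (s e))"
  unfolding val_def by (rule tm_setrec[where \<Phi> = val_step, OF Def_val_step])

lemma pair_ne_zero: "a \<in> univ K \<Longrightarrow> b \<in> univ K \<Longrightarrow> pair K a b \<noteq> zero"
  using Ext_pair[of a b] by (metis insert_not_empty zero(2))

lemma val_zero:
  assumes "c \<in> univ K"
  shows "val c zero = c"
proof -
  obtain r where r: "\<And>y. y \<in> univ K \<Longrightarrow> val_step c zero r y \<Longrightarrow>
      (\<And>y'. y' \<in> univ K \<Longrightarrow> val_step c zero r y' \<Longrightarrow> y' = y) \<Longrightarrow> val c zero = y"
    using setrec_unfold[where \<Phi> = val_step, OF Def_val_step assms zero(1)] unfolding val_def by metis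
  have "val_step c zero r y \<longleftrightarrow> y = c" for y
    unfolding val_step_def using pair_ne_zero pair_univ by metis
  then show ?thesis using r[OF assms] by blast
qed

lemma val_Ord:
  assumes c: "c \<in> Ord K" and x: "x \<in> univ K"
  shows "val c x \<in> Ord K"
proof -
  obtain r where r: "val c x = zero \<or> val_step c x r (val c x)"
    using setrec_unfold[where \<Phi> = val_step, OF Def_val_step Ord_univ[OF c] x] unfolding val_def by metis
  then show ?thesis
  proof
    assume "val c x = zero"
    then show ?thesis using zero_Ord by simp
  next
    assume "val_step c x r (val c x)"
    then have "val c x = c \<or> (\<exists>\<gamma>\<in>Ord K. val c x \<in> Ext K \<gamma>)"
      unfolding val_step_def by (elim disjE conjE bexE) (rule disjI1, assumption, blast)
    then show ?thesis using c Ord_mem by metis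
  qed
qed

lemma val_pair:
  assumes c: "c \<in> Ord K" and u: "\<psi> \<in> univ K" "e \<in> univ K" "i \<in> univ K" "n \<in> univ K"
    and m: "m \<in> Ext K (val c n)" "witness_at (val c n) \<psi> e i m"
  shows "val c (pair K (pair K \<psi> (pair K e i)) n) \<in> Ext K (val c n)"
    "witness_at (val c n) \<psi> e i (val c (pair K (pair K \<psi> (pair K e i)) n))"
proof -
  let ?x = "pair K (pair K \<psi> (pair K e i)) n"
  define \<gamma> where "\<gamma> = val c n"
  have \<gamma>: "\<gamma> \<in> Ord K" using val_Ord[OF c u(4)] by (simp add: \<gamma>_def)
  have \<gamma>u: "\<gamma> \<in> univ K" using Ord_univ[OF \<gamma>] .
  have x: "?x \<in> univ K" using u by simp
  obtain r where r:
    "\<And>z w. z \<in> univ K \<Longrightarrow> w \<in> univ K \<Longrightarrow> pair K z w \<in> Ext K r \<longleftrightarrow> z \<in> TC ?x \<and> w = val c z"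
    "\<And>y. y \<in> univ K \<Longrightarrow> val_step c ?x r y \<Longrightarrow>
      (\<And>y'. y' \<in> univ K \<Longrightarrow> val_step c ?x r y' \<Longrightarrow> y' = y) \<Longrightarrow> val c ?x = y"
    using setrec_unfold[where \<Phi> = val_step, OF Def_val_step Ord_univ[OF c] x]
    unfolding val_def by metis
  have "n \<in> TC ?x" using mem_TC_pair(2) u by simp
  then have nr: "pair K n w \<in> Ext K r \<longleftrightarrow> w = \<gamma>" if "w \<in> univ K" for w
    using r(1)[OF u(4) that] by (simp add: \<gamma>_def)
  define Q where "Q y \<longleftrightarrow> y \<in> Ext K \<gamma> \<and> witness_at \<gamma> \<psi> e i y \<and> (\<forall>z\<in>Ext K y. \<not> witness_at \<gamma> \<psi> e i z)" for y
  have step: "val_step c ?x r y \<longleftrightarrow> Q y" for y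
  proof
    assume "val_step c ?x r y"
    then obtain \<psi>' e' i' n' \<gamma>' where "\<psi>' \<in> univ K" "e' \<in> univ K" "i' \<in> univ K" "n' \<in> univ K" "\<gamma>' \<in> univ K"
      "?x = pair K (pair K \<psi>' (pair K e' i')) n'" "pair K n' \<gamma>' \<in> Ext K r"
      "y \<in> Ext K \<gamma>'" "witness_at \<gamma>' \<psi>' e' i' y" "\<forall>z\<in>Ext K y. \<not> witness_at \<gamma>' \<psi>' e' i' z"
      using pair_ne_zero u unfolding val_step_def by (metis pair_univ)
    then show "Q y" unfolding Q_def using u nr by simp
  next
    assume "Q y"
    then show "val_step c ?x r y" unfolding val_step_def Q_def using u \<gamma> \<gamma>u nr by blast
  qed
  have D: "Def K X (\<lambda>e'. e' 0 \<in> Ext K \<gamma> \<and> witness_at \<gamma> \<psi> e i (e' 0))"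
    unfolding witness_at_def by (intro Def_tms Def_Sat tm_V tm_upd tm_const \<gamma>u u)
  have "\<exists>y\<in>univ K. (y \<in> Ext K \<gamma> \<and> witness_at \<gamma> \<psi> e i y) \<and>
      (\<forall>z\<in>Ext K y. \<not> (z \<in> Ext K \<gamma> \<and> witness_at \<gamma> \<psi> e i z))"
    by (rule least_exists[OF D Ext_univ[OF m(1)]]) (use m in \<open>simp add: \<gamma>_def\<close>)
  then obtain y where y: "y \<in> univ K" "Q y" unfolding Q_def using Ord_trans[OF \<gamma>] by blast
  have "val c ?x = y"
  proof (rule r(2)[OF y(1)])
    show "val_step c ?x r y" unfolding step by (rule y(2))
    fix y' assume "val_step c ?x r y'"
    then have "Q y'" unfolding step .
    then show "y' = y" using y(2) Ord_linear Ord_mem[OF \<gamma>] unfolding Q_def by blast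
  qed
  then show "val c ?x \<in> Ext K (val c n)" "witness_at (val c n) \<psi> e i (val c ?x)"
    using y(2) unfolding Q_def \<gamma>_def by simp_all
qed

lemma in_V_exists:
  assumes "x \<in> univ K"
  shows "\<exists>a\<in>Ord K. x \<in> Ext K (V a)"
proof -
  have s: "isset {x}" using isset_one[OF assms] .
  show ?thesis using subset_V_exists[OF isset_univ[OF s]] unfolding isset_Ext[OF s] by blast
qed

text \<open>Used with N for K and a set of M for \<open>s\<close>: minima of values exist over sets,
  whereas the names with new values need not form a definable class of N.\<close>

lemma image_minimal:
  assumes g: "tm K X (\<lambda>e. g (e 0))" and s: "s \<in> univ K" "Ext K s \<noteq> {}"
  shows "\<exists>p\<in>Ext K s. \<forall>q\<in>Ext K s. g q \<notin> Ext K (g p)"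
proof -
  have g': "g q \<in> univ K" if "q \<in> univ K" for q
    using tm_in[OF g, of "\<lambda>_. q"] that by (simp add: Env_def)
  obtain p where p: "p \<in> Ext K s" using s by blast
  have D: "Def K X (\<lambda>e. \<exists>q\<in>Ext K s. e 0 = g q)" by (intro Def_tms tm_const s tm_rename[OF g])
  have "\<exists>b\<in>univ K. (\<exists>q\<in>Ext K s. b = g q) \<and> (\<forall>c\<in>Ext K b. \<not> (\<exists>q\<in>Ext K s. c = g q))"
    by (rule least_exists[OF D, of "g p"]) (use p g' Ext_univ in auto)
  then show ?thesis by blast
qed

end

section \<open>Faithful end extensions\<close>

locale faithful_end_extension =
  fixes M N :: "'a sstruct"
  assumes struct_M: "set_structure M" and struct_N: "set_structure N"
    and ZF_M: "models_ZF M" and ZF_N: "models_ZF N"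
    and end_ext: "end_extension M N" and proper: "M \<noteq> N"
    and faithful: "faithful_extension M N"
begin

sublocale M: zfx M "{}"
  by (unfold_locales) (rule struct_M models_ZFX_empty[OF ZF_M])+

sublocale N: zfx N "{}"
  by (unfold_locales) (rule struct_N models_ZFX_empty[OF ZF_N])+

lemma substructure: "substructure M N"
  using end_ext by (simp add: end_extension_def)

lemma univ_MN: "x \<in> univ M \<Longrightarrow> x \<in> univ N"
  using substructure by (auto simp: substructure_def)

lemma Ext_MN: "a \<in> univ M \<Longrightarrow> Ext N a = Ext M a"
  using end_ext by (simp add: end_extension_def)

lemma Ext_N_univ_M: "a \<in> univ M \<Longrightarrow> x \<in> Ext N a \<Longrightarrow> x \<in> univ M"
  using Ext_MN M.Ext_univ by blast

section \<open>Absoluteness between M and N\<close>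

lemma the_set_MN: "M.isset A \<Longrightarrow> the_set N A = the_set M A"
  using N.the_set_eq M.isset_univ M.isset_Ext univ_MN Ext_MN by metis

lemma pair_MN: "a \<in> univ M \<Longrightarrow> b \<in> univ M \<Longrightarrow> pair N a b = pair M a b"
  by (simp add: pair_def the_set_MN M.isset_one M.isset_two M.isset_univ)

lemma zero_MN: "N.zero = M.zero"
  by (simp add: N.zero_def M.zero_def the_set_MN M.isset_empty)

lemma numeral_MN: "numeral_in N k = numeral_in M k"
proof (induction k)
  case 0
  then show ?case by (simp add: the_set_MN M.isset_empty)
next
  case (Suc k)
  have "M.isset (insert (numeral_in M k) (Ext M (numeral_in M k)))"
    by (intro M.isset_insert M.isset_Ext_self M.numeral_in)
  then show ?case by (simp add: Suc Ext_MN M.numeral_in the_set_MN)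
qed

lemma tagged_MN: "a \<in> univ M \<Longrightarrow> tagged N k a = tagged M k a"
  by (simp add: tagged_def numeral_MN pair_MN M.numeral_in)

lemma codes_MN:
  "a \<in> univ M \<Longrightarrow> cVar N a = cVar M a" "a \<in> univ M \<Longrightarrow> cConst N a = cConst M a"
  "a \<in> univ M \<Longrightarrow> b \<in> univ M \<Longrightarrow> cEq N a b = cEq M a b"
  "a \<in> univ M \<Longrightarrow> b \<in> univ M \<Longrightarrow> cMem N a b = cMem M a b"
  "a \<in> univ M \<Longrightarrow> cNeg N a = cNeg M a"
  "a \<in> univ M \<Longrightarrow> b \<in> univ M \<Longrightarrow> cOr N a b = cOr M a b"
  "a \<in> univ M \<Longrightarrow> b \<in> univ M \<Longrightarrow> cEx N a b = cEx M a b"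
  by (simp_all add: cVar_def cConst_def cEq_def cMem_def cNeg_def cOr_def cEx_def tagged_MN pair_MN)

lemma pair_N_in_M:
  assumes "a \<in> univ N" "b \<in> univ N" "pair N a b \<in> univ M"
  shows "a \<in> univ M" "b \<in> univ M"
proof -
  have "the_set N {a, b} \<in> univ M"
    using Ext_N_univ_M[OF assms(3)] N.Ext_pair[OF assms(1,2)] by blast
  from Ext_N_univ_M[OF this] show "a \<in> univ M" "b \<in> univ M"
    using N.isset_Ext[OF N.isset_two[OF assms(1,2)]] by auto
qed

text \<open>In N the update could remove more pairs, as more second components are available; but a
  pair that is an element of e has both components in M.\<close>

lemma upd_MN:
  assumes "e \<in> univ M" "i \<in> univ M" "x \<in> univ M"
  shows "N.upd e i x = M.upd e i x"
proof -
  have "p \<noteq> pair N i y" if "p \<in> Ext M e" "\<forall>y\<in>univ M. p \<noteq> pair M i y" "y \<in> univ N" for p y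
    using that pair_N_in_M[OF univ_MN[OF assms(2)] that(3)] pair_MN[OF assms(2)] M.Ext_univ by metis
  moreover have "p \<noteq> pair M i y" if "\<forall>y\<in>univ N. p \<noteq> pair N i y" "y \<in> univ M" for p y
    using that pair_MN[OF assms(2)] univ_MN by metis
  ultimately have "{p \<in> Ext N e. \<forall>y\<in>univ N. p \<noteq> pair N i y} = {p \<in> Ext M e. \<forall>y\<in>univ M. p \<noteq> pair M i y}"
    unfolding Ext_MN[OF assms(1)] by blast
  then show ?thesis
    unfolding N.upd_def M.upd_def pair_MN[OF assms(2,3)] using the_set_MN[OF M.isset_upd[OF assms]] by simp
qed

lemma upd_in_M: "e \<in> univ M \<Longrightarrow> i \<in> univ M \<Longrightarrow> x \<in> univ M \<Longrightarrow> N.upd e i x \<in> univ M"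
  by (simp add: upd_MN M.upd)

text \<open>The class of elements of z is definable in N with z as a parameter. Separation in M for
  its trace, applied to b, produces a set of M with the same elements.\<close>

lemma subset_in_M:
  assumes "z \<in> univ N" "b \<in> univ M" "Ext N z \<subseteq> Ext N b"
  shows "z \<in> univ M"
proof -
  have "Def N {} (\<lambda>e. e 0 \<in> Ext N z)" by (intro N.Def_mem N.tm_v tm_const assms(1))
  from Def_definable[of N "\<lambda>x. x \<in> Ext N z", OF this]
  have "models_ZFX M ({x \<in> univ N. x \<in> Ext N z} \<inter> univ M)"
    using faithful unfolding faithful_extension_def by blast
  then interpret MX: zfx M "{x \<in> univ N. x \<in> Ext N z} \<inter> univ M"
    by unfold_locales (rule struct_M)
  obtain c where c: "c \<in> univ M" "Ext M c = {x \<in> Ext M b. x \<in> {x \<in> univ N. x \<in> Ext N z} \<inter> univ M}"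
    using MX.Separation[OF assms(2) MX.Def_X[OF MX.tm_v]] by blast
  have "Ext N c = Ext N z"
    unfolding Ext_MN[OF c(1)] c(2) using assms(3) N.Ext_univ M.Ext_univ unfolding Ext_MN[OF assms(2)] by blast
  then have "c = z" using N.extensionality univ_MN c(1) assms(1) by blast
  then show ?thesis using c(1) by simp
qed

lemma Ord_MN: "x \<in> univ M \<Longrightarrow> x \<in> Ord N \<longleftrightarrow> x \<in> Ord M"
  unfolding N.Ord_iff M.Ord_iff N.On_def M.On_def N.transitive_def M.transitive_def
  using univ_MN Ext_MN M.Ext_univ by (metis (no_types, lifting))

lemma Ord_new: "\<gamma> \<in> Ord N \<Longrightarrow> \<gamma> \<notin> Ord M \<longleftrightarrow> \<gamma> \<notin> univ M"
  using Ord_MN M.Ord_univ by blast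

lemma Ord_M_less_new:
  assumes "\<alpha> \<in> Ord M" "\<gamma> \<in> Ord N" "\<gamma> \<notin> univ M"
  shows "\<alpha> \<in> Ext N \<gamma>"
proof -
  have "\<alpha> \<in> univ M" using assms M.Ord_univ by blast
  then show ?thesis
    using N.Ord_linear[of \<alpha> \<gamma>] assms Ord_MN Ext_N_univ_M by blast
qed

text \<open>The sequence of levels that M has below \<open>a\<close> still satisfies the recursion
  in N: by \<open>subset_in_M\<close> no level acquires new subsets.\<close>

lemma V_MN:
  assumes a: "a \<in> Ord M"
  shows "N.V a = M.V a"
proof -
  have au: "a \<in> univ M" using M.Ord_univ a .
  have "is_V M a (M.V a)" using M.is_V_iff a by blast
  then obtain f F where v: "M.V a \<in> univ M" and f: "codes_fun M f a F"
    and F: "\<forall>\<alpha>\<in>Ext M a. Ext M (F \<alpha>) = {z \<in> univ M. \<exists>\<beta>\<in>Ext M \<alpha>. Ext M z \<subseteq> Ext M (F \<beta>)}"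
    and vF: "Ext M (M.V a) = {z \<in> univ M. \<exists>\<beta>\<in>Ext M a. Ext M z \<subseteq> Ext M (F \<beta>)}"
    unfolding is_V_def by blast
  have Fu: "F b \<in> univ M" if "b \<in> Ext M a" for b using f that unfolding codes_fun_def by blast
  have "Ext N f = (\<lambda>x. pair N x (F x)) ` Ext N a"
    using f Fu pair_MN M.Ext_univ Ext_MN au unfolding codes_fun_def by simp
  moreover have "f \<in> univ N" using f univ_MN by (simp add: codes_fun_def)
  moreover have "F ` Ext N a \<subseteq> univ N" using Fu univ_MN Ext_MN[OF au] by auto
  ultimately have fN: "codes_fun N f a F" by (simp add: codes_fun_def)
  have eq: "{z \<in> univ M. \<exists>\<beta>\<in>Ext M \<alpha>. Ext M z \<subseteq> Ext M (F \<beta>)} =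
      {z \<in> univ N. \<exists>\<beta>\<in>Ext N \<alpha>. Ext N z \<subseteq> Ext N (F \<beta>)}" if "\<alpha> \<in> univ M" "Ext M \<alpha> \<subseteq> Ext M a" for \<alpha>
  proof -
    have 1: "Ext N (F \<beta>) = Ext M (F \<beta>)" if "\<beta> \<in> Ext M \<alpha>" for \<beta>
      using Ext_MN Fu that \<open>Ext M \<alpha> \<subseteq> Ext M a\<close> by blast
    have 2: "z \<in> univ M" if "z \<in> univ N" "\<beta> \<in> Ext M \<alpha>" "Ext N z \<subseteq> Ext N (F \<beta>)" for z \<beta>
      using subset_in_M[OF that(1) _ that(3)] Fu that(2) \<open>Ext M \<alpha> \<subseteq> Ext M a\<close> by blast
    have "(z \<in> univ M \<and> (\<exists>\<beta>\<in>Ext M \<alpha>. Ext M z \<subseteq> Ext M (F \<beta>))) \<longleftrightarrow>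
        (z \<in> univ N \<and> (\<exists>\<beta>\<in>Ext M \<alpha>. Ext N z \<subseteq> Ext N (F \<beta>)))" for z
    proof (cases "z \<in> univ M")
      case True
      then show ?thesis by (simp add: 1 Ext_MN univ_MN)
    next
      case False
      then show ?thesis using 2 by blast
    qed
    then show ?thesis unfolding Ext_MN[OF that(1)] by blast
  qed
  have "is_V N a (M.V a)"
    unfolding is_V_def
  proof (intro conjI exI)
    show "a \<in> Ord N" using a Ord_MN au by blast
    show "M.V a \<in> univ N" using v univ_MN by blast
    show "codes_fun N f a F" by (rule fN)
    show "\<forall>\<alpha>\<in>Ext N a. Ext N (F \<alpha>) = {z \<in> univ N. \<exists>\<beta>\<in>Ext N \<alpha>. Ext N z \<subseteq> Ext N (F \<beta>)}"
    proof
      fix \<alpha> assume "\<alpha> \<in> Ext N a"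
      then have \<alpha>: "\<alpha> \<in> Ext M a" using Ext_MN au by blast
      then have "Ext M \<alpha> \<subseteq> Ext M a" using M.Ord_trans[OF a] by blast
      then show "Ext N (F \<alpha>) = {z \<in> univ N. \<exists>\<beta>\<in>Ext N \<alpha>. Ext N z \<subseteq> Ext N (F \<beta>)}"
        using eq[OF M.Ext_univ[OF \<alpha>]] F \<alpha> Ext_MN[OF Fu[OF \<alpha>]] by simp
    qed
    show "Ext N (M.V a) = {z \<in> univ N. \<exists>\<beta>\<in>Ext N a. Ext N z \<subseteq> Ext N (F \<beta>)}"
      using eq[OF au] vF Ext_MN[OF v] by simp
  qed
  then show ?thesis by (simp add: N.is_V_iff)
qed

lemma M_subset_V:
  assumes "a \<in> univ M" "\<gamma> \<in> Ord N" "\<gamma> \<notin> univ M"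
  shows "a \<in> Ext N (N.V \<gamma>)"
proof -
  obtain \<alpha> where \<alpha>: "\<alpha> \<in> Ord M" "Ext M a \<subseteq> Ext M (M.V \<alpha>)" using M.subset_V_exists[OF assms(1)] by blast
  have "Ext N a \<subseteq> Ext N (N.V \<alpha>)"
    using \<alpha> assms(1) by (simp add: V_MN Ext_MN M.Ord_univ)
  then show ?thesis
    unfolding N.Ext_V[OF N.Ord_univ[OF assms(2)]]
    using Ord_M_less_new[OF \<alpha>(1) assms(2,3)] univ_MN[OF assms(1)] by blast
qed

lemma subset_V_in_M:
  assumes "\<alpha> \<in> Ord M" "z \<in> univ N" "Ext N z \<subseteq> Ext N (N.V \<alpha>)"
  shows "z \<in> univ M"
  using subset_in_M[OF assms(2), of "M.V \<alpha>"] assms(1,3) by (simp add: V_MN M.Ord_univ)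

lemma univ_proper: "\<exists>b\<in>univ N. b \<notin> univ M"
proof (rule ccontr)
  assume "\<not> ?thesis"
  then have u: "univ M = univ N" using univ_MN by blast
  have "mem M = mem N" using substructure struct_N u
    unfolding substructure_def set_structure_def by blast
  with u proper show False by simp
qed

lemma new_ordinal: "\<exists>\<gamma>\<in>Ord N. \<gamma> \<notin> univ M"
proof -
  obtain b where b: "b \<in> univ N" "b \<notin> univ M" using univ_proper by blast
  obtain a where "a \<in> Ord N" "Ext N b \<subseteq> Ext N (N.V a)" using N.subset_V_exists[OF b(1)] by blast
  then show ?thesis using subset_V_in_M b Ord_MN by blast
qed

lemma rank_extension: "rank_extension M N"
  unfolding rank_extension_def
proof (intro conjI ballI end_ext)
  fix a b assume a: "a \<in> univ M" and b: "b \<in> univ N - univ M"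
  obtain \<alpha> where \<alpha>: "is_rank M a \<alpha>" using M.is_rank_exists[OF a] by blast
  have \<alpha>O: "\<alpha> \<in> Ord M" using \<alpha> M.is_rank_iff by blast
  have "is_rank N a \<alpha>"
    unfolding N.is_rank_iff
  proof (intro conjI ballI)
    show "\<alpha> \<in> Ord N" using \<alpha>O Ord_MN M.Ord_univ by blast
    show "Ext N a \<subseteq> Ext N (N.V \<alpha>)"
      using \<alpha> a \<alpha>O unfolding M.is_rank_iff by (simp add: Ext_MN V_MN M.Ord_univ)
    fix \<beta> assume "\<beta> \<in> Ext N \<alpha>"
    then have \<beta>: "\<beta> \<in> Ext M \<alpha>" using Ext_MN \<alpha>O M.Ord_univ by blast
    then have "\<beta> \<in> Ord M" using M.Ord_mem[OF \<alpha>O] by blast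
    then show "\<not> Ext N a \<subseteq> Ext N (N.V \<beta>)"
      using \<alpha> a \<beta> unfolding M.is_rank_iff by (simp add: Ext_MN V_MN M.Ord_univ)
  qed
  moreover obtain \<beta> where \<beta>: "is_rank N b \<beta>" using N.is_rank_exists b by blast
  moreover have "\<alpha> \<in> Ext N \<beta>"
  proof (rule Ord_M_less_new[OF \<alpha>O])
    show "\<beta> \<in> Ord N" using \<beta> N.is_rank_iff by blast
    then show "\<beta> \<notin> univ M" using subset_V_in_M[of \<beta> b] b \<beta> Ord_MN unfolding N.is_rank_iff by blast
  qed
  ultimately show "\<exists>\<alpha> \<beta>. is_rank N a \<alpha> \<and> is_rank N b \<beta> \<and> \<alpha> \<in> Ext N \<beta>" by blast
qed

section \<open>Existence of a least new value\<close>

text \<open>Without a least new value, \<open>M\<close>, with a predicate for the order of the values of \<open>g\<close>,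
  defines a sequence of ordinals \<open>H x\<close>, one for each set \<open>x\<close>, such that
  for \<open>z \<in> x\<close> some name in \<open>V\<^bsub>H x\<^esub>\<close> has a new value below those of all names in \<open>V\<^bsub>H z\<^esub>\<close>. Restricted to an
  inductive set this sequence is a set, and it gives \<open>N\<close> a nonempty set of ordinals without minimum.\<close>

lemma minimal_new_value:
  assumes g: "tm N {} (\<lambda>e. g (e 0))" and gO: "\<And>x. x \<in> univ N \<Longrightarrow> g x \<in> Ord N"
    and p0: "p0 \<in> univ M" "g p0 \<notin> univ M"
  shows "\<exists>p\<in>univ M. g p \<notin> univ M \<and> (\<forall>q\<in>univ M. g q \<notin> univ M \<longrightarrow> g q \<notin> Ext N (g p))"
proof (rule ccontr)
  assume "\<not> ?thesis"
  then have desc: "\<exists>q\<in>univ M. g q \<notin> univ M \<and> g q \<in> Ext N (g p)" if "p \<in> univ M" "g p \<notin> univ M" for p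
    using that by blast
  \<comment> \<open>Faithfulness handles one predicate at a time, so the graph of \<open>g\<close>
    and the order of its values are packed into a single class by tags 0 and 1.\<close>
  define D where "D d \<longleftrightarrow> (\<exists>p\<in>univ N. \<exists>q\<in>univ N. d = tagged N 0 (pair N p q) \<and> g p = q \<or>
      d = tagged N 1 (pair N p q) \<and> g p \<in> Ext N (g q))" for d
  have DD: "D (tagged N 0 (pair N p q)) \<longleftrightarrow> g p = q"
    "D (tagged N 1 (pair N p q)) \<longleftrightarrow> g p \<in> Ext N (g q)" if "p \<in> univ N" "q \<in> univ N" for p q
    using that unfolding D_def by auto
  have "Def N {} (\<lambda>e. D (e 0))"
    unfolding D_def by (intro N.Def_tms N.tm_tagged tm_rename[OF g])
  then have "definable N {d \<in> univ N. D d}" by (rule Def_definable)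
  moreover define Y where "Y = {d \<in> univ N. D d} \<inter> univ M"
  ultimately have "models_ZFX M Y" using faithful unfolding faithful_extension_def by blast
  then interpret MX: zfx M Y by unfold_locales (rule struct_M)
  \<comment> \<open>N cannot express that a value lies outside M, but M with the predicate can: no
    element of M is the value of p.\<close>
  define new where "new p \<longleftrightarrow> (\<forall>a\<in>univ M. tagged M 0 (pair M p a) \<notin> Y)" for p
  define lt where "lt p q \<longleftrightarrow> tagged M 1 (pair M p q) \<in> Y" for p q
  have Y: "tagged M k (pair M p q) \<in> Y \<longleftrightarrow> D (tagged N k (pair N p q))"
    if "p \<in> univ M" "q \<in> univ M" for p q k
    using that univ_MN by (simp add: Y_def tagged_MN pair_MN)
  have new: "new p \<longleftrightarrow> g p \<notin> univ M" if "p \<in> univ M" for p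
    unfolding new_def using that Y DD univ_MN by auto
  have lt: "lt p q \<longleftrightarrow> g p \<in> Ext N (g q)" if "p \<in> univ M" "q \<in> univ M" for p q
    unfolding lt_def using that Y DD univ_MN by auto
  \<comment> \<open>Some new name at level \<open>\<eta>\<close> has a value below those of all new
    names at level \<open>\<alpha>\<close>. Comparing levels avoids choosing names one after
    another.\<close>
  define J where "J \<alpha> \<eta> \<longleftrightarrow> (\<exists>p\<in>Ext M (M.V \<eta>). new p \<and> (\<forall>q\<in>Ext M (M.V \<alpha>). new q \<longrightarrow> lt p q))" for \<alpha> \<eta>
  have Dnew: "Def M Y (\<lambda>e. new (t e))" if "tm M Y t" for t
    unfolding new_def
    by (intro MX.Def_tms MX.Def_X MX.tm_tagged tm_rename[OF that])
  have DJ: "Def M Y (\<lambda>e. J (t e) (s e))" if "tm M Y t" "tm M Y s" for t s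
    unfolding J_def lt_def
    by (intro MX.Def_tms Dnew MX.Def_X MX.tm_tagged MX.tm_V tm_rename[OF that(1)] tm_rename[OF that(2)] that)
  have min: "\<exists>p\<in>Ext M s. \<forall>q\<in>Ext M s. g q \<notin> Ext N (g p)" if "s \<in> univ M" "Ext M s \<noteq> {}" for s
    using N.image_minimal[OF g univ_MN[OF that(1)]] that Ext_MN[OF that(1)] by simp
  have J_ex: "\<exists>\<eta>\<in>Ord M. J \<alpha> \<eta>" if \<alpha>: "\<alpha> \<in> Ord M" for \<alpha>
  proof -
    have "\<exists>s\<in>univ M. Ext M s = {q \<in> Ext M (M.V \<alpha>). new q}"
      by (rule MX.Separation[OF M.V_univ[OF M.Ord_univ[OF \<alpha>]]]) (intro Dnew MX.tm_v)
    then obtain s where s: "s \<in> univ M" "Ext M s = {q \<in> Ext M (M.V \<alpha>). new q}" by blast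
    have "\<exists>p\<in>univ M. g p \<notin> univ M \<and> (\<forall>q\<in>Ext M s. g p \<in> Ext N (g q))"
    proof (cases "Ext M s = {}")
      case True
      then show ?thesis using p0 by blast
    next
      case False
      \<comment> \<open>The new names of one level form a set, so N finds a least value among them;
        \<open>desc\<close> then goes strictly below it, and so below all values on
        \<open>s\<close>.\<close>
      then obtain p where p: "p \<in> Ext M s" "\<forall>q\<in>Ext M s. g q \<notin> Ext N (g p)" using min[OF s(1)] by blast
      have pM: "p \<in> univ M" "g p \<notin> univ M" using p(1) s(2) new M.Ext_univ by blast+
      obtain p' where p': "p' \<in> univ M" "g p' \<notin> univ M" "g p' \<in> Ext N (g p)" using desc[OF pM] by blast
      have "g p' \<in> Ext N (g q)" if q: "q \<in> Ext M s" for q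
      proof -
        have qN: "q \<in> univ N" using q M.Ext_univ univ_MN by blast
        have "g p \<in> Ext N (g q) \<or> g p = g q"
          using N.Ord_linear[OF gO gO, OF univ_MN[OF pM(1)] qN] p(2) q by blast
        then show ?thesis using N.Ord_trans[OF gO[OF qN]] p'(3) by auto
      qed
      then show ?thesis using p' by blast
    qed
    then obtain p where p: "p \<in> univ M" "g p \<notin> univ M" "\<forall>q\<in>Ext M s. g p \<in> Ext N (g q)" by blast
    obtain \<eta> where \<eta>: "\<eta> \<in> Ord M" "p \<in> Ext M (M.V \<eta>)" using M.in_V_exists[OF p(1)] by blast
    have "lt p q" if "q \<in> Ext M (M.V \<alpha>)" "new q" for q
      using lt[OF p(1) M.Ext_univ[OF that(1)]] p(3) s(2) that by blast
    then show ?thesis using \<eta> new[OF p(1)] p(2) unfolding J_def by blast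
  qed
  have J_mono: "J \<beta> \<eta>" if "J \<alpha> \<eta>" "\<alpha> \<in> Ord M" "\<beta> \<in> Ext M \<alpha>" for \<alpha> \<beta> \<eta>
    using that M.V_mono[OF that(2,3)] unfolding J_def by blast
  \<comment> \<open>Here r will be the graph of \<open>H\<close> on the transitive closure of x, so
    that \<open>H x\<close> becomes the least ordinal that J relates to every \<open>H z\<close>
    with z in x.\<close>
  define Q where "Q x r y \<longleftrightarrow> (\<forall>z\<in>Ext M x. \<forall>w\<in>univ M. pair M z w \<in> Ext M r \<longrightarrow> J w y)" for x r y
  define \<Psi> where "\<Psi> c x r y \<longleftrightarrow> y \<in> Ord M \<and> Q x r y \<and> (\<forall>y'\<in>Ext M y. \<not> Q x r y')" for c x r y :: 'a
  have DQ: "Def M Y (\<lambda>e. Q (t e) (s e) (u e))" if "tm M Y t" "tm M Y s" "tm M Y u" for t s u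
    unfolding Q_def
    by (intro MX.Def_tms DJ tm_rename[OF that(1)] tm_rename[OF that(2)] tm_rename[OF that(3)] that)
  have D\<Psi>: "Def M Y (\<lambda>e. \<Psi> (e i) (e j) (e k) (e l))" for i j k l
    unfolding \<Psi>_def by (intro MX.Def_tms DQ MX.Def_Ord)
  define H where "H x = M.setrec \<Psi> M.zero x" for x
  have tmH: "tm M Y (\<lambda>e. H (e 0))"
    unfolding H_def by (rule MX.tm_setrec[where \<Phi> = \<Psi>, OF D\<Psi> MX.tm_zero MX.tm_v])
  have unfold: "\<exists>r\<in>univ M. (\<forall>z\<in>univ M. \<forall>w\<in>univ M. pair M z w \<in> Ext M r \<longleftrightarrow> z \<in> M.TC x \<and> w = H z) \<and>
      (\<forall>y\<in>univ M. \<Psi> M.zero x r y \<longrightarrow> (\<forall>y'\<in>univ M. \<Psi> M.zero x r y' \<longrightarrow> y' = y) \<longrightarrow> H x = y) \<and>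
      (H x = M.zero \<or> \<Psi> M.zero x r (H x))" if x: "x \<in> univ M" for x
    by (rule MX.setrec_unfold[where \<Phi> = \<Psi>, OF D\<Psi> M.zero(1) x])
      (unfold H_def, intro bexI conjI ballI impI; blast)
  have HO: "H x \<in> Ord M" if "x \<in> univ M" for x
  proof -
    obtain r where "H x = M.zero \<or> \<Psi> M.zero x r (H x)" using unfold[OF \<open>x \<in> univ M\<close>] by blast
    then show ?thesis using M.zero_Ord unfolding \<Psi>_def by auto
  qed
  have HJ: "J (H z) (H x)" if x: "x \<in> univ M" and z: "z \<in> Ext M x" for x z
  proof -
    obtain r where r: "r \<in> univ M"
      "\<forall>z\<in>univ M. \<forall>w\<in>univ M. pair M z w \<in> Ext M r \<longleftrightarrow> z \<in> M.TC x \<and> w = H z"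
      "\<forall>y\<in>univ M. \<Psi> M.zero x r y \<longrightarrow> (\<forall>y'\<in>univ M. \<Psi> M.zero x r y' \<longrightarrow> y' = y) \<longrightarrow> H x = y"
      using unfold[OF x] by blast
    \<comment> \<open>One ordinal serves all z in x at once: beyond a strict bound of the earlier
      ordinals \<open>H z\<close>, by \<open>J_mono\<close>.\<close>
    have "M.isset (H ` Ext M x)" by (rule MX.isset_image[OF x tmH])
    then obtain b where b: "b \<in> univ M" "Ext M b = H ` Ext M x" unfolding M.isset_def by blast
    have "Ext M b \<subseteq> Ord M" unfolding b(2) using HO M.Ext_univ by blast
    then obtain a where a: "a \<in> Ord M" "H ` Ext M x \<subseteq> Ext M a"
      using M.Ord_bound[OF b(1)] b(2) by auto
    obtain \<eta> where \<eta>: "\<eta> \<in> Ord M" "J a \<eta>" using J_ex[OF a(1)] by blast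
    have Q\<eta>: "Q x r \<eta>" unfolding Q_def
    proof (intro ballI impI)
      fix z w assume "z \<in> Ext M x" "w \<in> univ M" "pair M z w \<in> Ext M r"
      then have "w \<in> Ext M a" using r(2) a(2) M.Ext_univ by blast
      then show "J w \<eta>" using J_mono[OF \<eta>(2) a(1)] by blast
    qed
    have D: "Def M Y (\<lambda>e. e 0 \<in> Ord M \<and> Q x r (e 0))"
      by (intro MX.Def_tms MX.Def_Ord DQ tm_const x r(1))
    have "\<exists>y\<in>univ M. (y \<in> Ord M \<and> Q x r y) \<and> (\<forall>c\<in>Ext M y. \<not> (c \<in> Ord M \<and> Q x r c))"
      by (rule MX.least_exists[OF D M.Ord_univ[OF \<eta>(1)]]) (use \<eta> Q\<eta> in blast)
    then obtain y where y: "y \<in> univ M" "\<Psi> M.zero x r y" unfolding \<Psi>_def using M.Ord_mem by blast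
    have "y' = y" if "y' \<in> univ M" "\<Psi> M.zero x r y'" for y'
      using M.Ord_linear[of y y'] that y unfolding \<Psi>_def by blast
    then have "H x = y" using r(3) y by blast
    then have "Q x r (H x)" using y(2) unfolding \<Psi>_def by blast
    moreover have "pair M z (H z) \<in> Ext M r"
      using r(2) M.Ext_univ[OF z] M.Ord_univ[OF HO[OF M.Ext_univ[OF z]]] M.Ext_subset_TC[of x] z by blast
    ultimately show ?thesis
      using z M.Ord_univ[OF HO[OF M.Ext_univ[OF z]]] unfolding Q_def by blast
  qed
  \<comment> \<open>Any inductive set will do as index set: each stage only needs a next one, and k
    is an element of its successor.\<close>
  have "\<exists>w\<in>univ M. M.zero \<in> Ext M w \<and> (\<forall>x\<in>Ext M w. M.suc x \<in> Ext M w)"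
  proof (rule M.omega_exists)
    fix w assume "w \<in> univ M" "M.zero \<in> Ext M w" "\<And>x. x \<in> Ext M w \<Longrightarrow> M.suc x \<in> Ext M w"
    then show ?thesis by blast
  qed
  then obtain w where w: "w \<in> univ M" "M.zero \<in> Ext M w" "\<And>x. x \<in> Ext M w \<Longrightarrow> M.suc x \<in> Ext M w"
    by blast
  have next_level: "J (H k) (H (M.suc k))" if "k \<in> Ext M w" for k
    using HJ[of "M.suc k" k] M.suc[OF M.Ext_univ[OF that]] by simp
  have "tm M Y (\<lambda>e. M.V (H (e 0)))" by (intro MX.tm_V tmH)
  then have i: "M.isset ((\<lambda>k. M.V (H k)) ` Ext M w)" by (rule MX.isset_image[OF w(1)])
  define t where "t = M.bigun (the_set M ((\<lambda>k. M.V (H k)) ` Ext M w))"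
  have t: "t \<in> univ M" "Ext M t = (\<Union>k\<in>Ext M w. Ext M (M.V (H k)))"
    unfolding t_def using M.isset_univ[OF i] M.isset_Ext[OF i] by auto
  have "\<exists>s\<in>univ M. Ext M s = {q \<in> Ext M t. new q}"
    by (rule MX.Separation[OF t(1)]) (intro Dnew MX.tm_v)
  then obtain s where s: "s \<in> univ M" "Ext M s = {q \<in> Ext M t. new q}" by blast
  have "Ext M s \<noteq> {}"
    using next_level[OF w(2)] w(3)[OF w(2)] unfolding s(2) t(2) J_def by blast
  then obtain p where p: "p \<in> Ext M s" "\<forall>q\<in>Ext M s. g q \<notin> Ext N (g p)" using min[OF s(1)] by blast
  obtain k where k: "k \<in> Ext M w" "p \<in> Ext M (M.V (H k))" "new p" using p(1) s(2) t(2) by blast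
  \<comment> \<open>The least value on \<open>s\<close> is attained at some stage k, but the next
    stage contains a new name with a smaller value.\<close>
  obtain q where q: "q \<in> Ext M (M.V (H (M.suc k)))" "new q" "lt q p"
    using next_level[OF k(1)] k unfolding J_def by blast
  have "q \<in> Ext M s" using q w(3)[OF k(1)] s(2) t(2) by blast
  moreover have "g q \<in> Ext N (g p)" using q(3) lt M.Ext_univ q(1) k(2) by blast
  ultimately show False using p(2) by blast
qed

text \<open>The Tarski-Vaught criterion for M inside the level of \<open>\<gamma>\<close>. It ranges
  over all elements of M as codes, so it includes formulas of nonstandard length.\<close>

definition witness_closed :: "'a \<Rightarrow> bool" where
  "witness_closed \<gamma> \<longleftrightarrow> (\<forall>\<psi>\<in>univ M. \<forall>e\<in>univ M. \<forall>i\<in>univ M.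
     (\<exists>x\<in>Ext N (N.V \<gamma>). N.Sat (N.V \<gamma>) \<psi> (N.upd e i x)) \<longrightarrow>
     (\<exists>x\<in>univ M. N.Sat (N.V \<gamma>) \<psi> (N.upd e i x)))"

lemma witness_ordinal: "\<exists>\<gamma>\<in>Ord N. \<gamma> \<notin> univ M \<and> witness_closed \<gamma>"
proof -
  obtain c where c: "c \<in> Ord N" "c \<notin> univ M" using new_ordinal by blast
  have g: "tm N {} (\<lambda>e. N.val c (e 0))" by (intro N.tm_val tm_const N.tm_v N.Ord_univ c)
  have "N.val c M.zero = c" using N.val_zero[OF N.Ord_univ[OF c(1)]] zero_MN by simp
  then have "\<exists>p\<in>univ M. N.val c p \<notin> univ M \<and>
      (\<forall>q\<in>univ M. N.val c q \<notin> univ M \<longrightarrow> N.val c q \<notin> Ext N (N.val c p))"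
    by (intro minimal_new_value[OF g, of M.zero] N.val_Ord c) (use c in simp_all)
  then obtain n where n: "n \<in> univ M" "N.val c n \<notin> univ M"
    "\<forall>q\<in>univ M. N.val c q \<notin> univ M \<longrightarrow> N.val c q \<notin> Ext N (N.val c n)" by blast
  define \<gamma> where "\<gamma> = N.val c n"
  have \<gamma>: "\<gamma> \<in> Ord N" unfolding \<gamma>_def using N.val_Ord[OF c(1)] univ_MN n(1) by blast
  have "\<exists>x\<in>univ M. N.Sat (N.V \<gamma>) \<psi> (N.upd e i x)"
    if u: "\<psi> \<in> univ M" "e \<in> univ M" "i \<in> univ M"
      and x: "x \<in> Ext N (N.V \<gamma>)" "N.Sat (N.V \<gamma>) \<psi> (N.upd e i x)" for \<psi> e i x
  proof -
    obtain m where m: "m \<in> Ext N \<gamma>" "Ext N x \<subseteq> Ext N (N.V m)"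
      using x(1) unfolding N.Ext_V[OF N.Ord_univ[OF \<gamma>]] by blast
    then have "N.witness_at \<gamma> \<psi> e i m" unfolding N.witness_at_def using x by blast
    define y where "y = N.val c (pair N (pair N \<psi> (pair N e i)) n)"
    have y: "y \<in> Ext N \<gamma>" "N.witness_at \<gamma> \<psi> e i y"
      using N.val_pair[OF c(1), of \<psi> e i n m] u n(1) univ_MN m(1) \<open>N.witness_at \<gamma> \<psi> e i m\<close>
      unfolding \<gamma>_def y_def by simp_all
    \<comment> \<open>The name of y is built from elements of M, so a new y would be a new value
      below the least one. Hence y is in M, and so is every set of rank at most y.\<close>
    have "pair N (pair N \<psi> (pair N e i)) n \<in> univ M" using u n(1) by (simp add: pair_MN)
    then have "y \<in> univ M" using n(3) y(1) unfolding \<gamma>_def y_def by blast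
    then have "y \<in> Ord M" using N.Ord_mem[OF \<gamma> y(1)] Ord_MN by blast
    then show ?thesis using y(2) subset_V_in_M N.Ext_univ unfolding N.witness_at_def by blast
  qed
  then have "witness_closed \<gamma>" unfolding witness_closed_def by blast
  then show ?thesis using \<gamma> n(2) unfolding \<gamma>_def by blast
qed

end

section \<open>Satisfaction classes\<close>

context zfx
begin

lemma term_subst_univ [simp]: "a \<in> univ K \<Longrightarrow> t \<in> univ K \<Longrightarrow> term_subst K j a t \<in> univ K"
  by (simp add: term_subst_def)

lemma tm_term_subst:
  assumes "j \<in> univ K" "a \<in> univ K" "tm K X t"
  shows "tm K X (\<lambda>e. term_subst K j a (t e))"
  unfolding term_subst_def using assms by (intro tm_if Def_eq tm_codes tm_const)

text \<open>\<open>is_subst\<close> asserts that a derivation list exists. Recursion first gives the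
  result of the substitution as a function; \<open>is_subst_exists\<close> then produces the
  list.\<close>

definition subst_rel :: "'a \<Rightarrow> 'a \<Rightarrow> 'a \<Rightarrow> 'a \<Rightarrow> 'a \<Rightarrow> 'a \<Rightarrow> bool" where
  "subst_rel j a c \<phi> r y \<longleftrightarrow>
     (\<exists>t\<in>univ K. \<exists>s\<in>univ K. \<phi> = cEq K t s \<and> y = cEq K (term_subst K j a t) (term_subst K j a s)) \<or>
     (\<exists>t\<in>univ K. \<exists>s\<in>univ K. \<phi> = cMem K t s \<and> y = cMem K (term_subst K j a t) (term_subst K j a s)) \<or>
     (\<exists>\<psi>\<in>univ K. \<exists>\<psi>'\<in>univ K. \<phi> = cNeg K \<psi> \<and> pair K \<psi> \<psi>' \<in> Ext K r \<and> y = cNeg K \<psi>') \<or>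
     (\<exists>\<psi>\<in>univ K. \<exists>\<psi>'\<in>univ K. \<exists>\<chi>\<in>univ K. \<exists>\<chi>'\<in>univ K. \<phi> = cOr K \<psi> \<chi> \<and>
        pair K \<psi> \<psi>' \<in> Ext K r \<and> pair K \<chi> \<chi>' \<in> Ext K r \<and> y = cOr K \<psi>' \<chi>') \<or>
     (\<exists>i\<in>univ K. \<exists>\<psi>\<in>univ K. \<exists>\<psi>'\<in>univ K. \<phi> = cEx K i \<psi> \<and>
        pair K \<psi> \<psi>' \<in> Ext K r \<and> y = cEx K i (if i = j then \<psi> else \<psi>'))"

definition sub :: "'a \<Rightarrow> 'a \<Rightarrow> 'a \<Rightarrow> 'a" where
  "sub j a \<phi> = setrec (subst_rel j a) zero \<phi>"

context
  fixes j a
  assumes j: "j \<in> univ K" and a: "a \<in> univ K"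
begin

lemma Def_subst_rel: "Def K X (\<lambda>e. subst_rel j a (e k) (e l) (e m) (e n))"
  unfolding subst_rel_def
  by (intro Def_tms tm_codes tm_term_subst tm_if tm_const j a)

lemma tm_sub: "tm K X t \<Longrightarrow> tm K X (\<lambda>e. sub j a (t e))"
  unfolding sub_def by (rule tm_setrec[where \<Phi> = "subst_rel j a", OF Def_subst_rel tm_zero])

lemma sub_univ [simp]: "\<phi> \<in> univ K \<Longrightarrow> sub j a \<phi> \<in> univ K"
  unfolding sub_def by (rule setrec_univ[where \<Phi> = "subst_rel j a", OF Def_subst_rel zero(1)])

lemma sub_eqI:
  assumes "\<phi> \<in> univ K" "y \<in> univ K"
    and step: "\<And>r y'. (\<And>z w. z \<in> univ K \<Longrightarrow> w \<in> univ K \<Longrightarrow> pair K z w \<in> Ext K r \<longleftrightarrow> z \<in> TC \<phi> \<and> w = sub j a z) \<Longrightarrow>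
      subst_rel j a zero \<phi> r y' \<longleftrightarrow> y' = y"
  shows "sub j a \<phi> = y"
proof -
  obtain r where r:
    "\<And>z w. z \<in> univ K \<Longrightarrow> w \<in> univ K \<Longrightarrow> pair K z w \<in> Ext K r \<longleftrightarrow> z \<in> TC \<phi> \<and> w = sub j a z"
    "\<And>y. y \<in> univ K \<Longrightarrow> subst_rel j a zero \<phi> r y \<Longrightarrow>
      (\<And>y'. y' \<in> univ K \<Longrightarrow> subst_rel j a zero \<phi> r y' \<Longrightarrow> y' = y) \<Longrightarrow> sub j a \<phi> = y"
    using setrec_unfold[where \<Phi> = "subst_rel j a", OF Def_subst_rel zero(1) assms(1)]
    unfolding sub_def by metis
  have "subst_rel j a zero \<phi> r y' \<longleftrightarrow> y' = y" for y' by (rule step) (rule r(1))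
  then show ?thesis using r(2)[OF assms(2)] by blast
qed

lemma sub_Eq:
  assumes "t \<in> univ K" "s \<in> univ K"
  shows "sub j a (cEq K t s) = cEq K (term_subst K j a t) (term_subst K j a s)"
  by (rule sub_eqI) (use assms a in \<open>auto simp: subst_rel_def code_defs\<close>)

lemma sub_Mem:
  assumes "t \<in> univ K" "s \<in> univ K"
  shows "sub j a (cMem K t s) = cMem K (term_subst K j a t) (term_subst K j a s)"
  by (rule sub_eqI) (use assms a in \<open>auto simp: subst_rel_def code_defs\<close>)

lemma sub_Neg:
  assumes "\<psi> \<in> univ K"
  shows "sub j a (cNeg K \<psi>) = cNeg K (sub j a \<psi>)"
proof (rule sub_eqI)
  fix r y'
  assume r: "\<And>z w. z \<in> univ K \<Longrightarrow> w \<in> univ K \<Longrightarrow>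
    pair K z w \<in> Ext K r \<longleftrightarrow> z \<in> TC (cNeg K \<psi>) \<and> w = sub j a z"
  have "\<psi> \<in> TC (cNeg K \<psi>)" unfolding code_defs using mem_TC_codes(1) assms by blast
  then have "pair K \<psi> w \<in> Ext K r \<longleftrightarrow> w = sub j a \<psi>" if "w \<in> univ K" for w
    using r[OF assms that] by simp
  then show "subst_rel j a zero (cNeg K \<psi>) r y' \<longleftrightarrow> y' = cNeg K (sub j a \<psi>)"
    using assms by (auto simp: subst_rel_def code_defs)
qed (use assms in simp_all)

lemma sub_Or:
  assumes "\<psi> \<in> univ K" "\<chi> \<in> univ K"
  shows "sub j a (cOr K \<psi> \<chi>) = cOr K (sub j a \<psi>) (sub j a \<chi>)"
proof (rule sub_eqI)
  fix r y'
  assume r: "\<And>z w. z \<in> univ K \<Longrightarrow> w \<in> univ K \<Longrightarrow>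
    pair K z w \<in> Ext K r \<longleftrightarrow> z \<in> TC (cOr K \<psi> \<chi>) \<and> w = sub j a z"
  have "\<psi> \<in> TC (cOr K \<psi> \<chi>)" "\<chi> \<in> TC (cOr K \<psi> \<chi>)"
    unfolding code_defs using mem_TC_codes(2,3) assms by blast+
  then have "pair K \<psi> w \<in> Ext K r \<longleftrightarrow> w = sub j a \<psi>" "pair K \<chi> w \<in> Ext K r \<longleftrightarrow> w = sub j a \<chi>"
    if "w \<in> univ K" for w
    using r[OF _ that] assms by simp_all
  then show "subst_rel j a zero (cOr K \<psi> \<chi>) r y' \<longleftrightarrow> y' = cOr K (sub j a \<psi>) (sub j a \<chi>)"
    using assms by (auto simp: subst_rel_def code_defs)
qed (use assms in simp_all)

lemma sub_Ex:
  assumes "i \<in> univ K" "\<psi> \<in> univ K"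
  shows "sub j a (cEx K i \<psi>) = cEx K i (if i = j then \<psi> else sub j a \<psi>)"
proof (rule sub_eqI)
  fix r y'
  assume r: "\<And>z w. z \<in> univ K \<Longrightarrow> w \<in> univ K \<Longrightarrow>
    pair K z w \<in> Ext K r \<longleftrightarrow> z \<in> TC (cEx K i \<psi>) \<and> w = sub j a z"
  have "\<psi> \<in> TC (cEx K i \<psi>)" unfolding code_defs using mem_TC_codes(3) assms by blast
  then have "pair K \<psi> w \<in> Ext K r \<longleftrightarrow> w = sub j a \<psi>" if "w \<in> univ K" for w
    using r[OF assms(2) that] by simp
  then show "subst_rel j a zero (cEx K i \<psi>) r y' \<longleftrightarrow>
      y' = cEx K i (if i = j then \<psi> else sub j a \<psi>)"
    using assms by (auto simp: subst_rel_def code_defs)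
qed (use assms in simp_all)

end

lemma omega_in_univ: "n \<in> omega_in K \<Longrightarrow> n \<in> univ K" "n \<in> omega_in K \<Longrightarrow> n \<in> Ord K"
  by (auto simp: omega_in_def Ord_univ)

lemma cTerm_univ: "t \<in> cTerm K \<Longrightarrow> t \<in> univ K"
  unfolding cTerm_def using omega_in_univ by auto

lemma fv_step_pair: "fv_step K Y q \<Longrightarrow> \<exists>\<phi>\<in>univ K. \<exists>s\<in>univ K. q = pair K \<phi> s"
proof (induction rule: fv_step.induct)
qed (use cTerm_univ omega_in_univ in \<open>blast intro: codes_univ\<close>)+

text \<open>Only the quantifier rule can have produced this entry, and its premise occurs earlier in
  the same list.\<close>

lemma fv_generated_Ex:
  assumes "generated K (fv_step K) (pair K (cEx K i \<psi>) s)" "i \<in> univ K" "\<psi> \<in> univ K" "s \<in> univ K"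
  shows "\<exists>s'\<in>univ K. generated K (fv_step K) (pair K \<psi> s')"
proof -
  obtain n f F k where n: "n \<in> omega_in K" and f: "codes_fun K f n F"
    and k: "k \<in> Ext K n" "F k = pair K (cEx K i \<psi>) s"
    and F: "\<forall>l\<in>Ext K n. fv_step K (F ` Ext K l) (F l)"
    using assms(1) unfolding generated_def by auto
  have "fv_step K (F ` Ext K k) (pair K (cEx K i \<psi>) s)" using F k by metis
  then have "\<exists>s'\<in>univ K. pair K \<psi> s' \<in> F ` Ext K k"
  proof cases
    case (5 i' \<psi>' s' q)
    then have "cEx K i \<psi> = cEx K i' \<psi>'" using assms omega_in_univ by simp
    then have "\<psi>' = \<psi>" using 5 assms omega_in_univ by (simp add: cEx_def)
    then show ?thesis using 5 by blast
  qed (use assms cTerm_univ in \<open>auto simp: code_defs\<close>)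
  moreover have "Ext K k \<subseteq> Ext K n" using Ord_trans omega_in_univ(2)[OF n] k(1) by blast
  ultimately show ?thesis unfolding generated_def using n f F by blast
qed

text \<open>The list that derives \<open>\<phi>\<close> as a formula has the right order: replacing
  every entry by the pair of its formula and the substituted one yields a derivation for
  \<open>subst_step\<close>.\<close>

lemma is_subst_exists:
  assumes gen: "generated K (fv_step K) (pair K \<phi> s)" and u: "\<phi> \<in> univ K" "s \<in> univ K"
    and j: "j \<in> univ K" and a: "a \<in> univ K"
  shows "is_subst K j a \<phi> (sub j a \<phi>)"
proof -
  obtain n f F where n: "n \<in> omega_in K" and f: "codes_fun K f n F"
    and \<phi>: "pair K \<phi> s \<in> F ` Ext K n"
    and F: "\<forall>l\<in>Ext K n. fv_step K (F ` Ext K l) (F l)"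
    using gen unfolding generated_def by auto
  have nu: "n \<in> univ K" and nO: "n \<in> Ord K" using n omega_in_univ by auto
  have "\<exists>\<phi>\<in>univ K. \<exists>s\<in>univ K. F l = pair K \<phi> s" if "l \<in> Ext K n" for l
    using F that fv_step_pair by blast
  then obtain A B where AB: "A l \<in> univ K" "B l \<in> univ K" "F l = pair K (A l) (B l)"
    if "l \<in> Ext K n" for l by metis
  have A_eq: "A l = \<psi>" if "l \<in> Ext K n" "F l = pair K \<psi> t" "\<psi> \<in> univ K" "t \<in> univ K" for l \<psi> t
    using AB[OF that(1)] that by simp
  define G where "G l = pair K (A l) (sub j a (A l))" for l
  \<comment> \<open>\<open>A\<close> and \<open>G\<close> are functions of the metatheory; this
    relation expresses the entrywise translation definably, so that collection can turn the list
    \<open>f\<close> into a list in K.\<close>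
  define P where "P q q' \<longleftrightarrow> (\<exists>l\<in>univ K. \<exists>\<psi>\<in>univ K. \<exists>t\<in>univ K.
     q = pair K l (pair K \<psi> t) \<and> q' = pair K l (pair K \<psi> (sub j a \<psi>)))" for q q'
  have DP: "Def K X (\<lambda>e. P (e i) (e k))" for i k
    unfolding P_def by (intro Def_tms tm_sub[OF j a])
  have fu: "f \<in> univ K" and Ef: "Ext K f = (\<lambda>l. pair K l (F l)) ` Ext K n"
    using f by (auto simp: codes_fun_def)
  have Pf: "P (pair K l (F l)) q' \<longleftrightarrow> q' = pair K l (G l)" if "l \<in> Ext K n" for l q'
    using AB[OF that] Ext_univ[OF that] unfolding P_def G_def by auto
  have GU: "G l \<in> univ K" if "l \<in> Ext K n" for l
    unfolding G_def using AB[OF that] sub_univ[OF j a] by simp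
  have "\<exists>b\<in>univ K. \<forall>q\<in>Ext K f. \<exists>q'\<in>Ext K b. P q q'"
  proof (rule Collection[where P = P, OF fu DP])
    fix q assume "q \<in> Ext K f"
    then obtain l where "l \<in> Ext K n" "q = pair K l (F l)" unfolding Ef by blast
    then show "\<exists>y\<in>univ K. P q y" using Pf GU Ext_univ by (intro bexI[of _ "pair K l (G l)"]) auto
  qed
  then obtain b where b: "b \<in> univ K" "\<forall>q\<in>Ext K f. \<exists>q'\<in>Ext K b. P q q'" by blast
  have D: "Def K X (\<lambda>e. \<exists>q\<in>Ext K f. P q (e 0))" by (intro Def_tms DP tm_const fu)
  have "\<exists>g\<in>univ K. Ext K g = {q' \<in> Ext K b. \<exists>q\<in>Ext K f. P q q'}" by (rule Separation[OF b(1) D])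
  then obtain g where g: "g \<in> univ K" "Ext K g = {q' \<in> Ext K b. \<exists>q\<in>Ext K f. P q q'}" by blast
  have "Ext K g = (\<lambda>l. pair K l (G l)) ` Ext K n"
    unfolding g(2) using b(2) Pf unfolding Ef by auto
  then have codes: "codes_fun K g n G" unfolding codes_fun_def using g(1) GU by blast
  have mem: "pair K \<psi> (sub j a \<psi>) \<in> G ` Ext K l"
    if H: "pair K \<psi> t \<in> F ` Ext K l" "Ext K l \<subseteq> Ext K n" "\<psi> \<in> univ K" "t \<in> univ K" for \<psi> t l
  proof -
    obtain k where k: "k \<in> Ext K l" "F k = pair K \<psi> t" using H(1) by auto
    have "A k = \<psi>" using A_eq[OF _ k(2)] k(1) H(2-4) by blast
    then show ?thesis using k(1) unfolding G_def by auto
  qed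
  have step: "subst_step K j a (G ` Ext K l) (G l)" if l: "l \<in> Ext K n" for l
  proof -
    have sub: "Ext K l \<subseteq> Ext K n" using Ord_trans[OF nO l] by blast
    have "fv_step K (F ` Ext K l) (F l)" using F l by blast
    then show ?thesis
    proof cases
      case (1 t s' q)
      then have "A l = cEq K t s'" using A_eq[OF l 1(1)] cTerm_univ by simp
      then show ?thesis unfolding G_def using 1 subst_step.intros(1)[of t K s'] cTerm_univ sub_Eq[OF j a] by simp
    next
      case (2 t s' q)
      then have "A l = cMem K t s'" using A_eq[OF l 2(1)] cTerm_univ by simp
      then show ?thesis unfolding G_def using 2 subst_step.intros(2)[of t K s'] cTerm_univ sub_Mem[OF j a] by simp
    next
      case (3 \<psi> q)
      then have "A l = cNeg K \<psi>" using A_eq[OF l 3(1)] by simp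
      moreover have "subst_step K j a (G ` Ext K l) (pair K (cNeg K \<psi>) (cNeg K (sub j a \<psi>)))"
        using 3 mem[OF 3(4) sub] sub_univ[OF j a] by (intro subst_step.intros) auto
      ultimately show ?thesis unfolding G_def using sub_Neg[OF j a] 3 by simp
    next
      case (4 \<psi> q1 \<chi> q2 q)
      then have "A l = cOr K \<psi> \<chi>" using A_eq[OF l 4(1)] by simp
      moreover have "subst_step K j a (G ` Ext K l) (pair K (cOr K \<psi> \<chi>) (cOr K (sub j a \<psi>) (sub j a \<chi>)))"
        using 4 mem[OF 4(4) sub] mem[OF 4(7) sub] sub_univ[OF j a] by (intro subst_step.intros) auto
      ultimately show ?thesis unfolding G_def using sub_Or[OF j a] 4 by simp
    next
      case (5 i \<psi> q1 q)
      then have "A l = cEx K i \<psi>" using A_eq[OF l 5(1)] omega_in_univ by simp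
      moreover have "subst_step K j a (G ` Ext K l)
          (pair K (cEx K i \<psi>) (cEx K i (if i = j then \<psi> else sub j a \<psi>)))"
        using 5 mem[OF 5(5) sub] sub_univ[OF j a] by (intro subst_step.intros) auto
      ultimately show ?thesis unfolding G_def using sub_Ex[OF j a] 5 omega_in_univ by simp
    qed
  qed
  have "pair K \<phi> (sub j a \<phi>) \<in> G ` Ext K n" using mem[OF \<phi>] u by blast
  then have "generated K (subst_step K j a) (pair K \<phi> (sub j a \<phi>))"
    unfolding generated_def using n codes step by blast
  then show ?thesis unfolding is_subst_def using u sub_univ[OF j a] by blast
qed

lemma denotes_Var:
  assumes "i \<in> univ K" "x \<in> univ K"
  shows "denotes (cVar K i) e x \<longleftrightarrow> pair K i x \<in> Ext K e"
  unfolding denotes_def code_defs using assms by auto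

lemma denotes_Const:
  assumes "a \<in> univ K" "x \<in> univ K"
  shows "denotes (cConst K a) e x \<longleftrightarrow> x = a"
  unfolding denotes_def code_defs using assms by auto

end

text \<open>Formulas of the metatheory become standard formulas of the structure, to which
  \<open>witness_closed\<close> can be applied.\<close>

primrec code :: "'a sstruct \<Rightarrow> fm \<Rightarrow> 'a" where
  "code K (EqF i j) = cEq K (cVar K (numeral_in K i)) (cVar K (numeral_in K j))"
| "code K (MemF i j) = cMem K (cVar K (numeral_in K i)) (cVar K (numeral_in K j))"
| "code K (XF i) = numeral_in K i"
| "code K (NegF p) = cNeg K (code K p)"
| "code K (OrF p q) = cOr K (code K p) (code K q)"
| "code K (ExF i p) = cEx K (numeral_in K i) (code K p)"

section \<open>The substitution lemma and the trace of satisfaction on M\<close>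

context faithful_end_extension
begin

lemma denotes_term_subst:
  assumes "t \<in> cTerm M" "j \<in> univ M" "a \<in> univ M" "e \<in> univ N" "x \<in> univ N"
  shows "N.denotes (term_subst M j a t) e x \<longleftrightarrow> N.denotes t (N.upd e j a) x"
  using assms(1) unfolding cTerm_def
proof
  assume "t \<in> cVar M ` omega_in M"
  then obtain i where i: "i \<in> univ M" "t = cVar M i" using M.omega_in_univ by blast
  have "t = cVar M j \<longleftrightarrow> i = j" using i assms by (simp add: cVar_def)
  then show ?thesis
    using i assms univ_MN
    by (auto simp: term_subst_def N.pair_mem_upd N.denotes_Var N.denotes_Const simp flip: codes_MN)
next
  assume "t \<in> cConst M ` univ M"
  then obtain b where b: "b \<in> univ M" "t = cConst M b" by blast
  have "t \<noteq> cVar M j" using b assms by (simp add: cVar_def cConst_def)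
  then show ?thesis
    using b assms univ_MN by (simp add: term_subst_def N.denotes_Const flip: codes_MN)
qed

context
  fixes \<gamma>
  assumes \<gamma>: "\<gamma> \<in> Ord N" "\<gamma> \<notin> univ M"
begin

lemma univ_M_in_V: "x \<in> univ M \<Longrightarrow> x \<in> Ext N (N.V \<gamma>)"
  using M_subset_V \<gamma> by blast

lemma V_gamma_univ: "N.V \<gamma> \<in> univ N"
  using N.Ord_univ[OF \<gamma>(1)] by simp

text \<open>The derivation list may have nonstandard length, so the induction on positions in it
  runs inside N. It is stated for all assignments at once because quantifiers change the
  assignment.\<close>

lemma Sat_subst:
  assumes "is_subst M j a \<phi> \<phi>'" and j: "j \<in> univ M" and a: "a \<in> univ M"
    and e: "e \<in> univ N" "N.assignment (N.V \<gamma>) e"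
  shows "N.Sat (N.V \<gamma>) \<phi>' e \<longleftrightarrow> N.Sat (N.V \<gamma>) \<phi> (N.upd e j a)"
proof -
  let ?u = "N.V \<gamma>"
  obtain n f F k where \<phi>: "\<phi> \<in> univ M" "\<phi>' \<in> univ M"
    and n: "n \<in> omega_in M" and f: "codes_fun M f n F"
    and k: "k \<in> Ext M n" "F k = pair M \<phi> \<phi>'"
    and F: "\<forall>l\<in>Ext M n. subst_step M j a (F ` Ext M l) (F l)"
    using assms(1) unfolding is_subst_def generated_def by auto
  have nM: "n \<in> univ M" "n \<in> Ord M" using n M.omega_in_univ by auto
  have fM: "f \<in> univ M" using f by (simp add: codes_fun_def)
  note jN = univ_MN[OF j] and aN = univ_MN[OF a]
  \<comment> \<open>Expresses the entries of the list through its code, which N can refer to, and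
    keeps their components in M.\<close>
  have f_pair: "pair N l (pair N \<psi> \<psi>') \<in> Ext N f \<longleftrightarrow> \<psi> \<in> univ M \<and> \<psi>' \<in> univ M \<and> F l = pair M \<psi> \<psi>'"
    if l: "l \<in> Ext M n" and \<psi>: "\<psi> \<in> univ N" "\<psi>' \<in> univ N" for l \<psi> \<psi>'
  proof -
    have lM: "l \<in> univ M" using M.Ext_univ[OF l] .
    have "\<psi> \<in> univ M \<and> \<psi>' \<in> univ M" if "pair N l (pair N \<psi> \<psi>') \<in> Ext N f"
      using pair_N_in_M[OF univ_MN[OF lM] N.pair_univ[OF \<psi>] Ext_N_univ_M[OF fM that]]
        pair_N_in_M[OF \<psi>] by blast
    moreover have "pair N l (pair N \<psi> \<psi>') \<in> Ext N f \<longleftrightarrow> F l = pair M \<psi> \<psi>'"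
      if "\<psi> \<in> univ M" "\<psi>' \<in> univ M"
      using M.codes_fun_pair[OF f nM(1) lM, of "pair M \<psi> \<psi>'"] that l lM
      by (auto simp: pair_MN Ext_MN[OF fM])
    ultimately show ?thesis by blast
  qed
  have asg: "N.assignment ?u (N.upd e j a)" if "N.assignment ?u e" "e \<in> univ N" for e
    using N.assignment_upd that univ_M_in_V j a by blast
  have main: "k \<in> Ext N n \<longrightarrow> (\<forall>\<phi>\<in>univ N. \<forall>\<phi>'\<in>univ N. pair N k (pair N \<phi> \<phi>') \<in> Ext N f \<longrightarrow>
      (\<forall>e\<in>univ N. N.assignment ?u e \<longrightarrow> (N.Sat ?u \<phi>' e \<longleftrightarrow> N.Sat ?u \<phi> (N.upd e j a))))"
  proof (rule N.mem_induct[OF _ _ univ_MN[OF M.Ext_univ[OF k(1)]]])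
    show "Def N {} (\<lambda>v. v 0 \<in> Ext N n \<longrightarrow>
      (\<forall>\<phi>\<in>univ N. \<forall>\<phi>'\<in>univ N. pair N (v 0) (pair N \<phi> \<phi>') \<in> Ext N f \<longrightarrow>
      (\<forall>e\<in>univ N. N.assignment ?u e \<longrightarrow> (N.Sat ?u \<phi>' e \<longleftrightarrow> N.Sat ?u \<phi> (N.upd e j a)))))"
      by (intro N.Def_tms N.Def_assignment N.Def_Sat N.tm_upd tm_const V_gamma_univ jN aN
          univ_MN[OF nM(1)] univ_MN[OF fM])
    fix k assume IH: "\<And>l. l \<in> Ext N k \<Longrightarrow> l \<in> Ext N n \<longrightarrow>
      (\<forall>\<phi>\<in>univ N. \<forall>\<phi>'\<in>univ N. pair N l (pair N \<phi> \<phi>') \<in> Ext N f \<longrightarrow>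
      (\<forall>e\<in>univ N. N.assignment ?u e \<longrightarrow> (N.Sat ?u \<phi>' e \<longleftrightarrow> N.Sat ?u \<phi> (N.upd e j a))))"
    show "k \<in> Ext N n \<longrightarrow> (\<forall>\<phi>\<in>univ N. \<forall>\<phi>'\<in>univ N. pair N k (pair N \<phi> \<phi>') \<in> Ext N f \<longrightarrow>
      (\<forall>e\<in>univ N. N.assignment ?u e \<longrightarrow> (N.Sat ?u \<phi>' e \<longleftrightarrow> N.Sat ?u \<phi> (N.upd e j a))))"
    proof (intro impI ballI)
      fix \<phi> \<phi>' e
      assume kn: "k \<in> Ext N n" and \<phi>: "\<phi> \<in> univ N" "\<phi>' \<in> univ N"
        and kf: "pair N k (pair N \<phi> \<phi>') \<in> Ext N f" and e: "e \<in> univ N" "N.assignment ?u e"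
      have k: "k \<in> Ext M n" using kn Ext_MN[OF nM(1)] by blast
      have \<phi>M: "\<phi> \<in> univ M" "\<phi>' \<in> univ M" "F k = pair M \<phi> \<phi>'" using f_pair[OF k \<phi>] kf by auto
      have IH': "N.Sat ?u \<psi>' e \<longleftrightarrow> N.Sat ?u \<psi> (N.upd e j a)"
        if H: "pair M \<psi> \<psi>' \<in> F ` Ext M k" "\<psi> \<in> univ M" "\<psi>' \<in> univ M" "e \<in> univ N" "N.assignment ?u e"
        for \<psi> \<psi>' e
      proof -
        obtain l where l: "l \<in> Ext M k" "F l = pair M \<psi> \<psi>'" using H(1) by auto
        have ln: "l \<in> Ext M n" using M.Ord_trans[OF nM(2) k l(1)] .
        have "pair N l (pair N \<psi> \<psi>') \<in> Ext N f" using f_pair[OF ln] H l(2) univ_MN by blast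
        moreover have "l \<in> Ext N k" using l(1) Ext_MN[OF M.Ext_univ[OF k]] by blast
        moreover have "l \<in> Ext N n" using ln Ext_MN[OF nM(1)] by blast
        ultimately show ?thesis using IH H univ_MN by blast
      qed
      note eN = N.upd(1)[OF e(1) jN aN] asg[OF e(2,1)]
      have "subst_step M j a (F ` Ext M k) (pair M \<phi> \<phi>')" using F k \<phi>M(3) by metis
      then show "N.Sat ?u \<phi>' e \<longleftrightarrow> N.Sat ?u \<phi> (N.upd e j a)"
      proof cases
        case (1 t s)
        have ts: "t \<in> univ M" "s \<in> univ M" using 1 M.cTerm_univ by auto
        then have eq: "\<phi> = cEq N t s" "\<phi>' = cEq N (term_subst M j a t) (term_subst M j a s)"
          using 1(1) \<phi>M a by (simp_all add: codes_MN)
        show ?thesis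
          using ts univ_MN M.term_subst_univ[OF a] 1(2,3) N.Ext_univ
          by (simp add: eq N.Sat_Eq[OF V_gamma_univ e] N.Sat_Eq[OF V_gamma_univ eN]
              denotes_term_subst[OF _ j a e(1)] cong: bex_cong)
      next
        case (2 t s)
        have ts: "t \<in> univ M" "s \<in> univ M" using 2 M.cTerm_univ by auto
        then have eq: "\<phi> = cMem N t s" "\<phi>' = cMem N (term_subst M j a t) (term_subst M j a s)"
          using 2(1) \<phi>M a by (simp_all add: codes_MN)
        show ?thesis
          using ts univ_MN M.term_subst_univ[OF a] 2(2,3) N.Ext_univ
          by (simp add: eq N.Sat_Mem[OF V_gamma_univ e] N.Sat_Mem[OF V_gamma_univ eN]
              denotes_term_subst[OF _ j a e(1)] cong: bex_cong)
      next
        case (3 \<psi> \<psi>')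
        then have eq: "\<phi> = cNeg N \<psi>" "\<phi>' = cNeg N \<psi>'" using \<phi>M by (simp_all add: codes_MN)
        show ?thesis
          using IH'[OF 3(4,2,3) e] univ_MN[OF 3(2)] univ_MN[OF 3(3)]
          by (simp add: eq N.Sat_Neg[OF V_gamma_univ e] N.Sat_Neg[OF V_gamma_univ eN])
      next
        case (4 \<psi> \<psi>' \<chi> \<chi>')
        then have eq: "\<phi> = cOr N \<psi> \<chi>" "\<phi>' = cOr N \<psi>' \<chi>'" using \<phi>M by (simp_all add: codes_MN)
        show ?thesis
          using IH'[OF 4(4,2,3) e] IH'[OF 4(7,5,6) e] univ_MN 4(2,3,5,6)
          by (simp add: eq N.Sat_Or[OF V_gamma_univ e] N.Sat_Or[OF V_gamma_univ eN])
      next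
        case (5 i \<psi> \<psi>')
        have i: "i \<in> univ M" using 5 M.omega_in_univ by blast
        define \<chi> where "\<chi> = (if i = j then \<psi> else \<psi>')"
        have \<chi>: "\<chi> \<in> univ M" using 5 by (simp add: \<chi>_def)
        have eq: "\<phi> = cEx N i \<psi>" "\<phi>' = cEx N i \<chi>"
          using 5 i \<chi> \<phi>M by (simp_all add: codes_MN \<chi>_def)
        \<comment> \<open>If the quantifier binds the substituted variable, its update overwrites
          the one by \<open>a\<close>, in accordance with the unchanged body. Otherwise the two
          updates commute and the induction hypothesis applies.\<close>
        have "N.Sat ?u \<chi> (N.upd e i x) \<longleftrightarrow> N.Sat ?u \<psi> (N.upd (N.upd e j a) i x)"
          if x: "x \<in> Ext N ?u" for x
        proof (cases "i = j")
          case True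
          then show ?thesis
            using N.upd_same[OF e(1) jN aN N.Ext_univ[OF x]] by (simp add: \<chi>_def)
        next
          case False
          have "N.Sat ?u \<chi> (N.upd e i x) \<longleftrightarrow> N.Sat ?u \<psi> (N.upd (N.upd e i x) j a)"
            using False IH'[OF 5(5,3,4), of "N.upd e i x"]
              N.upd(1)[OF e(1) univ_MN[OF i] N.Ext_univ[OF x]]
              N.assignment_upd[OF e(2,1) univ_M_in_V[OF i] x] by (simp add: \<chi>_def)
          then show ?thesis
            using N.upd_commute[OF e(1) univ_MN[OF i] N.Ext_univ[OF x] jN aN False] by simp
        qed
        then show ?thesis
          using univ_MN[OF i] univ_MN[OF \<chi>] univ_MN[OF 5(3)]
          by (simp add: eq N.Sat_Ex[OF V_gamma_univ e] N.Sat_Ex[OF V_gamma_univ eN])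
      qed
    qed
  qed
  have "pair N k (pair N \<phi> \<phi>') \<in> Ext N f" using f_pair[OF k(1)] \<phi> k(2) univ_MN by blast
  moreover have "k \<in> Ext N n" using k(1) Ext_MN[OF nM(1)] by blast
  ultimately show ?thesis using main \<phi> univ_MN e by blast
qed

text \<open>Parameters occur as constants, so sentences are evaluated under the empty assignment. In
  the quantifier clause, being a sentence of M supplies a derivation of the body and thereby its
  instances, while \<open>witness_closed\<close> moves a witness from the level into M;
  \<open>Sat_subst\<close> links the witness to its instance.\<close>

lemma full_satisfaction_class_trace:
  assumes "witness_closed \<gamma>"
  shows "full_satisfaction_class M {\<phi> \<in> univ M. N.Sat (N.V \<gamma>) \<phi> N.zero}"
  unfolding full_satisfaction_class_def Tarski_clauses_def
proof (intro conjI allI ballI impI)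
  let ?u = "N.V \<gamma>"
  let ?S = "{\<phi> \<in> univ M. N.Sat ?u \<phi> N.zero}"
  note z = N.zero(1) N.assignment_zero[of ?u]
  show "?S \<subseteq> univ M" by blast
  fix x y assume xy: "x \<in> univ M" "y \<in> univ M"
  show "cEq M (cConst M x) (cConst M y) \<in> ?S \<longleftrightarrow> x = y"
  proof -
    have "cEq M (cConst M x) (cConst M y) = cEq N (cConst N x) (cConst N y)"
      using xy by (simp add: codes_MN)
    moreover have "cEq M (cConst M x) (cConst M y) \<in> univ M" using xy by simp
    ultimately show ?thesis
      using xy univ_MN univ_M_in_V N.Sat_Eq[OF V_gamma_univ z, of "cConst N x" "cConst N y"]
      by (auto simp: N.denotes_Const N.Ext_univ)
  qed
  show "cMem M (cConst M x) (cConst M y) \<in> ?S \<longleftrightarrow> x \<in> Ext M y"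
  proof -
    have "cMem M (cConst M x) (cConst M y) = cMem N (cConst N x) (cConst N y)"
      using xy by (simp add: codes_MN)
    moreover have "cMem M (cConst M x) (cConst M y) \<in> univ M" using xy by simp
    ultimately show ?thesis
      using xy univ_MN univ_M_in_V N.Sat_Mem[OF V_gamma_univ z, of "cConst N x" "cConst N y"] Ext_MN[OF xy(2)]
      by (auto simp: N.denotes_Const N.Ext_univ)
  qed
next
  fix \<psi> assume "\<psi> \<in> univ M"
  then show "cNeg M \<psi> \<in> {\<phi> \<in> univ M. N.Sat (N.V \<gamma>) \<phi> N.zero} \<longleftrightarrow>
      \<psi> \<notin> {\<phi> \<in> univ M. N.Sat (N.V \<gamma>) \<phi> N.zero}"
    using N.Sat_Neg[OF V_gamma_univ N.zero(1) N.assignment_zero univ_MN] by (simp add: codes_MN)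
next
  fix \<psi> \<chi> assume "\<psi> \<in> univ M" "\<chi> \<in> univ M"
  then show "cOr M \<psi> \<chi> \<in> {\<phi> \<in> univ M. N.Sat (N.V \<gamma>) \<phi> N.zero} \<longleftrightarrow>
      \<psi> \<in> {\<phi> \<in> univ M. N.Sat (N.V \<gamma>) \<phi> N.zero} \<or> \<chi> \<in> {\<phi> \<in> univ M. N.Sat (N.V \<gamma>) \<phi> N.zero}"
    using N.Sat_Or[OF V_gamma_univ N.zero(1) N.assignment_zero univ_MN univ_MN] by (simp add: codes_MN)
next
  fix k i \<psi>
  assume i: "i \<in> omega_in M" and \<psi>: "\<psi> \<in> univ M" and "cEx M i \<psi> \<in> Sigma_sentences M k"
  then have "generated M (fv_step M) (pair M (cEx M i \<psi>) M.zero)"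
    by (simp add: Sigma_sentences_def sentence_in_def M.zero_def)
  moreover have iM: "i \<in> univ M" using i M.omega_in_univ by blast
  ultimately obtain s where s: "s \<in> univ M" "generated M (fv_step M) (pair M \<psi> s)"
    using M.fv_generated_Ex[OF _ iM \<psi> M.zero(1)] by blast
  have subst: "N.Sat (N.V \<gamma>) \<psi>' N.zero \<longleftrightarrow> N.Sat (N.V \<gamma>) \<psi> (N.upd N.zero i x)"
    if "is_subst M i x \<psi> \<psi>'" "x \<in> univ M" for x \<psi>'
    using Sat_subst[OF that(1) iM that(2) N.zero(1) N.assignment_zero] .
  have "cEx M i \<psi> \<in> {\<phi> \<in> univ M. N.Sat (N.V \<gamma>) \<phi> N.zero} \<longleftrightarrow>
      (\<exists>x\<in>Ext N (N.V \<gamma>). N.Sat (N.V \<gamma>) \<psi> (N.upd N.zero i x))"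
    using N.Sat_Ex[OF V_gamma_univ N.zero(1) N.assignment_zero univ_MN[OF iM] univ_MN[OF \<psi>]] iM \<psi>
    by (simp add: codes_MN)
  also have "\<dots> \<longleftrightarrow> (\<exists>x\<in>univ M. N.Sat (N.V \<gamma>) \<psi> (N.upd N.zero i x))"
    using assms \<psi> iM univ_M_in_V M.zero(1) unfolding witness_closed_def zero_MN by blast
  also have "\<dots> \<longleftrightarrow> (\<exists>x\<in>univ M. \<exists>\<psi>'. is_subst M i x \<psi> \<psi>' \<and> \<psi>' \<in> {\<phi> \<in> univ M. N.Sat (N.V \<gamma>) \<phi> N.zero})"
    (is "?L \<longleftrightarrow> ?R")
  proof
    assume ?L
    then obtain x where x: "x \<in> univ M" "N.Sat (N.V \<gamma>) \<psi> (N.upd N.zero i x)" by blast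
    have "is_subst M i x \<psi> (M.sub i x \<psi>)" by (rule M.is_subst_exists[OF s(2) \<psi> s(1) iM x(1)])
    moreover from this have "N.Sat (N.V \<gamma>) (M.sub i x \<psi>) N.zero" using subst x by blast
    ultimately show ?R using x(1) unfolding is_subst_def by blast
  next
    assume ?R
    then show ?L using subst by blast
  qed
  finally show "cEx M i \<psi> \<in> {\<phi> \<in> univ M. N.Sat (N.V \<gamma>) \<phi> N.zero} \<longleftrightarrow>
    (\<exists>x\<in>univ M. \<exists>\<psi>'. is_subst M i x \<psi> \<psi>' \<and> \<psi>' \<in> {\<phi> \<in> univ M. N.Sat (N.V \<gamma>) \<phi> N.zero})" .
qed

lemma definable_Sat: "definable N {\<phi> \<in> univ N. N.Sat (N.V \<gamma>) \<phi> N.zero}"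
  by (rule Def_definable) (intro N.Def_Sat N.tm_v tm_const V_gamma_univ N.zero)

section \<open>Elementarity of M in the substructure on a level of N\<close>

lemma V_substructure_eq: "V_substructure N \<gamma> = restrict_struct N (Ext N (N.V \<gamma>))"
proof -
  have "{m \<in> univ N. \<exists>v. is_V N \<gamma> v \<and> m \<in> Ext N v} = Ext N (N.V \<gamma>)"
    unfolding N.is_V_iff using \<gamma> N.Ext_univ by blast
  then show ?thesis by (simp add: V_substructure_def)
qed

lemma univ_V_substructure: "univ (V_substructure N \<gamma>) = Ext N (N.V \<gamma>)"
  unfolding V_substructure_eq restrict_struct_def using N.Ext_univ by auto

lemma Ext_V_substructure:
  assumes "c \<in> Ext N (N.V \<gamma>)"
  shows "Ext (V_substructure N \<gamma>) c = Ext N c \<inter> Ext N (N.V \<gamma>)"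
proof -
  have "Ext (restrict_struct N A) c = Ext N c \<inter> A" if "c \<in> A" for A
    using that by (auto simp: Ext_def restrict_struct_def)
  then show ?thesis using assms unfolding V_substructure_eq by blast
qed

lemma code_univ: "code N p \<in> univ M"
  by (induction p) (simp_all add: numeral_MN codes_MN M.numeral_in)

text \<open>An assignment of the metatheory need not be coded in M, but its first \<open>m\<close>
  values are (\<open>represents_exists\<close>), and these suffice for one formula.\<close>

definition represents :: "'a \<Rightarrow> nat \<Rightarrow> (nat \<Rightarrow> 'a) \<Rightarrow> bool" where
  "represents e m \<epsilon> \<longleftrightarrow> (\<forall>k<m. \<forall>x\<in>univ N. pair N (numeral_in N k) x \<in> Ext N e \<longleftrightarrow> x = \<epsilon> k)"

lemma represents_upd:
  assumes "represents e m \<epsilon>" "e \<in> univ N" "x \<in> univ N"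
  shows "represents (N.upd e (numeral_in N i) x) m (\<epsilon>(i := x))"
  using assms unfolding represents_def by (simp add: N.pair_mem_upd N.numeral_in)

lemma represents_exists:
  assumes "range \<epsilon> \<subseteq> univ M"
  shows "\<exists>e\<in>univ M. N.assignment (N.V \<gamma>) e \<and> represents e m \<epsilon>"
proof (induction m)
  case 0
  show ?case using M.zero(1) N.assignment_zero by (auto simp: represents_def simp flip: zero_MN)
next
  case (Suc m)
  then obtain e where e: "e \<in> univ M" "N.assignment (N.V \<gamma>) e" "represents e m \<epsilon>" by blast
  have num: "numeral_in N m \<in> univ M" by (simp add: numeral_MN M.numeral_in)
  have \<epsilon>m: "\<epsilon> m \<in> univ M" using assms by auto
  have "represents (N.upd e (numeral_in N m) (\<epsilon> m)) (Suc m) \<epsilon>"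
    using e(3) univ_MN[OF e(1)] univ_MN[OF \<epsilon>m]
    by (auto simp: represents_def N.pair_mem_upd N.numeral_in less_Suc_eq)
  then show ?case
    using upd_in_M[OF e(1) num \<epsilon>m] N.assignment_upd[OF e(2) univ_MN[OF e(1)] univ_M_in_V[OF num] univ_M_in_V[OF \<epsilon>m]]
    by blast
qed

text \<open>Induction in the metatheory on a standard formula. The quantifiers of both sides range
  over the elements of the level, so the witnesses need not lie in M here.\<close>

lemma sat_code:
  assumes "X_free p" "fm_vars p \<subseteq> {..<m}" "range \<epsilon> \<subseteq> Ext N (N.V \<gamma>)" "e \<in> univ N"
    "N.assignment (N.V \<gamma>) e" "represents e m \<epsilon>"
  shows "sat (V_substructure N \<gamma>) {} \<epsilon> p \<longleftrightarrow> N.Sat (N.V \<gamma>) (code N p) e"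
  using assms
proof (induction p arbitrary: \<epsilon> e)
  case (EqF i j)
  have den: "N.denotes (cVar N (numeral_in N k)) e x \<longleftrightarrow> x = \<epsilon> k" if "k < m" "x \<in> univ N" for k x
    using that EqF.prems(6) by (simp add: N.denotes_Var N.numeral_in represents_def)
  have "\<epsilon> i \<in> Ext N (N.V \<gamma>)" "\<epsilon> j \<in> Ext N (N.V \<gamma>)" using EqF.prems(3) by auto
  then show ?case
    using EqF.prems N.Ext_univ
    by (auto simp: N.Sat_Eq[OF V_gamma_univ EqF.prems(4,5)] N.numeral_in den)
next
  case (MemF i j)
  have den: "N.denotes (cVar N (numeral_in N k)) e x \<longleftrightarrow> x = \<epsilon> k" if "k < m" "x \<in> univ N" for k x
    using that MemF.prems(6) by (simp add: N.denotes_Var N.numeral_in represents_def)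
  have "\<epsilon> i \<in> Ext N (N.V \<gamma>)" "\<epsilon> j \<in> Ext N (N.V \<gamma>)" using MemF.prems(3) by auto
  then show ?case
    using MemF.prems N.Ext_univ
    by (auto simp: N.Sat_Mem[OF V_gamma_univ MemF.prems(4,5)] N.numeral_in den Ext_V_substructure)
next
  case (XF i)
  then show ?case by simp
next
  case (NegF p)
  have "sat (V_substructure N \<gamma>) {} \<epsilon> p \<longleftrightarrow> N.Sat (N.V \<gamma>) (code N p) e"
    by (rule NegF.IH) (use NegF.prems in simp_all)
  then show ?case
    using N.Sat_Neg[OF V_gamma_univ NegF.prems(4,5) univ_MN[OF code_univ]] by simp
next
  case (OrF p q)
  have "sat (V_substructure N \<gamma>) {} \<epsilon> p \<longleftrightarrow> N.Sat (N.V \<gamma>) (code N p) e"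
    by (rule OrF.IH(1)) (use OrF.prems in simp_all)
  moreover have "sat (V_substructure N \<gamma>) {} \<epsilon> q \<longleftrightarrow> N.Sat (N.V \<gamma>) (code N q) e"
    by (rule OrF.IH(2)) (use OrF.prems in simp_all)
  ultimately show ?case
    using N.Sat_Or[OF V_gamma_univ OrF.prems(4,5) univ_MN[OF code_univ] univ_MN[OF code_univ]] by simp
next
  case (ExF i p)
  have num: "numeral_in N i \<in> univ M" by (simp add: numeral_MN M.numeral_in)
  have "sat (V_substructure N \<gamma>) {} (\<epsilon>(i := a)) p \<longleftrightarrow>
      N.Sat (N.V \<gamma>) (code N p) (N.upd e (numeral_in N i) a)" if a: "a \<in> Ext N (N.V \<gamma>)" for a
  proof (rule ExF.IH)
    show "range (\<epsilon>(i := a)) \<subseteq> Ext N (N.V \<gamma>)" using ExF.prems(3) a by auto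
    show "N.upd e (numeral_in N i) a \<in> univ N"
      using N.upd(1)[OF ExF.prems(4) N.numeral_in(1) N.Ext_univ[OF a]] .
    show "N.assignment (N.V \<gamma>) (N.upd e (numeral_in N i) a)"
      using N.assignment_upd[OF ExF.prems(5,4) univ_M_in_V[OF num] a] .
    show "represents (N.upd e (numeral_in N i) a) m (\<epsilon>(i := a))"
      using represents_upd[OF ExF.prems(6,4) N.Ext_univ[OF a]] .
  qed (use ExF.prems in simp_all)
  then show ?case
    using N.Sat_Ex[OF V_gamma_univ ExF.prems(4,5) univ_MN[OF num] univ_MN[OF code_univ]]
    by (simp add: univ_V_substructure)
qed

text \<open>The Tarski-Vaught test: in the quantifier case \<open>sat_code\<close> turns the formula
  into a code under an assignment in M, so \<open>witness_closed\<close> yields a witness in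
  M.\<close>

lemma sat_V_substructure:
  assumes closed: "witness_closed \<gamma>" and "X_free p" "range \<epsilon> \<subseteq> univ M"
  shows "sat M {} \<epsilon> p \<longleftrightarrow> sat (V_substructure N \<gamma>) {} \<epsilon> p"
  using assms(2,3)
proof (induction p arbitrary: \<epsilon>)
  case (MemF i j)
  have "\<epsilon> i \<in> univ M" "\<epsilon> j \<in> univ M" using MemF.prems(2) by auto
  then show ?case using univ_M_in_V by (simp add: Ext_V_substructure Ext_MN)
next
  case (OrF p q)
  then show ?case using OrF.IH(1)[of \<epsilon>] OrF.IH(2)[of \<epsilon>] by simp
next
  case (NegF p)
  then show ?case using NegF.IH[of \<epsilon>] by simp
next
  case (ExF i p)
  have IH: "sat M {} (\<epsilon>(i := a)) p \<longleftrightarrow> sat (V_substructure N \<gamma>) {} (\<epsilon>(i := a)) p"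
    if "a \<in> univ M" for a
    by (rule ExF.IH) (use ExF.prems that in auto)
  have "\<exists>b\<in>univ M. sat (V_substructure N \<gamma>) {} (\<epsilon>(i := b)) p"
    if a: "a \<in> Ext N (N.V \<gamma>)" and sat: "sat (V_substructure N \<gamma>) {} (\<epsilon>(i := a)) p" for a
  proof -
    obtain m where m: "fm_vars p \<subseteq> {..<m}"
      using finite_fm_vars[of p] unfolding finite_nat_set_iff_bounded by blast
    obtain e where e: "e \<in> univ M" "N.assignment (N.V \<gamma>) e" "represents e m \<epsilon>"
      using represents_exists[OF ExF.prems(2)] by blast
    have num: "numeral_in N i \<in> univ M" by (simp add: numeral_MN M.numeral_in)
    have eq: "sat (V_substructure N \<gamma>) {} (\<epsilon>(i := x)) p \<longleftrightarrow>
        N.Sat (N.V \<gamma>) (code N p) (N.upd e (numeral_in N i) x)" if x: "x \<in> Ext N (N.V \<gamma>)" for x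
    proof (rule sat_code[OF _ m])
      show "range (\<epsilon>(i := x)) \<subseteq> Ext N (N.V \<gamma>)" using ExF.prems(2) univ_M_in_V x by auto
      show "N.upd e (numeral_in N i) x \<in> univ N"
        using N.upd(1)[OF univ_MN[OF e(1)] N.numeral_in(1) N.Ext_univ[OF x]] .
      show "N.assignment (N.V \<gamma>) (N.upd e (numeral_in N i) x)"
        using N.assignment_upd[OF e(2) univ_MN[OF e(1)] univ_M_in_V[OF num] x] .
      show "represents (N.upd e (numeral_in N i) x) m (\<epsilon>(i := x))"
        using represents_upd[OF e(3) univ_MN[OF e(1)] N.Ext_univ[OF x]] .
    qed (use ExF.prems in simp)
    obtain b where "b \<in> univ M" "N.Sat (N.V \<gamma>) (code N p) (N.upd e (numeral_in N i) b)"
      using closed code_univ e(1) num a eq[OF a] sat unfolding witness_closed_def by blast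
    then show ?thesis using eq univ_M_in_V by blast
  qed
  then show ?case using IH univ_M_in_V unfolding sat.simps univ_V_substructure by blast
qed simp_all

lemma elementary_V_substructure:
  assumes "witness_closed \<gamma>"
  shows "elementary_sub M (V_substructure N \<gamma>)"
proof -
  have "mem M = mem (V_substructure N \<gamma>) \<inter> univ M \<times> univ M"
    using substructure univ_M_in_V unfolding substructure_def V_substructure_eq restrict_struct_def by auto
  then have "substructure M (V_substructure N \<gamma>)"
    unfolding substructure_def univ_V_substructure using univ_M_in_V by blast
  then show ?thesis unfolding elementary_sub_def using sat_V_substructure[OF assms] by blast
qed

text \<open>An ordinal below \<open>\<gamma>\<close> is an element of the level of
  \<open>\<gamma>\<close>, hence of M; so \<open>\<gamma>\<close> is the least ordinal outside
  M.\<close>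

lemma topped_rank_extension_if_eq:
  assumes "M = V_substructure N \<gamma>" shows "topped_rank_extension M N"
proof -
  have u: "univ M = Ext N (N.V \<gamma>)" using univ_V_substructure assms by simp
  have "\<gamma> = \<delta> \<or> \<gamma> \<in> Ext N \<delta>" if \<delta>: "\<delta> \<in> Ord N" "\<delta> \<notin> univ M" for \<delta>
  proof (rule ccontr)
    assume "\<not> ?thesis"
    then have "\<delta> \<in> Ext N \<gamma>" using N.Ord_linear[OF \<gamma>(1) \<delta>(1)] by blast
    moreover have "Ext N \<delta> \<subseteq> Ext N (N.V \<delta>)" using N.subset_V_self N.Ord_univ[OF \<delta>(1)] .
    ultimately have "\<delta> \<in> Ext N (N.V \<gamma>)"
      using N.Ord_univ[OF \<delta>(1)] unfolding N.Ext_V[OF N.Ord_univ[OF \<gamma>(1)]] by blast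
    then show False using \<delta> u by blast
  qed
  moreover have "\<gamma> \<in> Ord N - Ord M" using \<gamma> Ord_new by blast
  ultimately show ?thesis
    unfolding topped_rank_extension_def using rank_extension Ord_new by blast
qed

end

end

theorem theorem4p4:
  fixes M N :: "'a sstruct"
  assumes "set_structure M" and "set_structure N"
    and "models_ZF M" and "models_ZF N"
    and "end_extension M N" and "M \<noteq> N"
    and "faithful_extension M N"
  shows "(\<exists>\<gamma>\<in>Ord N - Ord M. elementary_sub M (V_substructure N \<gamma>) \<and>
            (M = V_substructure N \<gamma> \<and> topped_rank_extension M N \<or>
             proper_elementary_sub M (V_substructure N \<gamma>))) \<and>
         (\<exists>S. full_satisfaction_class M S \<and> (\<exists>D. definable N D \<and> S = D \<inter> univ M))"
proof -
  interpret faithful_end_extension M N by unfold_locales (rule assms)+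
  obtain \<gamma> where \<gamma>: "\<gamma> \<in> Ord N" "\<gamma> \<notin> univ M"
    and closed: "witness_closed \<gamma>"
    using witness_ordinal by blast
  have el: "elementary_sub M (V_substructure N \<gamma>)"
    by (rule elementary_V_substructure[OF \<gamma> closed])
  have "M = V_substructure N \<gamma> \<and> topped_rank_extension M N \<or>
      proper_elementary_sub M (V_substructure N \<gamma>)"
    using el topped_rank_extension_if_eq[OF \<gamma>] unfolding proper_elementary_sub_def by blast
  moreover have "\<gamma> \<in> Ord N - Ord M" using \<gamma> Ord_new by blast
  moreover have "{\<phi> \<in> univ M. N.Sat (N.V \<gamma>) \<phi> N.zero} = {\<phi> \<in> univ N. N.Sat (N.V \<gamma>) \<phi> N.zero} \<inter> univ M"
    using univ_MN by blast
  ultimately show ?thesis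
    using el full_satisfaction_class_trace[OF \<gamma> closed] definable_Sat[OF \<gamma>] by blast
qed

end
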